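(* Let $\Theta\subset\mathbb{R}^p$ be a nonempty connected open set and $0<\alpha\le\beta$, $0<\underline{\lambda}\le\bar\lambda$. For each $\theta\in\Theta$ let $f_\theta:\mathbb{R}^n\to\mathbb{R}$ be $C^1$, $\alpha$-strongly convex with $\beta$-Lipschitz gradient, $g_\theta:\mathbb{R}^m\to\mathbb{R}\cup\{+\infty\}$ closed convex proper, and $K_\theta\in\mathbb{R}^{m\times n}$ surjective with all singular values in $[\underline{\lambda},\bar\lambda]$. Then: (i) for each $\theta$, the function $\varphi_\theta(y):=f_\theta^*(-K_\theta^* y)$ is $\underline{\lambda}^2/\beta$-strongly convex on $\mathbb{R}^m$ and differentiable with $\bar\lambda^2/\alpha$-Lipschitz gradient $\nabla\varphi_\theta(y)=-K_\theta\nabla f_\theta^*(-K_\theta^*y)$. (ii) Let $a=\underline{\lambda}^2/\beta$, $b=\bar\lambda^2/\alpha$, $\gamma\in\big(0,\frac{2a}{(a+b)^2}\big)$, and assume that $T(\theta,y):=\mathrm{prox}_{\gamma g_\theta^*}(y)$ and $(\theta,y)\mapsto\nabla\varphi_\theta(y)$ are path differentiable jointly in $(\theta,y)\in\Theta\times\mathbb{R}^m$. Then the dual problem $\min_{y\in\mathbb{R}^m} f_\theta^*(-K_\theta^*y)+g_\theta^*(y)$ has a unique solution $y^\star(\theta)$ for each $\theta$, and $\theta\mapsto y^\star(\theta)$ is path differentiable on $\Theta$ with conservative Jacobian $$\mathcal{J}_{y^\star}(\theta)=\Big\{\big(\mathrm{Id}_m-V(\mathrm{Id}_m-\gamma Z)\big)^{-1}\big(U-\gamma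 VW\big):[U\ V]\in\mathrm{Jac}^c_T\big(\theta,\,y^\star(\theta)+\gamma K_\theta\nabla f_\theta^*(-K_\theta^*y^\star(\theta))\big),\ [W\ Z]\in\mathrm{Jac}^c_{\nabla\varphi}(\theta,y^\star(\theta))\Big\},$$ where $\mathrm{Jac}^c_{\nabla\varphi}$ is the joint Clarke Jacobian of $(\theta,y)\mapsto\nabla\varphi_\theta(y)$.
   Context: $h^*(y)=\sup_u\langle y,u\rangle-h(u)$ is the convex conjugate; $\mathrm{prox}_g(x)=\mathrm{argmin}_u\, g(u)+\frac12\|x-u\|^2$. Clarke Jacobian: for a locally Lipschitz $F:\mathbb{R}^N\to\mathbb{R}^k$, $\mathrm{Jac}^c_F(z)=\mathrm{conv}\{\lim_j \mathrm{Jac}_F(z_j): z_j\to z,\ F \text{ differentiable at } z_j\}$. A conservative Jacobian for a locally Lipschitz $F$ is a set-valued map $\mathcal{J}_F$ with nonempty values, locally bounded, with closed graph, such that for every absolutely continuous curve $c:[0,1]\to\mathbb{R}^N$, for almost every $t$, $\frac{d}{dt}F(c(t))=M\dot c(t)$ for all $M\in\mathcal{J}_F(c(t))$. $F$ is path differentiable if it is locally Lipschitz and admits a conservative Jacobian. Jacobians of maps of $(\theta,y)$ are written in block form $[U\ V]$ with $U$ the $\theta$-block and $V$ the $y$-block of the joint Jacobian. *)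

theory Defs
  imports "HOL-Analysis.Analysis" "HOL-Library.Extended_Real"
begin

definition conjugate :: "('a::real_inner \<Rightarrow> ereal) \<Rightarrow> 'a \<Rightarrow> ereal" where
  "conjugate h y = (SUP u. ereal (inner y u) - h u)"

definition prox :: "('a::real_normed_vector \<Rightarrow> ereal) \<Rightarrow> 'a \<Rightarrow> 'a" where
  "prox h x = arg_min (\<lambda>u. h u + ereal ((1/2) * (norm (x - u))\<^sup>2)) (\<lambda>_. True)"

definition epi :: "('a \<Rightarrow> ereal) \<Rightarrow> ('a \<times> real) set" where
  "epi h = {(x, t). h x \<le> ereal t}"

definition closed_convex_proper :: "('a::real_normed_vector \<Rightarrow> ereal) \<Rightarrow> bool" where
  "closed_convex_proper h \<longleftrightarrow>
     (\<forall>x. h x \<noteq> -\<infinity>) \<and> (\<exists>x. h x \<noteq> \<infinity>) \<and> convex (epi h) \<and> closed (epi h)"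

definition strongly_convex_on :: "real \<Rightarrow> 'a::real_inner set \<Rightarrow> ('a \<Rightarrow> real) \<Rightarrow> bool" where
  "strongly_convex_on \<mu> S h \<longleftrightarrow> convex_on S (\<lambda>x. h x - (\<mu> / 2) * (norm x)\<^sup>2)"

definition gradient :: "('a::real_inner \<Rightarrow> real) \<Rightarrow> 'a \<Rightarrow> 'a" where
  "gradient h x = (THE D. GDERIV h x :> D)"

text \<open>sigma is a singular value of the m x n matrix K (m \<le> n): sigma \<ge> 0 and
  sigma^2 is an eigenvalue of K K^T.\<close>
definition singular_value :: "real^'n^'m \<Rightarrow> real \<Rightarrow> bool" where
  "singular_value K \<sigma> \<longleftrightarrow> \<sigma> \<ge> 0 \<and>
     (\<exists>v. v \<noteq> 0 \<and> (K ** transpose K) *v v = (\<sigma>\<^sup>2) *\<^sub>R v)"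

definition loc_lipschitz_on :: "'a::metric_space set \<Rightarrow> ('a \<Rightarrow> 'b::metric_space) \<Rightarrow> bool" where
  "loc_lipschitz_on S F \<longleftrightarrow> (\<forall>x\<in>S. \<exists>e>0. \<exists>L. L-lipschitz_on (ball x e \<inter> S) F)"

definition abs_cont_curve :: "(real \<Rightarrow> 'a::real_normed_vector) \<Rightarrow> bool" where
  "abs_cont_curve c \<longleftrightarrow>
     (\<forall>\<epsilon>>0. \<exists>\<delta>>0. \<forall>(n::nat) (a::nat\<Rightarrow>real) b.
        (\<forall>i<n. 0 \<le> a i \<and> a i \<le> b i \<and> b i \<le> 1) \<and>
        (\<forall>i<n. \<forall>j<n. i \<noteq> j \<longrightarrow> b i \<le> a j \<or> b j \<le> a i) \<and>
        (\<Sum>i<n. b i - a i) < \<delta>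
        \<longrightarrow> (\<Sum>i<n. norm (c (b i) - c (a i))) < \<epsilon>)"

definition conservative_jac_on ::
  "(real^'N) set \<Rightarrow> (real^'N \<Rightarrow> real^'k) \<Rightarrow> (real^'N \<Rightarrow> (real^'N^'k) set) \<Rightarrow> bool" where
  "conservative_jac_on S F J \<longleftrightarrow>
     (\<forall>z\<in>S. J z \<noteq> {}) \<and>
     (\<forall>z\<in>S. \<exists>e>0. \<exists>B. \<forall>z'\<in>ball z e \<inter> S. \<forall>M\<in>J z'. norm M \<le> B) \<and>
     closedin (top_of_set (S \<times> UNIV)) {(z, M). z \<in> S \<and> M \<in> J z} \<and>
     (\<forall>c. abs_cont_curve c \<and> c ` {0..1} \<subseteq> S \<longrightarrow>
        (AE t in lebesgue. t \<in> {0..1} \<longrightarrow>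
           (\<exists>dc dF. (c has_vector_derivative dc) (at t within {0..1}) \<and>
                    ((F \<circ> c) has_vector_derivative dF) (at t within {0..1}) \<and>
                    (\<forall>M\<in>J (c t). dF = M *v dc))))"

definition path_differentiable_on :: "(real^'N) set \<Rightarrow> (real^'N \<Rightarrow> real^'k) \<Rightarrow> bool" where
  "path_differentiable_on S F \<longleftrightarrow>
     loc_lipschitz_on S F \<and> (\<exists>J. conservative_jac_on S F J)"

definition clarke_jac_on ::
  "(real^'N) set \<Rightarrow> (real^'N \<Rightarrow> real^'k) \<Rightarrow> real^'N \<Rightarrow> (real^'N^'k) set" where
  "clarke_jac_on S F z = convex hull
     {M. \<exists>zs. (\<forall>j. zs j \<in> S \<and> F differentiable (at (zs j))) \<and> zs \<longlonglongrightarrow> z \<and>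
            (\<lambda>j. matrix (frechet_derivative F (at (zs j)))) \<longlonglongrightarrow> M}"

definition jpair :: "real^('p::finite) \<Rightarrow> real^('m::finite) \<Rightarrow> real^('p + 'm)" where
  "jpair \<theta> y = (\<chi> i. case i of Inl j \<Rightarrow> \<theta> $ j | Inr j \<Rightarrow> y $ j)"

definition jfst :: "real^('p::finite + 'm::finite) \<Rightarrow> real^'p" where
  "jfst z = (\<chi> j. z $ Inl j)"

definition jsnd :: "real^('p::finite + 'm::finite) \<Rightarrow> real^'m" where
  "jsnd z = (\<chi> j. z $ Inr j)"

definition blk1 :: "real^('p::finite + 'm::finite)^'k \<Rightarrow> real^'p^'k" where
  "blk1 M = (\<chi> i j. M $ i $ Inl j)"

definition blk2 :: "real^('p::finite + 'm::finite)^'k \<Rightarrow> real^'m^'k" where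
  "blk2 M = (\<chi> i j. M $ i $ Inr j)"

end

theory Submission
  imports Defs
begin

text \<open>The dual solution is the fixed point of the forward-backward map
  \<open>y \<mapsto> T(\<theta>, y - \<gamma>\<nabla>\<phi>\<^sub>\<theta>(y))\<close>, which contracts in \<open>y\<close> because the prox is nonexpansive and
  \<open>\<phi>\<^sub>\<theta>\<close> is strongly convex with Lipschitz gradient. Hence the solution is locally Lipschitz in
  \<open>\<theta>\<close>, and differentiating the fixed-point equation along an absolutely continuous curve gives a
  linear equation whose unique solution is the stated formula.

  What makes the differentiation legitimate is that the Clarke Jacobian of a path differentiable map
  is itself conservative. If all elements of a conservative Jacobian \<open>J(z)\<close> agree on a direction
  \<open>d\<close>, upper semicontinuity and the mean value inequality along segments make the difference
  quotients of the map in direction \<open>d\<close> near \<open>z\<close> almost constant, so limits of nearby Jacobians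
  agree with \<open>J(z)\<close> on \<open>d\<close>. Nonemptiness does not need Rademacher's theorem: by Baire's
  theorem the points where \<open>J\<close> is a singleton are dense, and there the map is differentiable.\<close>

section \<open>Conservative Jacobians\<close>

text \<open>Path differentiability only provides some conservative Jacobian \<open>J\<close>,
  whereas the formula is about Clarke Jacobians. The two sets are compared one direction at a time:
  at almost every time of a curve all of \<open>J (c t)\<close> agrees on the single vector
  \<open>dc\<close>, and this agreement passes to the Clarke Jacobian at the same \<open>t\<close>,
  with the same exceptional null set.

  Differentiability of \<open>ys\<close> along a curve is obtained by lifting the curve to the graph
  of \<open>ys\<close>. The lifted curve is absolutely continuous because \<open>ys\<close> is
  locally Lipschitz, and conservativity of the gradient map on it delivers the derivatives of both
  components.

  The bound on \<gamma> enters through the contraction constant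
  \<open>sqrt (1 - 2 * \<gamma> * a + \<gamma>\<^sup>2 * b\<^sup>2)\<close>, which is below 1 once
  \<open>\<gamma> * b\<^sup>2 < 2 * a\<close>. Nonexpansiveness of the prox and contraction of the
  gradient step are closed convex conditions on Jacobians in y-directions, so they survive limits
  and convex hulls; on Clarke Jacobians they make the linearised equation uniquely solvable, which
  is why the inverse in the formula exists.\<close>

text \<open>Mean value inequality by bisection. Off the null set short increments are controlled by
  the derivative; on it they are controlled by the Lipschitz constant times the measure of a small
  open cover.\<close>

lemma lipschitz_ae_vector_derivative_bound:
  fixes h :: "real \<Rightarrow> 'a::real_normed_vector"
  assumes lip: "L-lipschitz_on {0..1} h"
    and der: "AE t in lebesgue. t \<in> {0..1} \<longrightarrow>
      (\<exists>D. (h has_vector_derivative D) (at t within {0..1}) \<and> norm D \<le> e)"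
    and e: "0 \<le> e"
  shows "norm (h 1 - h 0) \<le> e"
proof (rule field_le_epsilon)
  fix \<eta> :: real assume \<eta>: "0 < \<eta>"
  have L: "0 \<le> L" using lip by (rule lipschitz_on_nonneg)
  \<comment> \<open>Half of the slack \<eta> pays for \<open>L * \<epsilon>\<close>, the other half
    for the first-order error; \<open>L + 1\<close> keeps the quotient meaningful for
    \<open>L = 0\<close>.\<close>
  define \<epsilon> where "\<epsilon> = \<eta> / (2 * (L + 1))"
  have \<epsilon>: "0 < \<epsilon>" using \<eta> L by (simp add: \<epsilon>_def)
  have L\<epsilon>: "L * \<epsilon> \<le> \<eta> / 2" using \<eta> L by (simp add: \<epsilon>_def field_simps)
  obtain N where N0: "\<And>t. t \<in> space lebesgue - N \<Longrightarrow> t \<in> {0..1} \<longrightarrow>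
      (\<exists>D. (h has_vector_derivative D) (at t within {0..1}) \<and> norm D \<le> e)" "N \<in> null_sets lebesgue"
    using AE_E3[OF der] by blast
  then have N: "N \<in> null_sets lebesgue"
    "\<And>t. t \<in> {0..1} \<Longrightarrow> t \<notin> N \<Longrightarrow> \<exists>D. (h has_vector_derivative D) (at t within {0..1}) \<and> norm D \<le> e"
    by simp_all
  \<comment> \<open>The exceptional set is covered by a small open set, where the Lipschitz bound takes over.\<close>
  obtain U where U: "open U" "N \<subseteq> U" "emeasure lebesgue (U - N) < ennreal \<epsilon>"
    using sets_lebesgue_outer_open[OF null_setsD2[OF N(1)] \<epsilon>] by metis
  have Us: "U \<in> sets lebesgue" using U(1) by (simp add: borel_open)
  have emU: "emeasure lebesgue U < ennreal \<epsilon>"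
    using U(3) emeasure_Diff_null_set[OF N(1) Us] by simp
  \<comment> \<open>Half-open intervals make \<open>m\<close> exactly additive over adjacent
    intervals.\<close>
  define m where "m a b = measure lebesgue (U \<inter> {a<..b})" for a b :: real
  have ms: "U \<inter> {a<..b} \<in> lmeasurable" for a b :: real
  proof (rule fmeasurableI)
    show "U \<inter> {a<..b} \<in> sets lebesgue" using Us by auto
    have "emeasure lebesgue (U \<inter> {a<..b}) \<le> emeasure lebesgue U"
      using Us by (intro emeasure_mono) auto
    then show "emeasure lebesgue (U \<inter> {a<..b}) < \<infinity>"
      using emU by (metis ennreal_less_top infinity_ennreal_def order_le_less_trans order_less_trans)
  qed
  \<comment> \<open>The bound is additive in the interval, so \<open>Bolzano\<close> reduces it to
    short intervals around each point.\<close>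
  define P where "P a b \<longleftrightarrow> 0 \<le> a \<and> b \<le> 1 \<longrightarrow>
    norm (h b - h a) \<le> (e + \<eta> / 2) * (b - a) + L * m a b" for a b
  have "(0::real) \<le> 1" by simp
  then have "P 0 1"
  proof (induction rule: Bolzano)
    case (trans a b c)
    show ?case unfolding P_def
    proof safe
      assume ac: "0 \<le> a" "c \<le> 1"
      have "U \<inter> {a<..c} = (U \<inter> {a<..b}) \<union> (U \<inter> {b<..c})"
        using trans(3,4) by auto
      moreover have "(U \<inter> {a<..b}) \<inter> (U \<inter> {b<..c}) = {}" by auto
      ultimately have m: "m a c = m a b + m b c"
        unfolding m_def using measure_Un3[OF ms ms, of a b b c] by simp
      have "norm (h c - h a) \<le> norm (h c - h b) + norm (h b - h a)"
        using norm_triangle_ineq[of "h c - h b" "h b - h a"] by simp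
      also have "\<dots> \<le> ((e + \<eta> / 2) * (c - b) + L * m b c) + ((e + \<eta> / 2) * (b - a) + L * m a b)"
        using trans ac unfolding P_def by (intro add_mono) auto
      finally show "norm (h c - h a) \<le> (e + \<eta> / 2) * (c - a) + L * m a c"
        by (simp add: m field_simps)
    qed
  next
    case (local x)
    show ?case
    proof (cases "x \<in> N")
      case True
      then obtain d where d: "d > 0" "ball x d \<subseteq> U" using U open_contains_ball by (metis subsetD)
      have "P a b" if "a \<le> x" "x \<le> b" "b - a < d" for a b
        unfolding P_def
      proof safe
        assume ab: "0 \<le> a" "b \<le> 1"
        have "U \<inter> {a<..b} = {a<..b}" using d(2) that by (auto simp: dist_real_def subset_eq)
        then have "m a b = b - a" using that by (simp add: m_def)
        moreover have "norm (h b - h a) \<le> L * (b - a)"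
          using lipschitz_onD[OF lip, of b a] that ab by (simp add: dist_norm)
        moreover have "0 \<le> (e + \<eta> / 2) * (b - a)" using e \<eta> that by auto
        ultimately show "norm (h b - h a) \<le> (e + \<eta> / 2) * (b - a) + L * m a b" by simp
      qed
      then show ?thesis using d by blast
    next
      case False
      then obtain D where D: "(h has_vector_derivative D) (at x within {0..1})" "norm D \<le> e"
        using N(2) local by auto
      obtain d where d: "d > 0" "\<And>y. y \<in> {0..1} \<Longrightarrow> norm (y - x) < d \<Longrightarrow>
          norm (h y - h x - (y - x) *\<^sub>R D) \<le> \<eta> / 2 * norm (y - x)"
        using D(1) \<eta> unfolding has_vector_derivative_def has_derivative_within_alt
        by (meson half_gt_zero)
      have "P a b" if ab: "a \<le> x" "x \<le> b" "b - a < d" for a b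
        unfolding P_def
      proof safe
        assume "0 \<le> a" "b \<le> 1"
        then have 1: "norm (h b - h x - (b - x) *\<^sub>R D) \<le> \<eta> / 2 * (b - x)"
          "norm (h a - h x - (a - x) *\<^sub>R D) \<le> \<eta> / 2 * (x - a)"
          using d(2)[of b] d(2)[of a] ab by auto
        have "h b - h a = (h b - h x - (b - x) *\<^sub>R D) - (h a - h x - (a - x) *\<^sub>R D) + (b - a) *\<^sub>R D"
          by (simp add: algebra_simps)
        also have "norm \<dots> \<le> norm (h b - h x - (b - x) *\<^sub>R D) + norm (h a - h x - (a - x) *\<^sub>R D)
            + norm ((b - a) *\<^sub>R D)"
          by (rule order_trans[OF norm_triangle_ineq add_right_mono[OF norm_triangle_ineq4]])
        also have "\<dots> \<le> \<eta> / 2 * (b - x) + \<eta> / 2 * (x - a) + (b - a) * e"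
          using 1 D(2) ab by (intro add_mono) (auto intro: mult_left_mono)
        also have "\<dots> = (e + \<eta> / 2) * (b - a)" by (simp add: field_simps)
        also have "\<dots> \<le> (e + \<eta> / 2) * (b - a) + L * m a b"
          using L by (simp add: m_def)
        finally show "norm (h b - h a) \<le> (e + \<eta> / 2) * (b - a) + L * m a b" .
      qed
      then show ?thesis using d(1) by blast
    qed
  qed
  then have "norm (h 1 - h 0) \<le> e + \<eta> / 2 + L * m 0 1" by (simp add: P_def)
  moreover have "m 0 1 \<le> \<epsilon>"
  proof -
    have "emeasure lebesgue (U \<inter> {0<..1}) \<le> ennreal \<epsilon>"
      using emU Us by (meson Int_lower1 emeasure_mono less_imp_le order_trans)
    then show ?thesis unfolding m_def measure_def using \<epsilon>
      by (simp add: enn2real_leI)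
  qed
  ultimately show "norm (h 1 - h 0) \<le> e + \<eta>"
    using mult_left_mono[of "m 0 1" \<epsilon> L] L L\<epsilon> by linarith
qed

lemma lipschitz_imp_abs_cont_curve:
  assumes "L-lipschitz_on {0..1} c"
  shows "abs_cont_curve c"
  unfolding abs_cont_curve_def
proof (intro allI impI)
  fix \<epsilon> :: real assume \<epsilon>: "0 < \<epsilon>"
  have L: "0 \<le> L" using assms by (rule lipschitz_on_nonneg)
  show "\<exists>\<delta>>0. \<forall>(n::nat) (a::nat\<Rightarrow>real) b.
        (\<forall>i<n. 0 \<le> a i \<and> a i \<le> b i \<and> b i \<le> 1) \<and>
        (\<forall>i<n. \<forall>j<n. i \<noteq> j \<longrightarrow> b i \<le> a j \<or> b j \<le> a i) \<and>
        (\<Sum>i<n. b i - a i) < \<delta>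
        \<longrightarrow> (\<Sum>i<n. norm (c (b i) - c (a i))) < \<epsilon>"
  proof (intro exI[of _ "\<epsilon> / (L + 1)"] conjI allI impI; (elim conjE)?)
    fix n :: nat and a b :: "nat \<Rightarrow> real"
    assume ab: "\<forall>i<n. 0 \<le> a i \<and> a i \<le> b i \<and> b i \<le> 1" and s: "(\<Sum>i<n. b i - a i) < \<epsilon> / (L + 1)"
    have "(\<Sum>i<n. norm (c (b i) - c (a i))) \<le> (\<Sum>i<n. L * (b i - a i))"
    proof (rule sum_mono)
      fix i assume "i \<in> {..<n}"
      then have "0 \<le> a i" "a i \<le> b i" "b i \<le> 1" using ab by auto
      then show "norm (c (b i) - c (a i)) \<le> L * (b i - a i)"
        using lipschitz_onD[OF assms, of "b i" "a i"] by (simp add: dist_norm)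
    qed
    also have "\<dots> = L * (\<Sum>i<n. b i - a i)" by (simp add: sum_distrib_left)
    also have "\<dots> \<le> L * (\<epsilon> / (L + 1))" using s L by (intro mult_left_mono) auto
    also have "\<dots> < \<epsilon>" using \<epsilon> L by (simp add: field_simps)
    finally show "(\<Sum>i<n. norm (c (b i) - c (a i))) < \<epsilon>" .
  qed (use \<epsilon> L in auto)
qed

lemma lipschitz_on_line: "(norm v)-lipschitz_on A (\<lambda>s. x + s *\<^sub>R v)"
  by (rule lipschitz_onI) (auto simp: dist_norm simp flip: scaleR_left_diff_distrib)

lemma conservative_jac_onD:
  assumes "conservative_jac_on S F J"
  shows "z \<in> S \<Longrightarrow> J z \<noteq> {}"
    and "z \<in> S \<Longrightarrow> \<exists>e>0. \<exists>B. \<forall>z'\<in>ball z e \<inter> S. \<forall>M\<in>J z'. norm M \<le> B"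
    and "closedin (top_of_set (S \<times> UNIV)) {(z, M). z \<in> S \<and> M \<in> J z}"
    and "abs_cont_curve c \<Longrightarrow> c ` {0..1} \<subseteq> S \<Longrightarrow>
        (AE t in lebesgue. t \<in> {0..1} \<longrightarrow>
           (\<exists>dc dF. (c has_vector_derivative dc) (at t within {0..1}) \<and>
                    ((F \<circ> c) has_vector_derivative dF) (at t within {0..1}) \<and>
                    (\<forall>M\<in>J (c t). dF = M *v dc)))"
  using assms unfolding conservative_jac_on_def by blast+

lemma vector_derivative_within_01_unique:
  assumes "t \<in> {0..1::real}" "(c has_vector_derivative a) (at t within {0..1})"
    "(c has_vector_derivative b) (at t within {0..1})"
  shows "a = b"
proof (rule vector_derivative_unique_within)
  show "at t within {0..1} \<noteq> bot"
    using assms(1) by (subst trivial_limit_within) auto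
qed (use assms in auto)

text \<open>The mean value inequality for a conservative Jacobian, with a free target
  \<open>q\<close>: it serves with \<open>q\<close> the image of \<open>y - x\<close> under a
  candidate derivative, and with \<open>q\<close> a multiple of a prescribed directional
  value.\<close>

lemma conservative_jac_on_segment_bound:
  assumes cons: "conservative_jac_on S F J"
    and seg: "closed_segment x y \<subseteq> S" and lip: "L-lipschitz_on (closed_segment x y) F"
    and e: "0 \<le> e"
    and bd: "\<And>z w. z \<in> closed_segment x y \<Longrightarrow> w \<in> J z \<Longrightarrow> norm (w *v (y - x) - q) \<le> e"
  shows "norm (F y - F x - q) \<le> e"
proof -
  define c where "c s = x + s *\<^sub>R (y - x)" for s :: real
  \<comment> \<open>Subtracting the uniform motion \<open>s *\<^sub>R q\<close> makes the derivative
    \<open>w *v (y - x) - q\<close> for every \<open>w\<close> in the Jacobian, which is what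
    \<open>bd\<close> controls.\<close>
  define h where "h s = F (c s) - s *\<^sub>R q" for s
  have cseg: "c s \<in> closed_segment x y" if "s \<in> {0..1}" for s
    using that unfolding c_def closed_segment_def
    by (auto intro!: exI[of _ s] simp: algebra_simps)
  have clip: "(norm (y - x))-lipschitz_on {0..1} c"
    unfolding c_def[abs_def] by (rule lipschitz_on_line)
  have "(L * norm (y - x))-lipschitz_on {0..1} (F \<circ> c)"
    using cseg by (intro lipschitz_on_compose[OF clip] lipschitz_on_subset[OF lip]) auto
  moreover have "(norm q)-lipschitz_on {0..1::real} (\<lambda>s. s *\<^sub>R q)"
    by (rule lipschitz_onI) (auto simp: dist_norm simp flip: scaleR_left_diff_distrib)
  ultimately have hlip: "(L * norm (y - x) + norm q)-lipschitz_on {0..1} h"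
    unfolding h_def[abs_def] o_def by (rule lipschitz_on_diff)
  have "AE t in lebesgue. t \<in> {0..1} \<longrightarrow>
           (\<exists>dc dF. (c has_vector_derivative dc) (at t within {0..1}) \<and>
                    ((F \<circ> c) has_vector_derivative dF) (at t within {0..1}) \<and>
                    (\<forall>M\<in>J (c t). dF = M *v dc))"
    using lipschitz_imp_abs_cont_curve[OF clip] cseg seg by (intro conservative_jac_onD(4)[OF cons]) auto
  then have "AE t in lebesgue. t \<in> {0..1} \<longrightarrow>
      (\<exists>D. (h has_vector_derivative D) (at t within {0..1}) \<and> norm D \<le> e)"
  proof (eventually_elim, intro impI)
    fix t :: real
    assume *: "t \<in> {0..1} \<longrightarrow>
           (\<exists>dc dF. (c has_vector_derivative dc) (at t within {0..1}) \<and>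
                    ((F \<circ> c) has_vector_derivative dF) (at t within {0..1}) \<and>
                    (\<forall>M\<in>J (c t). dF = M *v dc))" and t: "t \<in> {0..1}"
    then obtain dc dF where d: "(c has_vector_derivative dc) (at t within {0..1})"
      "((F \<circ> c) has_vector_derivative dF) (at t within {0..1})" "\<And>M. M\<in>J (c t) \<Longrightarrow> dF = M *v dc" by blast
    have "(c has_vector_derivative (y - x)) (at t within {0..1})"
      unfolding c_def by (auto intro!: derivative_eq_intros)
    then have dc: "dc = y - x" using vector_derivative_within_01_unique[OF t d(1)] by simp
    have "J (c t) \<noteq> {}" using conservative_jac_onD(1)[OF cons] cseg[OF t] seg by auto
    then obtain w where w: "w \<in> J (c t)" by auto
    have "(h has_vector_derivative (dF - q)) (at t within {0..1})"
      unfolding h_def using d(2) by (auto intro!: derivative_eq_intros simp: o_def)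
    moreover have "norm (dF - q) \<le> e" using bd[OF cseg[OF t] w] d(3)[OF w] dc by simp
    ultimately show "\<exists>D. (h has_vector_derivative D) (at t within {0..1}) \<and> norm D \<le> e" by blast
  qed
  from lipschitz_ae_vector_derivative_bound[OF hlip this e]
  show ?thesis by (simp add: h_def c_def diff_diff_eq add.commute)
qed

section \<open>Upper semicontinuous compact-valued maps\<close>

text \<open>``Usco'': upper semicontinuous with compact values, which is what local boundedness and a
  closed graph amount to.\<close>

definition usco_on :: "'a::metric_space set \<Rightarrow> ('a \<Rightarrow> 'b::real_normed_vector set) \<Rightarrow> bool" where
  "usco_on S J \<longleftrightarrow>
     (\<forall>z\<in>S. \<exists>e>0. \<exists>B. \<forall>z'\<in>ball z e \<inter> S. \<forall>M\<in>J z'. norm M \<le> B) \<and>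
     closedin (top_of_set (S \<times> UNIV)) {(z, M). z \<in> S \<and> M \<in> J z}"

lemma closed_graph_iff_sequentially:
  fixes J :: "'a::metric_space \<Rightarrow> 'b::metric_space set"
  shows "closedin (top_of_set (S \<times> UNIV)) {(z, M). z \<in> S \<and> M \<in> J z} \<longleftrightarrow>
    (\<forall>zs Ms z M. (\<forall>n. zs n \<in> S \<and> Ms n \<in> J (zs n)) \<and> z \<in> S \<and> zs \<longlonglongrightarrow> z \<and> Ms \<longlonglongrightarrow> M \<longrightarrow> M \<in> J z)"
    (is "closedin _ ?U \<longleftrightarrow> ?R")
proof
  assume "closedin (top_of_set (S \<times> UNIV)) ?U"
  then obtain C where C: "closed C" "?U = (S \<times> UNIV) \<inter> C" by (auto simp: closedin_closed)
  show ?R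
  proof (intro allI impI, elim conjE)
    fix zs Ms z M assume *: "\<forall>n. zs n \<in> S \<and> Ms n \<in> J (zs n)" "z \<in> S" "zs \<longlonglongrightarrow> z" "Ms \<longlonglongrightarrow> M"
    have "(zs n, Ms n) \<in> ?U" for n using * by simp
    then have "(zs n, Ms n) \<in> C" for n unfolding C(2) by simp
    moreover have "(\<lambda>n. (zs n, Ms n)) \<longlonglongrightarrow> (z, M)" using * by (intro tendsto_Pair)
    ultimately have "(z, M) \<in> C" using C(1) closed_sequentially[of C "\<lambda>n. (zs n, Ms n)"] by simp
    then have "(z, M) \<in> ?U" unfolding C(2) using *(2) by simp
    then show "M \<in> J z" by simp
  qed
next
  assume R: ?R
  have "?U = (S \<times> UNIV) \<inter> closure ?U"
  proof (intro equalityI subsetI)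
    fix x assume x: "x \<in> (S \<times> UNIV) \<inter> closure ?U"
    obtain z M where zM: "x = (z, M)" by fastforce
    obtain xs where xs: "\<And>n. xs n \<in> ?U" "xs \<longlonglongrightarrow> x" using x closure_sequential by blast
    have "(fst \<circ> xs) \<longlonglongrightarrow> z" "(snd \<circ> xs) \<longlonglongrightarrow> M"
      using tendsto_fst[OF xs(2)] tendsto_snd[OF xs(2)] zM by (simp_all add: o_def)
    moreover have "\<forall>n. (fst \<circ> xs) n \<in> S \<and> (snd \<circ> xs) n \<in> J ((fst \<circ> xs) n)"
      using xs(1) by (simp add: case_prod_unfold)
    ultimately show "x \<in> ?U" using R x zM by blast
  qed (use closure_subset in fastforce)
  then show "closedin (top_of_set (S \<times> UNIV)) ?U" using closedin_closed by blast
qed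

lemma usco_on_limit:
  assumes "usco_on S J" "\<And>n. zs n \<in> S" "\<And>n. Ms n \<in> J (zs n)" "z \<in> S" "zs \<longlonglongrightarrow> z" "Ms \<longlonglongrightarrow> M"
  shows "M \<in> J z"
  using assms unfolding usco_on_def closed_graph_iff_sequentially by blast

lemma usco_on_bounded:
  assumes "usco_on S J" "z \<in> S"
  obtains e B where "e > 0" "\<And>z' M. z' \<in> ball z e \<Longrightarrow> z' \<in> S \<Longrightarrow> M \<in> J z' \<Longrightarrow> norm M \<le> B"
  using assms unfolding usco_on_def by blast

text \<open>Local boundedness yields a convergent subsequence, and the closed graph places its limit
  in \<open>J z\<close>.\<close>

lemma usco_on_convergent_subseq:
  fixes J :: "'a::metric_space \<Rightarrow> 'b::euclidean_space set"
  assumes J: "usco_on S J" "\<And>n. zs n \<in> S" "\<And>n. Ms n \<in> J (zs n)" "z \<in> S" "zs \<longlonglongrightarrow> z"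
  obtains r M where "strict_mono r" "M \<in> J z" "(Ms \<circ> r) \<longlonglongrightarrow> M"
proof -
  obtain e B where eB: "e > 0" "\<And>z' M. z' \<in> ball z e \<Longrightarrow> z' \<in> S \<Longrightarrow> M \<in> J z' \<Longrightarrow> norm M \<le> B"
    using usco_on_bounded J by metis
  obtain n0 where n0: "\<And>n. n \<ge> n0 \<Longrightarrow> dist (zs n) z < e"
    using J(5) eB(1) unfolding lim_sequentially by blast
  have "Ms (n + n0) \<in> cball 0 B" for n
    using eB(2)[OF _ J(2,3)] n0 by (simp add: dist_commute)
  then obtain l r where lr: "strict_mono r" "((\<lambda>n. Ms (n + n0)) \<circ> r) \<longlonglongrightarrow> l"
    using compact_imp_seq_compact[OF compact_cball] unfolding seq_compact_def by metis
  define r' where "r' n = r n + n0" for n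
  have r': "strict_mono r'" using lr(1) by (auto simp: r'_def strict_mono_def)
  have Ml: "(Ms \<circ> r') \<longlonglongrightarrow> l" using lr(2) by (simp add: r'_def o_def)
  have "(zs \<circ> r') \<longlonglongrightarrow> z" using J(5) r' LIMSEQ_subseq_LIMSEQ by blast
  then have "l \<in> J z" using usco_on_limit[OF J(1), of "zs \<circ> r'" "Ms \<circ> r'"] Ml J by auto
  then show ?thesis using that r' Ml by blast
qed

text \<open>Otherwise elements outside \<open>V\<close> occur over points converging to
  \<open>z\<close>, and a subsequential limit of them lies in \<open>J z\<close> but still in the
  closed complement of \<open>V\<close>.\<close>

lemma usco_on_upper_semicontinuous:
  fixes J :: "'a::metric_space \<Rightarrow> 'b::euclidean_space set"
  assumes J: "usco_on S J" and z: "z \<in> S" and V: "open V" "J z \<subseteq> V"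
  obtains d where "d > 0" "\<And>z'. z' \<in> ball z d \<Longrightarrow> z' \<in> S \<Longrightarrow> J z' \<subseteq> V"
proof -
  have "\<exists>d>0. \<forall>z'. z' \<in> ball z d \<longrightarrow> z' \<in> S \<longrightarrow> J z' \<subseteq> V"
  proof (rule ccontr)
    assume "\<not> ?thesis"
    then have "\<exists>z'. z' \<in> ball z (inverse (Suc n)) \<and> z' \<in> S \<and> \<not> J z' \<subseteq> V" for n
      by (metis inverse_positive_iff_positive of_nat_0_less_iff zero_less_Suc)
    then obtain zs where zs: "\<And>n. zs n \<in> ball z (inverse (Suc n))" "\<And>n. zs n \<in> S" "\<And>n. \<not> J (zs n) \<subseteq> V"
      by metis
    then obtain Ms where Ms: "\<And>n. Ms n \<in> J (zs n)" "\<And>n. Ms n \<notin> V" unfolding subset_iff by metis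
    have lim: "zs \<longlonglongrightarrow> z"
      using zs(1) by (intro metric_tendsto_imp_tendsto[OF LIMSEQ_inverse_real_of_nat])
        (auto simp: dist_commute less_imp_le)
    obtain r M where rM: "M \<in> J z" "(Ms \<circ> r) \<longlonglongrightarrow> M"
      using usco_on_convergent_subseq[OF J zs(2) Ms(1) z lim] by metis
    have "M \<in> - V" using V(1) Ms(2) rM(2) closed_sequentially[of "- V" "Ms \<circ> r" M] by auto
    then show False using rM(1) V(2) by auto
  qed
  then show ?thesis using that by blast
qed

lemma usco_on_compact:
  fixes J :: "'a::metric_space \<Rightarrow> 'b::euclidean_space set"
  assumes J: "usco_on S J" and z: "z \<in> S"
  shows "compact (J z)"
  unfolding compact_def
proof (intro allI impI)
  fix f :: "nat \<Rightarrow> 'b" assume "\<forall>n. f n \<in> J z"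
  then show "\<exists>l\<in>J z. \<exists>r. strict_mono r \<and> (f \<circ> r) \<longlonglongrightarrow> l"
    using usco_on_convergent_subseq[OF J, of "\<lambda>_. z" f z] z by (metis tendsto_const)
qed

text \<open>Upper semicontinuity is tested against a convex open neighbourhood of the hull, which
  absorbs the hulls of nearby values together with the values. Compactness of the hull then turns
  approximation into membership.\<close>

lemma usco_on_convex_hull:
  fixes J :: "'a::metric_space \<Rightarrow> 'b::euclidean_space set"
  assumes J: "usco_on S J"
  shows "usco_on S (\<lambda>z. convex hull J z)"
  unfolding usco_on_def closed_graph_iff_sequentially
proof (intro conjI ballI allI impI; (elim conjE)?)
  fix z assume "z \<in> S"
  then obtain e B where eB: "e > 0" "\<And>z' M. z' \<in> ball z e \<Longrightarrow> z' \<in> S \<Longrightarrow> M \<in> J z' \<Longrightarrow> norm M \<le> B"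
    using usco_on_bounded J by metis
  have "norm M \<le> B" if "z' \<in> ball z e \<inter> S" "M \<in> convex hull J z'" for z' M
  proof -
    have "convex hull J z' \<subseteq> cball 0 B" using eB that(1) by (intro hull_minimal) auto
    then show ?thesis using that by auto
  qed
  then show "\<exists>e>0. \<exists>B. \<forall>z'\<in>ball z e \<inter> S. \<forall>M\<in>convex hull J z'. norm M \<le> B" using eB(1) by blast
next
  fix zs Ms z M
  assume *: "\<forall>n. zs n \<in> S \<and> Ms n \<in> convex hull J (zs n)" "z \<in> S" "zs \<longlonglongrightarrow> z" "Ms \<longlonglongrightarrow> M"
  have c: "compact (convex hull J z)" using usco_on_compact[OF J *(2)] by (rule compact_convex_hull)
  have "M \<in> closure (convex hull J z)"
    unfolding closure_approachable
  proof (intro allI impI)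
    fix \<epsilon> :: real assume \<epsilon>: "\<epsilon> > 0"
    \<comment> \<open>The Minkowski sum of the hull with a ball is both open and convex.\<close>
    define V where "V = (\<Union>x\<in>convex hull J z. \<Union>y\<in>ball 0 (\<epsilon>/2). {x + y})"
    have V: "open V" "convex V" unfolding V_def
      by (auto intro!: open_sums convex_sums)
    have "J z \<subseteq> V"
    proof
      fix x assume "x \<in> J z"
      then have "x \<in> convex hull J z" by (rule hull_inc)
      moreover have "(0::'b) \<in> ball 0 (\<epsilon>/2)" using \<epsilon> by simp
      ultimately have "x + 0 \<in> V" unfolding V_def by blast
      then show "x \<in> V" by simp
    qed
    then obtain d where d: "d > 0" "\<And>z'. z' \<in> ball z d \<Longrightarrow> z' \<in> S \<Longrightarrow> J z' \<subseteq> V"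
      using usco_on_upper_semicontinuous[OF J *(2) V(1)] by metis
    have "eventually (\<lambda>n. dist (zs n) z < d) sequentially" "eventually (\<lambda>n. dist (Ms n) M < \<epsilon>/2) sequentially"
      using tendstoD[OF *(3) d(1)] tendstoD[OF *(4), of "\<epsilon>/2"] \<epsilon> by simp_all
    then have "eventually (\<lambda>n. dist (zs n) z < d \<and> dist (Ms n) M < \<epsilon>/2) sequentially"
      by eventually_elim auto
    then obtain n where n: "dist (zs n) z < d" "dist (Ms n) M < \<epsilon>/2"
      using eventually_happens' sequentially_bot by blast
    have "convex hull J (zs n) \<subseteq> V"
      using d(2)[of "zs n"] n(1) * V(2) by (intro hull_minimal) (auto simp: dist_commute)
    then have "Ms n \<in> V" using *(1) by blast
    then obtain x y where xy: "x \<in> convex hull J z" "norm y < \<epsilon>/2" "Ms n = x + y" unfolding V_def by auto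
    have "dist x M \<le> dist x (Ms n) + dist (Ms n) M" by (rule dist_triangle)
    also have "\<dots> < \<epsilon>" using n(2) xy by (simp add: dist_norm)
    finally show "\<exists>y\<in>convex hull J z. dist y M < \<epsilon>" using xy(1) by blast
  qed
  then show "M \<in> convex hull J z" using c by (simp add: compact_imp_closed)
qed

lemma conservative_jac_on_iff_usco:
  "conservative_jac_on S F J \<longleftrightarrow> (\<forall>z\<in>S. J z \<noteq> {}) \<and> usco_on S J \<and>
     (\<forall>c. abs_cont_curve c \<and> c ` {0..1} \<subseteq> S \<longrightarrow>
        (AE t in lebesgue. t \<in> {0..1} \<longrightarrow>
           (\<exists>dc dF. (c has_vector_derivative dc) (at t within {0..1}) \<and>
                    ((F \<circ> c) has_vector_derivative dF) (at t within {0..1}) \<and>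
                    (\<forall>M\<in>J (c t). dF = M *v dc))))"
  unfolding conservative_jac_on_def usco_on_def by (simp only: conj_assoc)

section \<open>Directional bounds and matrix norms\<close>

lemma has_derivative_directional_bound:
  assumes F: "(F has_derivative F') (at w)"
    and e: "e > 0" "\<And>t. 0 < t \<Longrightarrow> t < e \<Longrightarrow> norm (F (w + t *\<^sub>R d) - F w - t *\<^sub>R q) \<le> C * t"
  shows "norm (F' d - q) \<le> C"
proof (rule field_le_epsilon)
  fix \<epsilon> :: real assume \<epsilon>: "0 < \<epsilon>"
  define \<eta> where "\<eta> = \<epsilon> / (norm d + 1)"
  have \<eta>: "\<eta> > 0" "\<eta> * norm d \<le> \<epsilon>" using \<epsilon> by (auto simp: \<eta>_def field_simps add_pos_nonneg)
  obtain \<delta> where \<delta>: "\<delta> > 0" "\<And>y. norm (y - w) < \<delta> \<Longrightarrow> norm (F y - F w - F' (y - w)) \<le> \<eta> * norm (y - w)"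
    using F \<eta>(1) unfolding has_derivative_at_alt by blast
  have lin: "linear F'" using F has_derivative_linear by blast
  \<comment> \<open>One step is enough: \<open>t < e\<close> for the hypothesis on quotients, and
    \<open>norm (t *\<^sub>R d) < \<delta>\<close> for the first-order expansion.\<close>
  define t where "t = min (e/2) (\<delta> / (2 * (norm d + 1)))"
  have t: "0 < t" "t < e" using e \<delta> by (auto simp: t_def add_nonneg_pos)
  have "t * norm d \<le> \<delta> / (2 * (norm d + 1)) * norm d"
    by (intro mult_right_mono) (auto simp: t_def)
  also have "\<dots> < \<delta>" 
  proof -
    have "norm d / (2 * (norm d + 1)) < 1" by (simp add: divide_less_eq) (smt (verit) norm_ge_zero)
    then show ?thesis using mult_strict_left_mono[OF _ \<delta>(1)] by fastforce
  qed
  finally have td: "norm (t *\<^sub>R d) < \<delta>" using t by simp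
  have 1: "norm (F (w + t *\<^sub>R d) - F w - F' (t *\<^sub>R d)) \<le> \<eta> * (t * norm d)"
    using \<delta>(2)[of "w + t *\<^sub>R d"] td t by simp
  have "t * norm (F' d - q) = norm (t *\<^sub>R (F' d - q))" using t by simp
  also have "t *\<^sub>R (F' d - q) = (F (w + t *\<^sub>R d) - F w - t *\<^sub>R q) - (F (w + t *\<^sub>R d) - F w - F' (t *\<^sub>R d))"
    by (simp add: linear_scale[OF lin] scaleR_diff_right)
  also have "norm \<dots> \<le> C * t + \<eta> * (t * norm d)"
    using 1 e(2)[OF t] by (smt (verit) norm_triangle_ineq4)
  also have "\<dots> = t * (C + \<eta> * norm d)" by (simp add: algebra_simps)
  finally have "norm (F' d - q) \<le> C + \<eta> * norm d" using t by simp
  then show "norm (F' d - q) \<le> C + \<epsilon>" using \<eta> by linarith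
qed

lemma norm_matrix_vector_mult_le:
  fixes A :: "real^'n^'m"
  shows "norm (A *v x) \<le> norm A * norm x"
proof -
  have "norm (A *v x) = L2_set (\<lambda>i. norm ((A *v x) $ i)) UNIV" by (simp add: norm_vec_def)
  also have "\<dots> \<le> L2_set (\<lambda>i. norm (A $ i) * norm x) UNIV"
    by (intro L2_set_mono) (auto simp: matrix_vector_mul_component Cauchy_Schwarz_ineq2)
  also have "\<dots> = norm A * norm x"
    by (simp add: norm_vec_def L2_set_left_distrib)
  finally show ?thesis .
qed

text \<open>\<open>norm A\<close> is the Frobenius norm, while Lipschitz estimates bound the
  operator norm. The entrywise constant is crude, but only local boundedness is asked of it.\<close>

lemma norm_matrix_le_of_operator_bound:
  fixes A :: "real^'n^'m"
  assumes "\<And>x. norm (A *v x) \<le> B * norm x"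
  shows "norm A \<le> CARD('m) * (real CARD('n) * B)"
proof -
  have e: "\<bar>A $ i $ j\<bar> \<le> B" for i j
    using order_trans[OF component_le_norm_cart assms, of "axis j 1" i]
    by (simp add: matrix_vector_mult_basis column_def)
  have "norm A \<le> (\<Sum>i\<in>UNIV. norm (A $ i))" by (simp add: norm_vec_def L2_set_le_sum)
  also have "\<dots> \<le> (\<Sum>i\<in>(UNIV::'m set). real CARD('n) * B)"
  proof (rule sum_mono)
    fix i
    have "norm (A $ i) \<le> (\<Sum>j\<in>UNIV. \<bar>A $ i $ j\<bar>)" by (rule norm_le_l1_cart)
    also have "\<dots> \<le> (\<Sum>j\<in>(UNIV::'n set). B)" using e by (rule sum_mono)
    finally show "norm (A $ i) \<le> real CARD('n) * B" by simp
  qed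
  finally show ?thesis by simp
qed

section \<open>The Clarke Jacobian of a path differentiable map\<close>

lemma conservative_jac_on_usco: "conservative_jac_on S F J \<Longrightarrow> usco_on S J"
  by (simp add: conservative_jac_on_iff_usco)

text \<open>Upper semicontinuity spreads \<open>J z \<subseteq> V\<close> to a ball, and balls are
  convex, so the segment inequality applies between any two of its points. Information on the single
  set \<open>J z\<close> thereby controls increments of \<open>F\<close> nearby.\<close>

lemma conservative_jac_on_local_bound:
  fixes F :: "real^'N \<Rightarrow> real^'k"
  assumes cons: "conservative_jac_on S F J" and lip: "loc_lipschitz_on S F" and S: "open S" "z \<in> S"
    and V: "open V" "J z \<subseteq> V"
  obtains r where "r > 0" "ball z r \<subseteq> S" "\<And>x y q e. x \<in> ball z r \<Longrightarrow> y \<in> ball z r \<Longrightarrow> 0 \<le> e \<Longrightarrow>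
    (\<And>w. w \<in> V \<Longrightarrow> norm (w *v (y - x) - q) \<le> e) \<Longrightarrow> norm (F y - F x - q) \<le> e"
proof -
  obtain d where d: "d > 0" "\<And>z'. z' \<in> ball z d \<Longrightarrow> z' \<in> S \<Longrightarrow> J z' \<subseteq> V"
    using usco_on_upper_semicontinuous[OF conservative_jac_on_usco[OF cons] S(2) V] by metis
  obtain e1 L where L: "e1 > 0" "L-lipschitz_on (ball z e1 \<inter> S) F"
    using lip S unfolding loc_lipschitz_on_def by blast
  obtain e2 where e2: "e2 > 0" "ball z e2 \<subseteq> S" using S open_contains_ball by blast
  define r where "r = min d (min e1 e2)"
  have r: "r > 0" "ball z r \<subseteq> S" "ball z r \<subseteq> ball z d" "ball z r \<subseteq> ball z e1"
    using d e2 L by (auto simp: r_def)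
  have "norm (F y - F x - q) \<le> e" if xy: "x \<in> ball z r" "y \<in> ball z r" "0 \<le> e"
    "\<And>w. w \<in> V \<Longrightarrow> norm (w *v (y - x) - q) \<le> e" for x y q e
  proof (rule conservative_jac_on_segment_bound[OF cons])
    have seg: "closed_segment x y \<subseteq> ball z r" using xy by (intro closed_segment_subset) auto
    then show "closed_segment x y \<subseteq> S" using r(2) by (rule subset_trans)
    show "L-lipschitz_on (closed_segment x y) F"
      using seg r(2,4) by (intro lipschitz_on_subset[OF L(2)]) auto
    show "norm (w *v (y - x) - q) \<le> e" if "z' \<in> closed_segment x y" "w \<in> J z'" for z' w
    proof -
      have "J z' \<subseteq> V" using that(1) seg r(2,3) by (intro d(2)) auto
      then show ?thesis using that(2) by (intro xy(4)) auto
    qed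
  qed (use xy in auto)
  then show ?thesis using that r by blast
qed

text \<open>With \<open>J z = {M}\<close> the neighbourhood \<open>V\<close> can be a small ball
  around \<open>M\<close>, and the local bound with target \<open>M *v (y - z)\<close> is the
  definition of the Frechet derivative.\<close>

lemma conservative_jac_on_singleton_has_derivative:
  fixes F :: "real^'N \<Rightarrow> real^'k"
  assumes cons: "conservative_jac_on S F J" and lip: "loc_lipschitz_on S F" and S: "open S" "z \<in> S"
    and M: "J z = {M}"
  shows "(F has_derivative (*v) M) (at z)"
  unfolding has_derivative_at_alt
proof (intro conjI allI impI)
  show "bounded_linear ((*v) M)" by simp
  fix e :: real assume e: "e > 0"
  obtain r where r: "r > 0" "\<And>x y q e'. x \<in> ball z r \<Longrightarrow> y \<in> ball z r \<Longrightarrow> 0 \<le> e' \<Longrightarrow>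
    (\<And>w. w \<in> ball M e \<Longrightarrow> norm (w *v (y - x) - q) \<le> e') \<Longrightarrow> norm (F y - F x - q) \<le> e'"
    using conservative_jac_on_local_bound[OF cons lip S, of "ball M e"] M e
    by (metis centre_in_ball empty_subsetI insert_subset open_ball)
  have "norm (F y - F z - M *v (y - z)) \<le> e * norm (y - z)" if "norm (y - z) < r" for y
  proof (rule r(2))
    show "norm (w *v (y - z) - M *v (y - z)) \<le> e * norm (y - z)" if "w \<in> ball M e" for w
    proof -
      have "norm (w *v (y - z) - M *v (y - z)) = norm ((w - M) *v (y - z))"
        by (simp add: matrix_vector_mult_diff_rdistrib)
      also have "\<dots> \<le> norm (w - M) * norm (y - z)" by (rule norm_matrix_vector_mult_le)
      also have "\<dots> \<le> e * norm (y - z)"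
        using that by (intro mult_right_mono) (auto simp: dist_norm norm_minus_commute)
      finally show ?thesis .
    qed
  qed (use that r(1) e in \<open>auto simp: dist_norm norm_minus_commute\<close>)
  then show "\<exists>d>0. \<forall>y. norm (y - z) < d \<longrightarrow> norm (F y - F z - M *v (y - z)) \<le> e * norm (y - z)"
    using r(1) by blast
qed

lemma continuous_matrix_vector_mult: "continuous_on A (\<lambda>w. (w :: real^'n^'m) *v d)"
  unfolding matrix_vector_mult_def by (intro continuous_intros continuous_on_vec_lambda)

lemma tendsto_matrix_vector_mult:
  "(w \<longlongrightarrow> M) A \<Longrightarrow> ((\<lambda>k. (w k :: real^'n^'m) *v d) \<longlongrightarrow> M *v d) A"
  by (rule continuous_on_tendsto_compose[OF continuous_matrix_vector_mult[of UNIV]]) auto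

text \<open>The Bouligand subdifferential. It is separated from its hull because boundedness, closed
  graph and nonemptiness are shown here and then carried over to the hull.\<close>

definition limit_jac :: "(real^'N) set \<Rightarrow> (real^'N \<Rightarrow> real^'k) \<Rightarrow> real^'N \<Rightarrow> (real^'N^'k) set" where
  "limit_jac S F z = {M. \<exists>zs. (\<forall>j. zs j \<in> S \<and> F differentiable (at (zs j))) \<and> zs \<longlonglongrightarrow> z \<and>
            (\<lambda>j. matrix (frechet_derivative F (at (zs j)))) \<longlonglongrightarrow> M}"

lemma clarke_jac_on_eq: "clarke_jac_on S F z = convex hull limit_jac S F z"
  by (simp add: clarke_jac_on_def limit_jac_def)

lemma matrix_frechet_derivative_works:
  fixes F :: "real^'N \<Rightarrow> real^'k"
  assumes "F differentiable (at z)"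
  shows "(F has_derivative (*v) (matrix (frechet_derivative F (at z)))) (at z)"
proof -
  have *: "(F has_derivative frechet_derivative F (at z)) (at z)"
    using assms frechet_derivative_works by blast
  then have "linear (frechet_derivative F (at z))" using has_derivative_linear by blast
  then show ?thesis using * by (simp add: matrix_works)
qed

lemma limit_jac_in_closed:
  assumes "M \<in> limit_jac S F z" "open U" "z \<in> U" "closed C"
    and "\<And>w A. w \<in> U \<Longrightarrow> w \<in> S \<Longrightarrow> (F has_derivative (*v) A) (at w) \<Longrightarrow> A \<in> C"
  shows "M \<in> C"
proof -
  obtain zs where zs: "\<And>j. zs j \<in> S" "\<And>j. F differentiable (at (zs j))" "zs \<longlonglongrightarrow> z"
    "(\<lambda>j. matrix (frechet_derivative F (at (zs j)))) \<longlonglongrightarrow> M"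
    using assms(1) unfolding limit_jac_def by blast
  have "eventually (\<lambda>j. zs j \<in> U) sequentially" using zs(3) assms(2,3) topological_tendstoD by blast
  then have "eventually (\<lambda>j. matrix (frechet_derivative F (at (zs j))) \<in> C) sequentially"
    by eventually_elim (use assms(5) zs matrix_frechet_derivative_works in blast)
  then show ?thesis using Lim_in_closed_set[OF assms(4) _ sequentially_bot zs(4)] by blast
qed

lemma clarke_jac_in_closed_convex:
  assumes "M \<in> clarke_jac_on S F z" "open U" "z \<in> U" "closed C" "convex C"
    and "\<And>w A. w \<in> U \<Longrightarrow> w \<in> S \<Longrightarrow> (F has_derivative (*v) A) (at w) \<Longrightarrow> A \<in> C"
  shows "M \<in> C"
proof -
  have "limit_jac S F z \<subseteq> C" using limit_jac_in_closed[OF _ assms(2,3,4)] assms(6) by blast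
  then have "convex hull limit_jac S F z \<subseteq> C" using assms(5) by (rule hull_minimal)
  then show ?thesis using assms(1) by (auto simp: clarke_jac_on_eq)
qed

text \<open>The matrices \<open>w\<close> with \<open>norm (w *v d - q) \<le> e\<close> form a
  closed convex set, so a bound on difference quotients in direction \<open>d\<close> passes from
  derivatives to their limits and to convex combinations. The step length may depend on the base
  point.\<close>

lemma clarke_jac_directional_bound:
  fixes F :: "real^'N \<Rightarrow> real^'k"
  assumes M: "M \<in> clarke_jac_on S F z" and U: "open U" "z \<in> U"
    and bd: "\<And>w. w \<in> U \<Longrightarrow> w \<in> S \<Longrightarrow>
      \<exists>\<epsilon>>0. \<forall>t. 0 < t \<and> t < \<epsilon> \<longrightarrow> norm (F (w + t *\<^sub>R d) - F w - t *\<^sub>R q) \<le> e * t"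
  shows "norm (M *v d - q) \<le> e"
proof -
  define C where "C = {w :: real^'N^'k. norm (w *v d - q) \<le> e}"
  have "closed C" unfolding C_def
    by (intro closed_Collect_le continuous_intros continuous_matrix_vector_mult)
  moreover have "convex C"
  proof -
    have "C = (\<lambda>w. w *v d) -` cball q e" by (auto simp: C_def dist_norm norm_minus_commute)
    moreover have "linear (\<lambda>w::real^'N^'k. w *v d)"
      by (rule linearI) (auto simp: matrix_vector_mult_add_rdistrib scaleR_matrix_vector_assoc)
    ultimately show ?thesis by (simp add: convex_linear_vimage)
  qed
  moreover have "A \<in> C" if w: "w \<in> U" "w \<in> S" "(F has_derivative (*v) A) (at w)" for w A
  proof -
    obtain \<epsilon> where "\<epsilon> > 0" "\<And>t. 0 < t \<Longrightarrow> t < \<epsilon> \<Longrightarrow> norm (F (w + t *\<^sub>R d) - F w - t *\<^sub>R q) \<le> e * t"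
      using bd[OF w(1,2)] by blast
    then show ?thesis using has_derivative_directional_bound[OF w(3)] by (simp add: C_def)
  qed
  ultimately have "M \<in> C" using clarke_jac_in_closed_convex[OF M U, of C] by auto
  then show ?thesis by (simp add: C_def)
qed

lemma small_step_in_ball:
  assumes "\<rho> > 0" "0 < t" "t < \<rho> / (norm d + 1)"
  shows "w + t *\<^sub>R d \<in> ball w \<rho>"
proof -
  have "t * norm d \<le> t * (norm d + 1)" using assms by (intro mult_left_mono) auto
  also have "\<dots> < \<rho>" using assms(3) by (simp add: pos_less_divide_eq add_nonneg_pos)
  finally show ?thesis using assms by (simp add: dist_norm)
qed

text \<open>For each \<open>e\<close> the elements sending \<open>d\<close> within \<open>e\<close>
  of \<open>q\<close> form an open set containing \<open>J z\<close>. Near \<open>z\<close> the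
  quotients of \<open>F\<close> in direction \<open>d\<close> are then within \<open>e\<close> of
  \<open>q\<close>, hence so is \<open>M *v d\<close>; finally \<open>e\<close> tends to 0.\<close>

lemma clarke_jac_direction:
  fixes F :: "real^'N \<Rightarrow> real^'k"
  assumes cons: "conservative_jac_on S F J" and lip: "loc_lipschitz_on S F" and S: "open S" "z \<in> S"
    and dq: "\<And>w. w \<in> J z \<Longrightarrow> w *v d = q" and M: "M \<in> clarke_jac_on S F z"
  shows "M *v d = q"
proof -
  have "norm (M *v d - q) \<le> e" if e: "e > 0" for e
  proof -
    define V where "V = {w :: real^'N^'k. norm (w *v d - q) < e}"
    have V: "open V" unfolding V_def
      by (intro open_Collect_less continuous_intros continuous_matrix_vector_mult)
    have "J z \<subseteq> V" using dq e by (auto simp: V_def)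
    then obtain r where r: "r > 0" "\<And>x y q e. x \<in> ball z r \<Longrightarrow> y \<in> ball z r \<Longrightarrow> 0 \<le> e \<Longrightarrow>
      (\<And>w. w \<in> V \<Longrightarrow> norm (w *v (y - x) - q) \<le> e) \<Longrightarrow> norm (F y - F x - q) \<le> e"
      using conservative_jac_on_local_bound[OF cons lip S V] by metis
    show ?thesis
    proof (rule clarke_jac_directional_bound[OF M open_ball[of z r]])
      show "z \<in> ball z r" using r(1) by simp
      fix w assume w: "w \<in> ball z r"
      then obtain \<rho> where \<rho>: "\<rho> > 0" "ball w \<rho> \<subseteq> ball z r"
        using open_ball open_contains_ball by blast
      show "\<exists>\<epsilon>>0. \<forall>t. 0 < t \<and> t < \<epsilon> \<longrightarrow> norm (F (w + t *\<^sub>R d) - F w - t *\<^sub>R q) \<le> e * t"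
      proof (intro exI[of _ "\<rho> / (norm d + 1)"] conjI allI impI; (elim conjE)?)
        show "0 < \<rho> / (norm d + 1)" using \<rho> by (simp add: add_nonneg_pos)
        fix t assume t: "0 < t" "t < \<rho> / (norm d + 1)"
        have y: "w + t *\<^sub>R d \<in> ball z r" using small_step_in_ball[OF \<rho>(1) t] \<rho>(2) by blast
        show "norm (F (w + t *\<^sub>R d) - F w - t *\<^sub>R q) \<le> e * t"
        proof (rule r(2)[OF w y])
          fix u assume u: "u \<in> V"
          have "u *v (w + t *\<^sub>R d - w) - t *\<^sub>R q = t *\<^sub>R (u *v d - q)"
            by (simp add: matrix_vector_mult_scaleR scaleR_diff_right)
          then show "norm (u *v (w + t *\<^sub>R d - w) - t *\<^sub>R q) \<le> e * t"
            using u t by (simp add: V_def mult.commute)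
        qed (use e t in auto)
      qed
    qed
  qed
  then have "norm (M *v d - q) \<le> 0" by (meson field_le_epsilon add_0 dense_ge)
  then show ?thesis by simp
qed

lemma has_derivative_norm_le_lipschitz:
  assumes "(F has_derivative F') (at w)" "L-lipschitz_on U F" "open U" "w \<in> U"
  shows "norm (F' d) \<le> L * norm d"
proof -
  obtain \<rho> where \<rho>: "\<rho> > 0" "ball w \<rho> \<subseteq> U" using assms(3,4) open_contains_ball by blast
  have "norm (F' d - 0) \<le> L * norm d"
  proof (rule has_derivative_directional_bound[OF assms(1)])
    show "0 < \<rho> / (norm d + 1)" using \<rho> by (simp add: add_nonneg_pos)
    fix t assume t: "0 < t" "t < \<rho> / (norm d + 1)"
    have y: "w + t *\<^sub>R d \<in> U" using small_step_in_ball[OF \<rho>(1) t] \<rho>(2) by blast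
    show "norm (F (w + t *\<^sub>R d) - F w - t *\<^sub>R 0) \<le> L * norm d * t"
      using lipschitz_onD[OF assms(2) y assms(4)] t by (simp add: dist_norm mult_ac)
  qed
  then show ?thesis by simp
qed

lemma tendsto_if_dist_less_inverse_Suc:
  assumes "\<And>n. dist (a n) (b n) < inverse (real (Suc n))" "b \<longlonglongrightarrow> l"
  shows "a \<longlonglongrightarrow> l"
proof (rule metric_tendsto_imp_tendsto)
  show "(\<lambda>n. inverse (real (Suc n)) + dist (b n) l) \<longlonglongrightarrow> 0"
    using tendsto_add[OF LIMSEQ_inverse_real_of_nat assms(2)[unfolded tendsto_dist_iff[of b]]] by simp
  show "\<forall>\<^sub>F n in sequentially. dist (a n) l \<le> dist (inverse (real (Suc n)) + dist (b n) l) 0"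
  proof (rule always_eventually, rule allI)
    fix n
    have "dist (a n) l \<le> dist (a n) (b n) + dist (b n) l" by (rule dist_triangle)
    also have "\<dots> \<le> dist (inverse (real (Suc n)) + dist (b n) l) 0" using assms(1)[of n] by simp
    finally show "dist (a n) l \<le> dist (inverse (real (Suc n)) + dist (b n) l) 0" .
  qed
qed

text \<open>The local Lipschitz constant bounds all derivatives nearby; the closed graph is a
  diagonal argument.\<close>

lemma usco_on_limit_jac:
  fixes F :: "real^'N \<Rightarrow> real^'k"
  assumes lip: "loc_lipschitz_on S F" and S: "open S"
  shows "usco_on S (limit_jac S F)"
  unfolding usco_on_def closed_graph_iff_sequentially
proof (intro conjI ballI allI impI; (elim conjE)?)
  fix z assume z: "z \<in> S"
  obtain e L where L: "e > 0" "L-lipschitz_on (ball z e \<inter> S) F"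
    using lip z unfolding loc_lipschitz_on_def by blast
  define B where "B = real CARD('k) * (real CARD('N) * L)"
  have "norm M \<le> B" if z': "z' \<in> ball z e \<inter> S" "M \<in> limit_jac S F z'" for z' M
  proof -
    have "M \<in> cball 0 B"
    proof (rule limit_jac_in_closed[OF z'(2)])
      show "open (ball z e \<inter> S)" "z' \<in> ball z e \<inter> S" using z' S by auto
      fix w A assume "w \<in> ball z e \<inter> S" "(F has_derivative (*v) A) (at w)"
      then have "norm (A *v d) \<le> L * norm d" for d
        using has_derivative_norm_le_lipschitz[OF _ L(2)] S by blast
      then show "A \<in> cball 0 B" using norm_matrix_le_of_operator_bound[of A L] by (simp add: B_def)
    qed auto
    then show ?thesis by simp
  qed
  then show "\<exists>e>0. \<exists>B. \<forall>z'\<in>ball z e \<inter> S. \<forall>M\<in>limit_jac S F z'. norm M \<le> B" using L(1) by blast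
next
  fix zs Ms z M
  assume *: "\<forall>n. zs n \<in> S \<and> Ms n \<in> limit_jac S F (zs n)" "z \<in> S" "zs \<longlonglongrightarrow> z" "Ms \<longlonglongrightarrow> M"
  let ?D = "\<lambda>w. matrix (frechet_derivative F (at w))"
  \<comment> \<open>Diagonal choice: one differentiability point per \<open>n\<close>, close in
    position and in Jacobian at once.\<close>
  have "\<exists>w. w \<in> S \<and> F differentiable (at w) \<and> dist w (zs n) < inverse (Suc n) \<and> dist (?D w) (Ms n) < inverse (Suc n)" for n
  proof -
    obtain ws where ws: "\<And>j. ws j \<in> S" "\<And>j. F differentiable (at (ws j))" "ws \<longlonglongrightarrow> zs n"
      "(\<lambda>j. ?D (ws j)) \<longlonglongrightarrow> Ms n"
      using *(1) unfolding limit_jac_def by blast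
    have "eventually (\<lambda>j. dist (ws j) (zs n) < inverse (Suc n)) sequentially"
      "eventually (\<lambda>j. dist (?D (ws j)) (Ms n) < inverse (Suc n)) sequentially"
      using ws(3,4) by (auto intro!: tendstoD)
    then have "eventually (\<lambda>j. dist (ws j) (zs n) < inverse (Suc n) \<and> dist (?D (ws j)) (Ms n) < inverse (Suc n)) sequentially"
      by eventually_elim auto
    then obtain j where "dist (ws j) (zs n) < inverse (Suc n) \<and> dist (?D (ws j)) (Ms n) < inverse (Suc n)"
      using eventually_happens' sequentially_bot by blast
    then show ?thesis using ws by blast
  qed
  then obtain w where w: "\<And>n. w n \<in> S" "\<And>n. F differentiable (at (w n))"
    "\<And>n. dist (w n) (zs n) < inverse (Suc n)" "\<And>n. dist (?D (w n)) (Ms n) < inverse (Suc n)" by metis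
  have "w \<longlonglongrightarrow> z" "(\<lambda>n. ?D (w n)) \<longlonglongrightarrow> M" 
    using tendsto_if_dist_less_inverse_Suc[OF w(3) *(3)] tendsto_if_dist_less_inverse_Suc[OF w(4) *(4)] by auto
  then show "M \<in> limit_jac S F z" using w unfolding limit_jac_def by blast
qed

section \<open>Nonemptiness of the Clarke Jacobian by Baire's theorem\<close>

lemma AE_lebesgue_01_happens:
  assumes "AE t in lebesgue. t \<in> {0..1::real} \<longrightarrow> P t"
  obtains t where "t \<in> {0..1}" "P t"
proof -
  have "\<not> {0..1::real} \<subseteq> N" if "N \<in> null_sets lebesgue" for N
  proof
    assume "{0..1} \<subseteq> N"
    then have "{0..1::real} \<in> null_sets lebesgue" using null_sets_subset[OF that] by simp
    then show False by (simp add: null_sets_def)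
  qed
  moreover obtain N where "\<And>t. t \<in> space lebesgue - N \<Longrightarrow> t \<in> {0..1} \<longrightarrow> P t" "N \<in> null_sets lebesgue"
    using AE_E3[OF assms] by blast
  ultimately show ?thesis using that by (metis DiffI UNIV_I space_completion space_lborel space_borel subsetI)
qed

text \<open>Along every line parallel to a coordinate axis, all elements of the conservative Jacobian
  agree almost everywhere on the axis direction; so the closed set of points at which two of them
  differ by at least a given amount in that direction has empty interior, and Baire's
  theorem replaces the use of Rademacher's theorem.\<close>

lemma conservative_jac_on_dense_singleton:
  fixes F :: "real^'N \<Rightarrow> real^'k"
  assumes cons: "conservative_jac_on S F J" and S: "open S" "z \<in> S" and e: "e > 0"
  obtains z' M where "z' \<in> ball z e" "z' \<in> S" "J z' = {M}"
proof -
  have usco: "usco_on S J" using cons by (rule conservative_jac_on_usco)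
  obtain r0 where r0: "r0 > 0" "cball z r0 \<subseteq> S" using S open_contains_cball by blast
  define r where "r = min r0 (e/2)"
  have r: "r > 0" "cball z r \<subseteq> S" "cball z r \<subseteq> ball z e" using r0 e by (auto simp: r_def)
  \<comment> \<open>Matrices are determined by their columns, so within the closed ball these
    countably many sets together cover every point with two distinct elements of \<open>J\<close>.
    The gap \<open>inverse (real (Suc n))\<close>, rather than mere inequality, is what makes each
    of them closed.\<close>
  define A where "A i n = {x \<in> cball z r. \<exists>w\<in>J x. \<exists>w'\<in>J x.
      inverse (real (Suc n)) \<le> norm (w *v axis i 1 - w' *v axis i 1)}" for i :: 'N and n
  have closedA: "closed (A i n)" for i n
    unfolding closed_sequential_limits
  proof (intro allI impI, elim conjE)
    fix xs l assume xs: "\<forall>k. xs k \<in> A i n" "xs \<longlonglongrightarrow> l"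
    then have xS: "xs k \<in> S" and xc: "xs k \<in> cball z r" for k using r(2) by (auto simp: A_def)
    have lc: "l \<in> cball z r" using closed_sequentially[OF closed_cball xc xs(2)] .
    then have lS: "l \<in> S" using r(2) by auto
    have "\<forall>k. \<exists>w w'. w \<in> J (xs k) \<and> w' \<in> J (xs k) \<and>
      inverse (real (Suc n)) \<le> norm (w *v axis i 1 - w' *v axis i 1)"
      using xs(1) unfolding A_def by blast
    then obtain w w' where w: "\<And>k. w k \<in> J (xs k)" "\<And>k. w' k \<in> J (xs k)"
      "\<And>k. inverse (real (Suc n)) \<le> norm (w k *v axis i 1 - w' k *v axis i 1)" by metis
    obtain s1 M where s1: "strict_mono s1" "M \<in> J l" "(w \<circ> s1) \<longlonglongrightarrow> M"
      using usco_on_convergent_subseq[OF usco xS w(1) lS xs(2)] by blast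
    obtain s2 M' where s2: "strict_mono s2" "M' \<in> J l" "(w' \<circ> s1 \<circ> s2) \<longlonglongrightarrow> M'"
    proof (rule usco_on_convergent_subseq[OF usco, of "xs \<circ> s1" "w' \<circ> s1" l])
      show "(xs \<circ> s1) \<longlonglongrightarrow> l" using xs(2) s1(1) LIMSEQ_subseq_LIMSEQ by blast
    qed (use xS w(2) lS in auto)
    have wl: "(w \<circ> s1 \<circ> s2) \<longlonglongrightarrow> M" using s1(3) s2(1) LIMSEQ_subseq_LIMSEQ by blast
    have "(\<lambda>k. norm ((w \<circ> s1 \<circ> s2) k *v axis i 1 - (w' \<circ> s1 \<circ> s2) k *v axis i 1))
      \<longlonglongrightarrow> norm (M *v axis i 1 - M' *v axis i 1)"
      by (intro tendsto_norm tendsto_diff tendsto_matrix_vector_mult wl s2(3))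
    then have "inverse (real (Suc n)) \<le> norm (M *v axis i 1 - M' *v axis i 1)"
      by (rule LIMSEQ_le_const) (use w(3) in \<open>auto simp: o_def\<close>)
    then show "l \<in> A i n" using lc s1(2) s2(2) unfolding A_def by blast
  qed
  have not_ball: "\<not> ball x \<rho> \<subseteq> A i n" if \<rho>: "\<rho> > 0" for x \<rho> i n
  proof
    assume sub: "ball x \<rho> \<subseteq> A i n"
    define c where "c s = x + s *\<^sub>R ((\<rho>/2) *\<^sub>R axis i 1)" for s :: real
    have cb: "c s \<in> ball x \<rho>" if "s \<in> {0..1}" for s
    proof -
      have "s * (\<rho>/2) \<le> 1 * (\<rho>/2)" using that \<rho> by (intro mult_right_mono) auto
      then show ?thesis using that \<rho> by (simp add: c_def dist_norm abs_mult)
    qed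
    have clip: "(norm ((\<rho>/2) *\<^sub>R axis i 1 :: real^'N))-lipschitz_on {0..1} c"
      unfolding c_def[abs_def] by (rule lipschitz_on_line)
    have "AE t in lebesgue. t \<in> {0..1} \<longrightarrow>
           (\<exists>dc dF. (c has_vector_derivative dc) (at t within {0..1}) \<and>
                    ((F \<circ> c) has_vector_derivative dF) (at t within {0..1}) \<and>
                    (\<forall>M\<in>J (c t). dF = M *v dc))"
    proof (rule conservative_jac_onD(4)[OF cons])
      show "abs_cont_curve c" using clip by (rule lipschitz_imp_abs_cont_curve)
      have "A i n \<subseteq> S" using r(2) by (auto simp: A_def)
      then show "c ` {0..1} \<subseteq> S" using cb sub by blast
    qed
    then obtain t dc dF where t: "t \<in> {0..1}" "(c has_vector_derivative dc) (at t within {0..1})"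
      "\<And>M. M\<in>J (c t) \<Longrightarrow> dF = M *v dc"
      by (rule AE_lebesgue_01_happens) blast
    have "(c has_vector_derivative ((\<rho>/2) *\<^sub>R axis i 1)) (at t within {0..1})"
      unfolding c_def by (auto intro!: derivative_eq_intros)
    then have dc: "dc = (\<rho>/2) *\<^sub>R axis i 1" using vector_derivative_within_01_unique t by blast
    obtain w w' where w: "w \<in> J (c t)" "w' \<in> J (c t)"
      "inverse (real (Suc n)) \<le> norm (w *v axis i 1 - w' *v axis i 1)"
      using cb[OF t(1)] sub unfolding A_def by blast
    have "(\<rho>/2) *\<^sub>R (w *v axis i 1) = (\<rho>/2) *\<^sub>R (w' *v axis i 1)"
      using t(3)[OF w(1)] t(3)[OF w(2)] dc by (metis matrix_vector_mult_scaleR)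
    then have "w *v axis i 1 = w' *v axis i 1" using that by simp
    then show False using w(3) by (simp del: of_nat_Suc)
  qed
  \<comment> \<open>Baire is applied inside the closed ball, which is a closed subset of the whole
    space.\<close>
  define \<G> where "\<G> = (\<lambda>(i, n). cball z r - A i n) ` UNIV"
  have "cball z r \<subseteq> closure (\<Inter>\<G>)"
  proof (rule Baire)
    show "countable \<G>" unfolding \<G>_def by (intro countable_image) auto
    fix T assume "T \<in> \<G>"
    then obtain i n where T: "T = cball z r - A i n" by (auto simp: \<G>_def)
    \<comment> \<open>Density is checked at interior points, around which small balls stay in
      \<open>cball z r\<close>; the boundary follows since the closure of the open ball is the
      closed one.\<close>
    have "ball z r \<subseteq> closure T"
    proof
      fix x assume x: "x \<in> ball z r"
      show "x \<in> closure T" unfolding closure_approachable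
      proof (intro allI impI)
        fix \<epsilon> :: real assume \<epsilon>: "\<epsilon> > 0"
        obtain \<rho> where \<rho>: "\<rho> > 0" "ball x \<rho> \<subseteq> ball z r" using x open_ball open_contains_ball by blast
        have "\<not> ball x (min \<epsilon> \<rho>) \<subseteq> A i n" using \<epsilon> \<rho> by (intro not_ball) auto
        then obtain y where "y \<in> ball x (min \<epsilon> \<rho>)" "y \<notin> A i n" by blast
        then show "\<exists>y\<in>T. dist y x < \<epsilon>" using \<rho>(2) unfolding T by (auto simp: dist_commute subset_iff intro!: bexI[of _ y])
      qed
    qed
    then have "closure (ball z r) \<subseteq> closure T" by (simp add: closure_minimal)
    then have "cball z r \<subseteq> closure T" using r(1) by simp
    moreover have "openin (top_of_set (cball z r)) T"
      unfolding T Diff_eq by (rule openin_open_Int) (use closedA in auto)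
    ultimately show "openin (top_of_set (cball z r)) T \<and> cball z r \<subseteq> closure T" by simp
  qed simp
  then have "z \<in> closure (\<Inter>\<G>)" using r(1) by auto
  then obtain z' where "z' \<in> \<Inter>\<G>" by (metis closure_empty equals0I empty_iff)
  then have z': "z' \<in> cball z r" "\<And>i n. z' \<notin> A i n" by (auto simp: \<G>_def)
  have "w = w'" if w: "w \<in> J z'" "w' \<in> J z'" for w w'
  proof -
    have "w *v axis i 1 = w' *v axis i 1" for i
    proof (rule ccontr)
      assume "w *v axis i 1 \<noteq> w' *v axis i 1"
      then obtain n where "inverse (real (Suc n)) < norm (w *v axis i 1 - w' *v axis i 1)"
        using reals_Archimedean by (metis right_minus_eq zero_less_norm_iff)
      then show False using z' w unfolding A_def by (metis (mono_tags, lifting) less_imp_le mem_Collect_eq)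
    qed
    then show ?thesis by (simp add: matrix_vector_mult_basis vec_eq_iff column_def)
  qed
  moreover have "J z' \<noteq> {}" using conservative_jac_onD(1)[OF cons] z'(1) r(2) by auto
  ultimately have "\<exists>M. J z' = {M}" by blast
  then show ?thesis using that z'(1) r by blast
qed

text \<open>At points with singleton \<open>J\<close> the map is differentiable with that element as
  its Jacobian. Such points accumulate at \<open>z\<close>, and the usco property of
  \<open>J\<close> makes a subsequence of the Jacobians converge.\<close>

lemma limit_jac_nonempty:
  fixes F :: "real^'N \<Rightarrow> real^'k"
  assumes cons: "conservative_jac_on S F J" and lip: "loc_lipschitz_on S F" and S: "open S" "z \<in> S"
  shows "limit_jac S F z \<noteq> {}"
proof -
  have "\<exists>z' M. z' \<in> ball z (inverse (Suc n)) \<and> z' \<in> S \<and> J z' = {M}" for n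
    using conservative_jac_on_dense_singleton[OF cons S, of "inverse (Suc n)"] by (metis inverse_positive_iff_positive of_nat_0_less_iff zero_less_Suc)
  then obtain zs Ms where zs: "\<And>n. zs n \<in> ball z (inverse (Suc n))" "\<And>n. zs n \<in> S" "\<And>n. J (zs n) = {Ms n}"
    by metis
  have lim: "zs \<longlonglongrightarrow> z"
    using zs(1) by (intro metric_tendsto_imp_tendsto[OF LIMSEQ_inverse_real_of_nat])
      (auto simp: dist_commute less_imp_le)
  obtain s M where s: "strict_mono s" "M \<in> J z" "(Ms \<circ> s) \<longlonglongrightarrow> M"
    using usco_on_convergent_subseq[OF conservative_jac_on_usco[OF cons] zs(2) _ S(2) lim, of Ms] zs(3) by blast
  have d: "(F has_derivative (*v) (Ms n)) (at (zs n))" for n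
    by (rule conservative_jac_on_singleton_has_derivative[OF cons lip S(1) zs(2) zs(3)])
  then have D: "matrix (frechet_derivative F (at (zs n))) = Ms n" for n
    using frechet_derivative_at[OF d, of n] by (metis matrix_of_matrix_vector_mul)
  have "M \<in> limit_jac S F z" unfolding limit_jac_def
  proof (rule CollectI, rule exI[of _ "zs \<circ> s"], intro conjI allI)
    show "(zs \<circ> s) \<longlonglongrightarrow> z" using lim s(1) LIMSEQ_subseq_LIMSEQ by blast
    show "(\<lambda>j. matrix (frechet_derivative F (at ((zs \<circ> s) j)))) \<longlonglongrightarrow> M" using s(3) by (simp add: D o_def)
    show "(zs \<circ> s) j \<in> S" "F differentiable (at ((zs \<circ> s) j))" for j
      using zs(2) d by (auto simp: differentiable_def)
  qed
  then show ?thesis by blast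
qed

text \<open>Only the chain rule along curves involves the given \<open>J\<close>: at each good time
  \<open>clarke_jac_direction\<close> is applied with the direction \<open>dc\<close>, so the
  derivatives of the curve and of \<open>F \<circ> c\<close> are kept.\<close>

theorem clarke_jac_conservative:
  fixes F :: "real^'N \<Rightarrow> real^'k"
  assumes pd: "path_differentiable_on S F" and S: "open S"
  shows "conservative_jac_on S F (clarke_jac_on S F)"
proof -
  obtain J where lip: "loc_lipschitz_on S F" and cons: "conservative_jac_on S F J"
    using pd unfolding path_differentiable_on_def by blast
  show ?thesis unfolding conservative_jac_on_iff_usco
  proof (intro conjI ballI allI impI; (elim conjE)?)
    show "clarke_jac_on S F z \<noteq> {}" if "z \<in> S" for z
      using limit_jac_nonempty[OF cons lip S that] by (simp add: clarke_jac_on_eq)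
    show "usco_on S (clarke_jac_on S F)"
      using usco_on_convex_hull[OF usco_on_limit_jac[OF lip S]] by (simp add: clarke_jac_on_eq[abs_def])
    fix c :: "real \<Rightarrow> real^'N" assume c: "abs_cont_curve c" "c ` {0..1} \<subseteq> S"
    show "AE t in lebesgue. t \<in> {0..1} \<longrightarrow>
           (\<exists>dc dF. (c has_vector_derivative dc) (at t within {0..1}) \<and>
                    ((F \<circ> c) has_vector_derivative dF) (at t within {0..1}) \<and>
                    (\<forall>M\<in>clarke_jac_on S F (c t). dF = M *v dc))"
      using conservative_jac_onD(4)[OF cons c]
    proof (eventually_elim, intro impI)
      fix t :: real
      assume t: "t \<in> {0..1}" and "t \<in> {0..1} \<longrightarrow>
           (\<exists>dc dF. (c has_vector_derivative dc) (at t within {0..1}) \<and>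
                    ((F \<circ> c) has_vector_derivative dF) (at t within {0..1}) \<and>
                    (\<forall>M\<in>J (c t). dF = M *v dc))"
      then obtain dc dF where d: "(c has_vector_derivative dc) (at t within {0..1})"
        "((F \<circ> c) has_vector_derivative dF) (at t within {0..1})" "\<And>M. M\<in>J (c t) \<Longrightarrow> M *v dc = dF"
        by metis
      have "c t \<in> S" using c(2) t by blast
      then have "dF = M *v dc" if "M \<in> clarke_jac_on S F (c t)" for M
        using clarke_jac_direction[OF cons lip S _ d(3) that] by simp
      then show "\<exists>dc dF. (c has_vector_derivative dc) (at t within {0..1}) \<and>
                    ((F \<circ> c) has_vector_derivative dF) (at t within {0..1}) \<and>
                    (\<forall>M\<in>clarke_jac_on S F (c t). dF = M *v dc)" using d(1,2) by blast
    qed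
  qed
qed

section \<open>Implicit differentiation of a fixed point\<close>

lemma jpair_simps [simp]:
  "jfst (jpair a b) = a" "jsnd (jpair a b) = b" "jpair (jfst z) (jsnd z) = z"
  by (auto simp: jpair_def jfst_def jsnd_def vec_eq_iff split: sum.split)

lemma jpair_arith:
  "jpair a b + jpair c d = jpair (a + c) (b + d)"
  "jpair a b - jpair c d = jpair (a - c) (b - d)"
  "r *\<^sub>R jpair a b = jpair (r *\<^sub>R a) (r *\<^sub>R b)"
  by (auto simp: jpair_def vec_eq_iff split: sum.split)

lemma linear_jfst: "linear jfst" and linear_jsnd: "linear jsnd"
  and linear_jpair2: "linear (\<lambda>b. jpair 0 b)"
  by (auto intro!: linearI simp: jpair_def jfst_def jsnd_def vec_eq_iff split: sum.split)

lemmas bounded_linear_jfst = linear_jfst[THEN linear_conv_bounded_linear[THEN iffD1]]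
  and bounded_linear_jsnd = linear_jsnd[THEN linear_conv_bounded_linear[THEN iffD1]]
  and bounded_linear_jpair2 = linear_jpair2[THEN linear_conv_bounded_linear[THEN iffD1]]

lemma norm_jpair_power2: "(norm (jpair a b))\<^sup>2 = (norm a)\<^sup>2 + (norm b)\<^sup>2"
proof -
  have "(\<Sum>i\<in>UNIV. (jpair a b $ i)\<^sup>2) = (\<Sum>i\<in>range Inl. (jpair a b $ i)\<^sup>2) + (\<Sum>i\<in>range Inr. (jpair a b $ i)\<^sup>2)"
    unfolding UNIV_sum by (intro sum.union_disjoint) auto
  also have "\<dots> = (\<Sum>i\<in>UNIV. (a $ i)\<^sup>2) + (\<Sum>i\<in>UNIV. (b $ i)\<^sup>2)"
    by (simp add: sum.reindex jpair_def)
  finally show ?thesis by (simp add: norm_vec_def L2_set_def sum_nonneg)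
qed

lemma norm_jpair_le: "norm (jpair a b) \<le> norm a + norm b"
  by (rule power2_le_imp_le) (auto simp: norm_jpair_power2 power2_sum)

lemma norm_jpair_0 [simp]: "norm (jpair a 0) = norm a" "norm (jpair 0 b) = norm b"
  using norm_jpair_power2[of a 0] norm_jpair_power2[of 0 b] by (simp_all add: power2_eq_iff_nonneg)

lemma matrix_vector_mult_jpair: "M *v jpair a b = blk1 M *v a + blk2 M *v b"
proof -
  have "(\<Sum>j\<in>UNIV. M $ i $ j * jpair a b $ j) = (\<Sum>j\<in>range Inl. M $ i $ j * jpair a b $ j)
      + (\<Sum>j\<in>range Inr. M $ i $ j * jpair a b $ j)" for i
    unfolding UNIV_sum by (intro sum.union_disjoint) auto
  then show ?thesis
    by (simp add: vec_eq_iff matrix_vector_mult_def sum.reindex blk1_def blk2_def) (simp add: jpair_def)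
qed

section \<open>Locally Lipschitz maps along curves\<close>

lemma loc_lipschitz_on_compose:
  assumes f: "loc_lipschitz_on S f" and g: "loc_lipschitz_on S' g" and "f ` S \<subseteq> S'"
  shows "loc_lipschitz_on S (g \<circ> f)"
  unfolding loc_lipschitz_on_def
proof
  fix x assume x: "x \<in> S"
  obtain e1 L1 where 1: "e1 > 0" "L1-lipschitz_on (ball x e1 \<inter> S) f"
    using f x unfolding loc_lipschitz_on_def by blast
  obtain e2 L2 where 2: "e2 > 0" "L2-lipschitz_on (ball (f x) e2 \<inter> S') g"
    using g x assms(3) unfolding loc_lipschitz_on_def by blast
  have L1: "0 \<le> L1" using 1(2) by (rule lipschitz_on_nonneg)
  define e where "e = min e1 (e2 / (L1 + 1))"
  have e: "e > 0" using 1 2 L1 by (simp add: e_def)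
  have "f ` (ball x e \<inter> S) \<subseteq> ball (f x) e2 \<inter> S'"
  proof (intro subsetI, elim imageE)
    fix v y assume y: "v = f y" "y \<in> ball x e \<inter> S"
    have "dist (f x) (f y) \<le> L1 * dist x y" using y x 1 by (intro lipschitz_onD[OF 1(2)]) (auto simp: e_def)
    also have "\<dots> \<le> (L1 + 1) * dist x y" by (intro mult_right_mono) auto
    also have "\<dots> < e2" using y L1 by (auto simp: e_def pos_less_divide_eq mult.commute)
    finally show "v \<in> ball (f x) e2 \<inter> S'" using y assms(3) by auto
  qed
  then have "(L2 * L1)-lipschitz_on (ball x e \<inter> S) (g \<circ> f)"
    by (intro lipschitz_on_compose lipschitz_on_subset[OF 1(2)] lipschitz_on_subset[OF 2(2)])
      (auto simp: e_def)
  then show "\<exists>e>0. \<exists>L. L-lipschitz_on (ball x e \<inter> S) (g \<circ> f)" using e by blast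
qed

lemma loc_lipschitz_on_continuous_on:
  assumes "loc_lipschitz_on S F"
  shows "continuous_on S F"
  unfolding continuous_on_eq_continuous_within
proof
  fix x assume x: "x \<in> S"
  then obtain e L where e: "e > 0" "L-lipschitz_on (ball x e \<inter> S) F"
    using assms unfolding loc_lipschitz_on_def by blast
  have "continuous (at x within (S \<inter> ball x e)) F"
    using lipschitz_on_continuous_on[OF e(2)] x e(1)
    by (simp add: continuous_on_eq_continuous_within Int_commute)
  moreover have "at x within (S \<inter> ball x e) = at x within S"
    using e(1) by (intro at_within_nhd[of x "ball x e"]) auto
  ultimately show "continuous (at x within S) F" by simp
qed

lemma abs_cont_curve_continuous_on:
  assumes "abs_cont_curve c"
  shows "continuous_on {0..1} c"
  unfolding continuous_on_iff
proof (intro ballI allI impI)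
  fix x e :: real assume x: "x \<in> {0..1}" and e: "e > 0"
  obtain d where d: "d > 0" "\<And>(n::nat) (a::nat\<Rightarrow>real) b.
        (\<forall>i<n. 0 \<le> a i \<and> a i \<le> b i \<and> b i \<le> 1) \<and>
        (\<forall>i<n. \<forall>j<n. i \<noteq> j \<longrightarrow> b i \<le> a j \<or> b j \<le> a i) \<and>
        (\<Sum>i<n. b i - a i) < d
        \<longrightarrow> (\<Sum>i<n. norm (c (b i) - c (a i))) < e"
    using assms e unfolding abs_cont_curve_def by blast
  have "dist (c y) (c x) < e" if "y \<in> {0..1}" "dist y x < d" for y
    using d(2)[of 1 "\<lambda>_. min x y" "\<lambda>_. max x y"] that x
    by (cases "x \<le> y") (auto simp: dist_norm min_def max_def norm_minus_commute)
  then show "\<exists>d>0. \<forall>x'\<in>{0..1}. dist x' x < d \<longrightarrow> dist (c x') (c x) < e" using d(1) by blast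
qed

lemma loc_lipschitz_on_compact_imp_lipschitz:
  assumes "loc_lipschitz_on S F" "compact C" "C \<subseteq> S"
  obtains L where "L-lipschitz_on C F"
proof -
  \<comment> \<open>A dummy time set brings the claim into the form for which uniform Lipschitz
    constants on compact sets are known.\<close>
  have "local_lipschitz {0::real} C (\<lambda>_. F)"
  proof (rule local_lipschitzI)
    fix t :: real and x assume "x \<in> C"
    then obtain e L where e: "e > 0" "L-lipschitz_on (ball x e \<inter> S) F"
      using assms unfolding loc_lipschitz_on_def by blast
    have "L-lipschitz_on (cball x (e/2) \<inter> C) F"
      using e(1) assms(3) by (intro lipschitz_on_subset[OF e(2)]) auto
    then show "\<exists>u>0. \<exists>L. \<forall>t\<in>cball t u \<inter> {0}. L-lipschitz_on (cball x u \<inter> C) F" using e(1) half_gt_zero by blast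
  qed
  then show ?thesis
    using local_lipschitz_compact_implies_lipschitz[of "{0::real}" C "\<lambda>_. F"] assms(2) that by auto
qed

text \<open>The curve has compact image, on which a single Lipschitz constant of \<open>F\<close> is
  valid.\<close>

lemma abs_cont_curve_compose:
  assumes c: "abs_cont_curve c" "c ` {0..1} \<subseteq> S" and F: "loc_lipschitz_on S F"
  shows "abs_cont_curve (F \<circ> c)"
proof -
  have "compact (c ` {0..1})"
    using abs_cont_curve_continuous_on[OF c(1)] by (rule compact_continuous_image) simp
  then obtain L where L: "L-lipschitz_on (c ` {0..1}) F"
    using loc_lipschitz_on_compact_imp_lipschitz[OF F] c(2) by blast
  have L0: "0 \<le> L" using L by (rule lipschitz_on_nonneg)
  show ?thesis unfolding abs_cont_curve_def
  proof (intro allI impI)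
    fix \<epsilon> :: real assume \<epsilon>: "\<epsilon> > 0"
    then have "\<epsilon> / (L + 1) > 0" using L0 by simp
    then obtain d where d: "d > 0" "\<And>(n::nat) (a::nat\<Rightarrow>real) b.
        (\<forall>i<n. 0 \<le> a i \<and> a i \<le> b i \<and> b i \<le> 1) \<and>
        (\<forall>i<n. \<forall>j<n. i \<noteq> j \<longrightarrow> b i \<le> a j \<or> b j \<le> a i) \<and>
        (\<Sum>i<n. b i - a i) < d
        \<longrightarrow> (\<Sum>i<n. norm (c (b i) - c (a i))) < \<epsilon> / (L + 1)"
      using c(1) unfolding abs_cont_curve_def by blast
    have "(\<Sum>i<n. norm ((F \<circ> c) (b i) - (F \<circ> c) (a i))) < \<epsilon>"
      if h: "(\<forall>i<n. 0 \<le> a i \<and> a i \<le> b i \<and> b i \<le> 1) \<and>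
        (\<forall>i<n. \<forall>j<n. i \<noteq> j \<longrightarrow> b i \<le> a j \<or> b j \<le> a i) \<and>
        (\<Sum>i<n. b i - a i) < d" for n :: nat and a b :: "nat \<Rightarrow> real"
    proof -
      have "(\<Sum>i<n. norm ((F \<circ> c) (b i) - (F \<circ> c) (a i))) \<le> (\<Sum>i<n. L * norm (c (b i) - c (a i)))"
      proof (rule sum_mono)
        fix i assume "i \<in> {..<n}"
        then have "0 \<le> a i" "a i \<le> b i" "b i \<le> 1" using h by auto
        then show "norm ((F \<circ> c) (b i) - (F \<circ> c) (a i)) \<le> L * norm (c (b i) - c (a i))"
          using lipschitz_onD[OF L, of "c (b i)" "c (a i)"] by (auto simp: dist_norm)
      qed
      also have "\<dots> = L * (\<Sum>i<n. norm (c (b i) - c (a i)))" by (simp add: sum_distrib_left)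
      also have "\<dots> \<le> L * (\<epsilon> / (L + 1))" using d(2)[of n a b] h L0 by (intro mult_left_mono) auto
      also have "\<dots> < \<epsilon>" using \<epsilon> L0 by (simp add: field_simps)
      finally show ?thesis .
    qed
    then show "\<exists>\<delta>>0. \<forall>(n::nat) (a::nat\<Rightarrow>real) b.
        (\<forall>i<n. 0 \<le> a i \<and> a i \<le> b i \<and> b i \<le> 1) \<and>
        (\<forall>i<n. \<forall>j<n. i \<noteq> j \<longrightarrow> b i \<le> a j \<or> b j \<le> a i) \<and>
        (\<Sum>i<n. b i - a i) < \<delta>
        \<longrightarrow> (\<Sum>i<n. norm ((F \<circ> c) (b i) - (F \<circ> c) (a i))) < \<epsilon>"
      using d(1) by (intro exI[of _ d] conjI allI impI)
  qed
qed

lemma bounded_bilinear_matrix_vector_mult: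
  "bounded_bilinear ((*v) :: real^'n^'m \<Rightarrow> real^'n \<Rightarrow> real^'m)"
proof
  show "\<exists>K. \<forall>a b. norm ((a :: real^'n^'m) *v b) \<le> norm a * norm b * K"
    by (rule exI[of _ 1]) (simp add: norm_matrix_vector_mult_le)
qed (auto simp: matrix_vector_mult_add_rdistrib matrix_vector_right_distrib
    scaleR_matrix_vector_assoc matrix_vector_mult_scaleR)

lemma conservative_jac_on_cong:
  assumes "\<And>z. z \<in> S \<Longrightarrow> J z = J' z"
  shows "conservative_jac_on S F J \<longleftrightarrow> conservative_jac_on S F J'"
proof -
  have graph: "{(z, M). z \<in> S \<and> M \<in> J z} = {(z, M). z \<in> S \<and> M \<in> J' z}" using assms by auto
  have "c ` {0..1} \<subseteq> S \<Longrightarrow> t \<in> {0..1} \<Longrightarrow> J (c t) = J' (c t)" for c :: "real \<Rightarrow> _" and t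
    using assms by blast
  then show ?thesis
    unfolding conservative_jac_on_def graph by (simp add: assms cong: conj_cong imp_cong)
qed

text \<open>The implicit Jacobian \<open>M\<close> is characterised by \<open>M x\<close> being the fixed point of the linearised
  step for every \<open>x\<close>; unlike the formula with the matrix inverse, this passes to limits.\<close>

definition linearized_step ::
  "real \<Rightarrow> real^('p::finite + 'm::finite)^'m \<Rightarrow> real^('p + 'm)^'m \<Rightarrow> real^'p \<Rightarrow> real^'m \<Rightarrow> real^'m" where
  "linearized_step \<gamma> MT MG x v = MT *v jpair x (v - \<gamma> *\<^sub>R (MG *v jpair x v))"

context
  fixes MT MG :: "real^('p::finite + 'm::finite)^'m" and \<gamma> q :: real
  assumes MT: "\<And>d. norm (blk2 MT *v d) \<le> norm d"
    and MG: "\<And>d. norm (d - \<gamma> *\<^sub>R (blk2 MG *v d)) \<le> q * norm d"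
    and q: "q < 1"
begin

lemma linearized_step_contraction:
  "norm (linearized_step \<gamma> MT MG x v - linearized_step \<gamma> MT MG x v') \<le> q * norm (v - v')"
proof -
  have "linearized_step \<gamma> MT MG x v - linearized_step \<gamma> MT MG x v' =
      blk2 MT *v ((v - v') - \<gamma> *\<^sub>R (blk2 MG *v (v - v')))"
    unfolding linearized_step_def matrix_vector_mult_jpair
    by (simp add: matrix_vector_right_distrib matrix_vector_mult_diff_distrib
        matrix_vector_mult_scaleR algebra_simps)
  then show ?thesis using order_trans[OF MT MG] by simp
qed

lemma linearized_step_unique:
  assumes "v = linearized_step \<gamma> MT MG x v" "v' = linearized_step \<gamma> MT MG x v'"
  shows "v = v'"
proof -
  have "norm (v - v') \<le> q * norm (v - v')"
    using linearized_step_contraction[of x v v'] assms by simp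
  then have "(1 - q) * norm (v - v') \<le> 0" by (simp add: algebra_simps)
  then show ?thesis using q by (simp add: mult_le_0_iff)
qed

text \<open>With \<open>A\<close> the matrix to be inverted and \<open>N\<close> the right factor,
  the step is \<open>N *v x + (v - A *v v)\<close>; its fixed points solve
  \<open>A *v v = N *v x\<close>. Uniqueness of the fixed point for \<open>x = 0\<close> is
  injectivity of \<open>A\<close>, which for a square matrix gives the inverse.\<close>

lemma implicit_jacobian_iff:
  "M = matrix_inv (mat 1 - blk2 MT ** (mat 1 - \<gamma> *\<^sub>R blk2 MG)) ** (blk1 MT - \<gamma> *\<^sub>R (blk2 MT ** blk1 MG))
    \<longleftrightarrow> (\<forall>x. M *v x = linearized_step \<gamma> MT MG x (M *v x))"
proof -
  define A where "A = mat 1 - blk2 MT ** (mat 1 - \<gamma> *\<^sub>R blk2 MG)"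
  define N where "N = blk1 MT - \<gamma> *\<^sub>R (blk2 MT ** blk1 MG)"
  have step: "linearized_step \<gamma> MT MG x v = N *v x + (v - A *v v)" for x v
    unfolding linearized_step_def matrix_vector_mult_jpair A_def N_def
    by (simp add: matrix_vector_right_distrib matrix_vector_mult_diff_distrib matrix_vector_mult_diff_rdistrib
        matrix_vector_mult_scaleR matrix_vector_mul_assoc[symmetric] scaleR_matrix_vector_assoc[symmetric] algebra_simps)
  have "inj ((*v) A)"
  proof (rule injI)
    fix v v' assume "A *v v = A *v v'"
    then have "A *v (v - v') = 0" by (simp add: matrix_vector_mult_diff_distrib)
    then show "v = v'"
      using linearized_step_unique[of "v - v'" 0 0] by (simp add: step)
  qed
  then have inv: "A ** matrix_inv A = mat 1" "matrix_inv A ** A = mat 1"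
    using matrix_left_invertible_injective[of A] invertible_left_inverse[of A]
    unfolding matrix_inv_def invertible_def by (metis (mono_tags, lifting) someI_ex)+
  have "M = matrix_inv A ** N \<longleftrightarrow> A ** M = N"
    using inv by (metis matrix_mul_assoc matrix_mul_lid)
  also have "\<dots> \<longleftrightarrow> (\<forall>x. A *v (M *v x) = N *v x)"
    by (auto simp: matrix_eq matrix_vector_mul_assoc)
  also have "\<dots> \<longleftrightarrow> (\<forall>x. M *v x = linearized_step \<gamma> MT MG x (M *v x))"
    by (auto simp: step)
  finally show ?thesis by (simp add: A_def N_def)
qed

text \<open>A fixed point \<open>v\<close> of a \<open>q\<close>-contraction has norm at most the
  norm of the image of 0 divided by \<open>1 - q\<close>. The remaining factor estimates that image,
  \<open>MT\<close> applied to \<open>jpair x\<close> of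
  \<open>- \<gamma> *\<^sub>R (MG *v jpair x 0)\<close>.\<close>

lemma implicit_jacobian_bound:
  assumes "\<And>x. M *v x = linearized_step \<gamma> MT MG x (M *v x)" "norm MT \<le> B" "norm MG \<le> B'" "0 \<le> \<gamma>"
  shows "norm (M *v x) \<le> B * (1 + \<gamma> * B') / (1 - q) * norm x"
proof -
  have "norm (linearized_step \<gamma> MT MG x 0) \<le> norm MT * norm (jpair x (- (\<gamma> *\<^sub>R (MG *v jpair x 0))))"
    by (simp add: linearized_step_def norm_matrix_vector_mult_le)
  also have "\<dots> \<le> norm MT * (norm x + \<gamma> * (norm MG * norm x))"
    using norm_jpair_le[of x "- (\<gamma> *\<^sub>R (MG *v jpair x 0))"] norm_matrix_vector_mult_le[of MG "jpair x 0"] assms(4)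
    by (intro mult_left_mono) (auto intro: order_trans[OF _ add_left_mono[OF mult_left_mono]])
  also have "\<dots> \<le> B * (norm x + \<gamma> * (B' * norm x))"
    using assms(2-4) order_trans[OF norm_ge_zero assms(2)]
    by (intro mult_mono add_mono mult_left_mono mult_right_mono) auto
  finally have 1: "norm (linearized_step \<gamma> MT MG x 0) \<le> B * (1 + \<gamma> * B') * norm x" by (simp add: algebra_simps)
  have "norm (M *v x) = norm ((linearized_step \<gamma> MT MG x (M *v x) - linearized_step \<gamma> MT MG x 0) + linearized_step \<gamma> MT MG x 0)"
    using assms(1) by simp
  also have "\<dots> \<le> q * norm (M *v x) + B * (1 + \<gamma> * B') * norm x"
    using 1 linearized_step_contraction[of x "M *v x" 0] by (intro norm_triangle_le add_mono) simp_all
  finally have "(1 - q) * norm (M *v x) \<le> B * (1 + \<gamma> * B') * norm x" by (simp add: algebra_simps)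
  then show ?thesis using q by (simp add: field_simps)
qed

end

section \<open>Fixed points of a parametrised contraction\<close>

context
  fixes \<Theta> :: "(real^'p) set" and T G :: "real^('p + 'm) \<Rightarrow> real^'m" and ys :: "real^'p \<Rightarrow> real^'m"
    and \<gamma> q :: real
  assumes open_\<Theta>: "open \<Theta>"
    and T_pd: "path_differentiable_on {z. jfst z \<in> \<Theta>} T"
    and G_pd: "path_differentiable_on {z. jfst z \<in> \<Theta>} G"
    and \<gamma>: "0 < \<gamma>" and q: "q < 1"
    and T_nonexp: "\<And>\<theta> y y'. \<theta> \<in> \<Theta> \<Longrightarrow> norm (T (jpair \<theta> y) - T (jpair \<theta> y')) \<le> norm (y - y')"
    and G_contr: "\<And>\<theta> y y'. \<theta> \<in> \<Theta> \<Longrightarrow>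
      norm ((y - \<gamma> *\<^sub>R G (jpair \<theta> y)) - (y' - \<gamma> *\<^sub>R G (jpair \<theta> y'))) \<le> q * norm (y - y')"
    and fixed: "\<And>\<theta>. \<theta> \<in> \<Theta> \<Longrightarrow> T (jpair \<theta> (ys \<theta> - \<gamma> *\<^sub>R G (jpair \<theta> (ys \<theta>)))) = ys \<theta>"
begin

private definition "S = {z :: real^('p + 'm). jfst z \<in> \<Theta>}"
text \<open>The forward (gradient) step carrying the parameter along, so that
  \<open>T \<circ> R\<close> is the whole iteration and \<open>ys\<close> its fixed point.\<close>

private definition "R z = jpair (jfst z) (jsnd z - \<gamma> *\<^sub>R G z)" for z

private lemma open_S: "open S"
proof -
  have "S = jfst -` \<Theta>" by (auto simp: S_def)
  then show ?thesis
    using open_\<Theta> continuous_on_open_vimage[of UNIV jfst] bounded_linear.continuous_on[OF bounded_linear_jfst continuous_on_id]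
    by (auto simp: S_def)
qed

private lemma R_eq: "R z = z - \<gamma> *\<^sub>R jpair 0 (G z)"
proof -
  have "z - \<gamma> *\<^sub>R jpair 0 (G z) = jpair (jfst z) (jsnd z) - \<gamma> *\<^sub>R jpair 0 (G z)" by simp
  also have "\<dots> = R z" unfolding R_def jpair_arith by simp
  finally show ?thesis by simp
qed

private lemma R_lip: "loc_lipschitz_on S R"
  unfolding loc_lipschitz_on_def
proof
  fix x assume "x \<in> S"
  then obtain e L where e: "e > 0" "L-lipschitz_on (ball x e \<inter> S) G"
    using G_pd unfolding S_def path_differentiable_on_def loc_lipschitz_on_def by blast
  have "(1 + \<gamma> * L)-lipschitz_on (ball x e \<inter> S) R"
  proof (rule lipschitz_onI)
    fix z z' assume z: "z \<in> ball x e \<inter> S" "z' \<in> ball x e \<inter> S"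
    have "R z - R z' = (z - z') - \<gamma> *\<^sub>R jpair 0 (G z - G z')"
      unfolding R_eq by (simp add: algebra_simps jpair_arith)
    then have "norm (R z - R z') \<le> norm (z - z') + \<gamma> * norm (G z - G z')"
      using norm_triangle_ineq4[of "z - z'" "\<gamma> *\<^sub>R jpair 0 (G z - G z')"] \<gamma> by simp
    also have "\<dots> \<le> norm (z - z') + \<gamma> * (L * norm (z - z'))"
      using lipschitz_onD[OF e(2) z] \<gamma> by (simp add: dist_norm)
    finally show "dist (R z) (R z') \<le> (1 + \<gamma> * L) * dist z z'" by (simp add: dist_norm algebra_simps)
  qed (use \<gamma> lipschitz_on_nonneg[OF e(2)] in simp)
  then show "\<exists>e>0. \<exists>L. L-lipschitz_on (ball x e \<inter> S) R" using e(1) by blast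
qed

private lemma R_S: "R ` S \<subseteq> S"
  by (auto simp: R_def S_def)

private lemma TR_lip: "loc_lipschitz_on S (T \<circ> R)"
  using T_pd by (intro loc_lipschitz_on_compose[OF R_lip _ R_S]) (simp add: path_differentiable_on_def S_def)

private lemma fixed': "\<theta> \<in> \<Theta> \<Longrightarrow> (T \<circ> R) (jpair \<theta> (ys \<theta>)) = ys \<theta>"
  using fixed by (simp add: R_def)

private lemma TR_contr: "\<theta> \<in> \<Theta> \<Longrightarrow> norm ((T \<circ> R) (jpair \<theta> y) - (T \<circ> R) (jpair \<theta> y')) \<le> q * norm (y - y')"
  unfolding R_def o_def using order_trans[OF T_nonexp G_contr] by simp

text \<open>Inserting the value at \<open>jpair \<theta>' (ys \<theta>)\<close> splits the
  difference into a contraction in y, absorbed on the left, and a change of parameter alone.\<close>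

private lemma ys_diff_le:
  assumes "\<theta> \<in> \<Theta>" "\<theta>' \<in> \<Theta>"
  shows "(1 - q) * norm (ys \<theta>' - ys \<theta>) \<le> norm ((T \<circ> R) (jpair \<theta>' (ys \<theta>)) - (T \<circ> R) (jpair \<theta> (ys \<theta>)))"
proof -
  have "norm (ys \<theta>' - ys \<theta>) = norm (((T \<circ> R) (jpair \<theta>' (ys \<theta>')) - (T \<circ> R) (jpair \<theta>' (ys \<theta>)))
      + ((T \<circ> R) (jpair \<theta>' (ys \<theta>)) - (T \<circ> R) (jpair \<theta> (ys \<theta>))))"
    unfolding fixed'[OF assms(1)] fixed'[OF assms(2)] by simp
  also have "\<dots> \<le> q * norm (ys \<theta>' - ys \<theta>) + norm ((T \<circ> R) (jpair \<theta>' (ys \<theta>)) - (T \<circ> R) (jpair \<theta> (ys \<theta>)))"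
    by (intro norm_triangle_le add_mono TR_contr assms order_refl)
  finally show ?thesis by (simp add: algebra_simps)
qed

text \<open>The Lipschitz constant of \<open>T \<circ> R\<close> is only available near
  \<open>z0\<close>, and a priori \<open>ys \<theta>\<close> could be far from
  \<open>ys \<theta>0\<close>. The estimate \<open>key\<close> is therefore used twice: with base
  point \<theta>0, where its premises concern only \<open>ys \<theta>0\<close>, to keep the graph
  near \<open>z0\<close>, and then between two arbitrary nearby parameters.\<close>

lemma fixed_point_loc_lipschitz: "loc_lipschitz_on \<Theta> ys"
  unfolding loc_lipschitz_on_def
proof
  fix \<theta>0 assume \<theta>0: "\<theta>0 \<in> \<Theta>"
  define z0 where "z0 = jpair \<theta>0 (ys \<theta>0)"
  have "z0 \<in> S" using \<theta>0 by (simp add: z0_def S_def)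
  then obtain e L where e: "e > 0" "L-lipschitz_on (ball z0 e \<inter> S) (T \<circ> R)"
    using TR_lip unfolding loc_lipschitz_on_def by blast
  have L: "0 \<le> L" using e(2) by (rule lipschitz_on_nonneg)
  define L' where "L' = L / (1 - q)"
  have L': "0 \<le> L'" using L q by (simp add: L'_def)
  have key: "norm (ys \<theta>' - ys \<theta>) \<le> L' * norm (\<theta>' - \<theta>)"
    if "\<theta> \<in> \<Theta>" "\<theta>' \<in> \<Theta>" "jpair \<theta> (ys \<theta>) \<in> ball z0 e" "jpair \<theta>' (ys \<theta>) \<in> ball z0 e" for \<theta> \<theta>'
  proof -
    have "(1 - q) * norm (ys \<theta>' - ys \<theta>) \<le> L * norm (jpair \<theta>' (ys \<theta>) - jpair \<theta> (ys \<theta>))"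
      using ys_diff_le[OF that(1,2)] lipschitz_onD[OF e(2), of "jpair \<theta>' (ys \<theta>)" "jpair \<theta> (ys \<theta>)"] that
      by (simp add: dist_norm S_def)
    also have "\<dots> = L * norm (\<theta>' - \<theta>)" by (simp add: jpair_arith)
    finally show ?thesis using q by (simp add: L'_def field_simps)
  qed
  \<comment> \<open>Chosen so that \<open>d + L' * d = e / 2\<close>: a parameter within
    \<open>d\<close> of \<theta>0 paired with a value within \<open>L' * d\<close> of
    \<open>ys \<theta>0\<close> stays in the ball.\<close>
  define d where "d = e / (2 * (L' + 1))"
  have d: "d > 0" "d * (L' + 1) = e / 2" using e(1) L' by (auto simp: d_def field_simps)
  have de: "d + L' * d = e/2" using d(2) by (simp add: algebra_simps)
  have in_ball: "jpair \<theta>' (ys \<theta>) \<in> ball z0 e"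
    if \<theta>: "\<theta> \<in> \<Theta>" "\<theta> \<in> ball \<theta>0 d" "\<theta>' \<in> ball \<theta>0 d" for \<theta> \<theta>'
  proof -
    have "d \<le> e/2" using de d(1) L' by (smt (verit) mult_nonneg_nonneg)
    then have "d < e" using e(1) by linarith
    then have "jpair \<theta> (ys \<theta>0) \<in> ball z0 e"
      using \<theta> unfolding z0_def by (simp add: dist_norm jpair_arith)
    then have "norm (ys \<theta> - ys \<theta>0) \<le> L' * norm (\<theta> - \<theta>0)"
      using \<theta> \<theta>0 e(1) by (intro key) (auto simp: z0_def)
    also have "\<dots> \<le> L' * d" using \<theta> L' by (intro mult_left_mono) (auto simp: dist_norm norm_minus_commute)
    finally have "norm (jpair (\<theta>' - \<theta>0) (ys \<theta> - ys \<theta>0)) < e"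
      using norm_jpair_le[of "\<theta>' - \<theta>0" "ys \<theta> - ys \<theta>0"] \<theta>(3) de e(1) by (simp add: dist_norm norm_minus_commute)
    then have "dist (jpair \<theta>' (ys \<theta>)) z0 < e" by (simp add: z0_def dist_norm jpair_arith)
    then show ?thesis by (simp add: dist_commute)
  qed
  have "L'-lipschitz_on (ball \<theta>0 d \<inter> \<Theta>) ys"
    using key in_ball L' by (intro lipschitz_onI) (auto simp: dist_norm)
  then show "\<exists>e>0. \<exists>L. L-lipschitz_on (ball \<theta>0 e \<inter> \<Theta>) ys" using d(1) by blast
qed

private lemma graph_lip: "loc_lipschitz_on \<Theta> (\<lambda>\<theta>. jpair \<theta> (ys \<theta>))"
  unfolding loc_lipschitz_on_def
proof
  fix x assume "x \<in> \<Theta>"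
  then obtain e L where e: "e > 0" "L-lipschitz_on (ball x e \<inter> \<Theta>) ys"
    using fixed_point_loc_lipschitz unfolding loc_lipschitz_on_def by blast
  have "(1 + L)-lipschitz_on (ball x e \<inter> \<Theta>) (\<lambda>\<theta>. jpair \<theta> (ys \<theta>))"
  proof (rule lipschitz_onI)
    fix z z' assume z: "z \<in> ball x e \<inter> \<Theta>" "z' \<in> ball x e \<inter> \<Theta>"
    show "dist (jpair z (ys z)) (jpair z' (ys z')) \<le> (1 + L) * dist z z'"
      using norm_jpair_le[of "z - z'" "ys z - ys z'"] lipschitz_onD[OF e(2) z]
      by (simp add: dist_norm jpair_arith algebra_simps)
  qed (use lipschitz_on_nonneg[OF e(2)] in simp)
  then show "\<exists>e>0. \<exists>L. L-lipschitz_on (ball x e \<inter> \<Theta>) (\<lambda>\<theta>. jpair \<theta> (ys \<theta>))" using e(1) by blast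
qed

text \<open>Along \<open>jpair 0 d\<close> only y changes, so nonexpansiveness in y bounds the
  quotients by \<open>norm d\<close>; the target of the directional bound is 0.\<close>

private lemma clarke_T_bound:
  assumes "M \<in> clarke_jac_on S T z" "z \<in> S"
  shows "norm (blk2 M *v d) \<le> norm d"
proof -
  have "norm (M *v jpair 0 d - 0) \<le> norm d"
  proof (rule clarke_jac_directional_bound[OF assms(1) open_S assms(2)])
    fix w assume "w \<in> S"
    then have w: "jfst w \<in> \<Theta>" by (simp add: S_def)
    have "norm (T (w + t *\<^sub>R jpair 0 d) - T w - t *\<^sub>R 0) \<le> norm d * t" if "t > 0" for t
    proof -
      have "w + t *\<^sub>R jpair 0 d = jpair (jfst w) (jsnd w) + t *\<^sub>R jpair 0 d" by simp
      also have "\<dots> = jpair (jfst w) (jsnd w + t *\<^sub>R d)" unfolding jpair_arith by simp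
      finally show ?thesis
        using T_nonexp[OF w, of "jsnd w + t *\<^sub>R d" "jsnd w"] that by (simp add: mult.commute)
    qed
    then show "\<exists>\<epsilon>>0. \<forall>t. 0 < t \<and> t < \<epsilon> \<longrightarrow> norm (T (w + t *\<^sub>R jpair 0 d) - T w - t *\<^sub>R 0) \<le> norm d * t"
      using zero_less_one by blast
  qed
  then show ?thesis by (simp add: matrix_vector_mult_jpair)
qed

private lemma clarke_G_bound:
  assumes "M \<in> clarke_jac_on S G z" "z \<in> S"
  shows "norm (d - \<gamma> *\<^sub>R (blk2 M *v d)) \<le> q * norm d"
proof -
  \<comment> \<open>The contraction of \<open>y - \<gamma> *\<^sub>R G\<close> says that quotients
    of \<open>G\<close> in direction \<open>d\<close> lie within
    \<open>q * norm d / \<gamma>\<close> of \<open>(1/\<gamma>) *\<^sub>R d\<close>, which is the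
    shape of the directional bound.\<close>
  have "norm (M *v jpair 0 d - (1/\<gamma>) *\<^sub>R d) \<le> q * norm d / \<gamma>"
  proof (rule clarke_jac_directional_bound[OF assms(1) open_S assms(2)])
    fix w assume "w \<in> S"
    then have w: "jfst w \<in> \<Theta>" by (simp add: S_def)
    have "norm (G (w + t *\<^sub>R jpair 0 d) - G w - t *\<^sub>R ((1/\<gamma>) *\<^sub>R d)) \<le> q * norm d / \<gamma> * t" if t: "t > 0" for t
    proof -
      have wt: "w + t *\<^sub>R jpair 0 d = jpair (jfst w) (jsnd w + t *\<^sub>R d)"
      proof -
        have "w + t *\<^sub>R jpair 0 d = jpair (jfst w) (jsnd w) + t *\<^sub>R jpair 0 d" by simp
        also have "\<dots> = jpair (jfst w) (jsnd w + t *\<^sub>R d)" unfolding jpair_arith by simp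
        finally show ?thesis .
      qed
      define D where "D = G (jpair (jfst w) (jsnd w + t *\<^sub>R d)) - G w"
      have "norm (t *\<^sub>R d - \<gamma> *\<^sub>R D) \<le> q * (t * norm d)"
        using G_contr[OF w, of "jsnd w + t *\<^sub>R d" "jsnd w"] t by (simp add: D_def algebra_simps)
      moreover have "D - t *\<^sub>R ((1/\<gamma>) *\<^sub>R d) = (- (1/\<gamma>)) *\<^sub>R (t *\<^sub>R d - \<gamma> *\<^sub>R D)"
        using \<gamma> by (simp add: algebra_simps)
      then have "norm (D - t *\<^sub>R ((1/\<gamma>) *\<^sub>R d)) = norm (t *\<^sub>R d - \<gamma> *\<^sub>R D) / \<gamma>"
        using \<gamma> by (simp only: norm_scaleR) simp
      ultimately show ?thesis unfolding wt D_def[symmetric] using \<gamma> by (simp add: divide_le_cancel mult_ac)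
    qed
    then show "\<exists>\<epsilon>>0. \<forall>t. 0 < t \<and> t < \<epsilon> \<longrightarrow>
        norm (G (w + t *\<^sub>R jpair 0 d) - G w - t *\<^sub>R ((1/\<gamma>) *\<^sub>R d)) \<le> q * norm d / \<gamma> * t"
      using zero_less_one by blast
  qed
  moreover have "d - \<gamma> *\<^sub>R (blk2 M *v d) = (- \<gamma>) *\<^sub>R (M *v jpair 0 d - (1/\<gamma>) *\<^sub>R d)"
    using \<gamma> by (simp add: matrix_vector_mult_jpair algebra_simps)
  then have "norm (d - \<gamma> *\<^sub>R (blk2 M *v d)) = \<gamma> * norm (M *v jpair 0 d - (1/\<gamma>) *\<^sub>R d)"
    using \<gamma> by (simp only: norm_scaleR)
  ultimately show ?thesis using \<gamma> by (simp add: pos_le_divide_eq mult.commute)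
qed

private definition "Jys \<theta> = {M. \<exists>MT\<in>clarke_jac_on S T (R (jpair \<theta> (ys \<theta>))). \<exists>MG\<in>clarke_jac_on S G (jpair \<theta> (ys \<theta>)).
    \<forall>x. M *v x = linearized_step \<gamma> MT MG x (M *v x)}" for \<theta>

private lemma graph_S: "\<theta> \<in> \<Theta> \<Longrightarrow> jpair \<theta> (ys \<theta>) \<in> S" "\<theta> \<in> \<Theta> \<Longrightarrow> R (jpair \<theta> (ys \<theta>)) \<in> S"
  by (simp_all add: S_def R_def)

private lemma Jys_eq:
  assumes "\<theta> \<in> \<Theta>"
  shows "{matrix_inv (mat 1 - blk2 MT ** (mat 1 - \<gamma> *\<^sub>R blk2 MG)) ** (blk1 MT - \<gamma> *\<^sub>R (blk2 MT ** blk1 MG)) | MT MG.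
      MT \<in> clarke_jac_on S T (R (jpair \<theta> (ys \<theta>))) \<and> MG \<in> clarke_jac_on S G (jpair \<theta> (ys \<theta>))} = Jys \<theta>"
proof -
  have "M = matrix_inv (mat 1 - blk2 MT ** (mat 1 - \<gamma> *\<^sub>R blk2 MG)) ** (blk1 MT - \<gamma> *\<^sub>R (blk2 MT ** blk1 MG))
    \<longleftrightarrow> (\<forall>x. M *v x = linearized_step \<gamma> MT MG x (M *v x))"
    if "MT \<in> clarke_jac_on S T (R (jpair \<theta> (ys \<theta>)))" "MG \<in> clarke_jac_on S G (jpair \<theta> (ys \<theta>))" for M MT MG
    using clarke_T_bound[OF that(1) graph_S(2)[OF assms]] clarke_G_bound[OF that(2) graph_S(1)[OF assms]] q
    by (rule implicit_jacobian_iff)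
  then show ?thesis unfolding Jys_def by (intro set_eqI) (simp, metis)
qed

private lemma T_cons: "conservative_jac_on S T (clarke_jac_on S T)"
  and G_cons: "conservative_jac_on S G (clarke_jac_on S G)"
  using clarke_jac_conservative T_pd G_pd open_S by (simp_all add: S_def)

private lemma graph_tendsto:
  assumes "\<And>n. \<theta>s n \<in> \<Theta>" "\<theta> \<in> \<Theta>" "\<theta>s \<longlonglongrightarrow> \<theta>"
  shows "(\<lambda>n. jpair (\<theta>s n) (ys (\<theta>s n))) \<longlonglongrightarrow> jpair \<theta> (ys \<theta>)"
    "(\<lambda>n. R (jpair (\<theta>s n) (ys (\<theta>s n)))) \<longlonglongrightarrow> R (jpair \<theta> (ys \<theta>))"
proof -
  show 1: "(\<lambda>n. jpair (\<theta>s n) (ys (\<theta>s n))) \<longlonglongrightarrow> jpair \<theta> (ys \<theta>)"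
    using continuous_on_tendsto_compose[OF loc_lipschitz_on_continuous_on[OF graph_lip] assms(3,2)] assms(1) by simp
  show "(\<lambda>n. R (jpair (\<theta>s n) (ys (\<theta>s n)))) \<longlonglongrightarrow> R (jpair \<theta> (ys \<theta>))"
    using continuous_on_tendsto_compose[OF loc_lipschitz_on_continuous_on[OF R_lip] 1] assms(1,2) graph_S by simp
qed

text \<open>Local bounds on the Clarke Jacobians of \<open>T\<close> and \<open>G\<close> pull back
  along the continuous maps from \<theta> to their base points. For the closed graph, convergent
  subsequences of both Jacobians are extracted and the fixed-point equation passes to the
  limit.\<close>

private lemma usco_Jys: "usco_on \<Theta> Jys"
  unfolding usco_on_def closed_graph_iff_sequentially
proof (intro conjI ballI allI impI; (elim conjE)?)
  fix \<theta> assume \<theta>: "\<theta> \<in> \<Theta>"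
  obtain eT BT where T: "eT > 0" "\<And>z' M. z' \<in> ball (R (jpair \<theta> (ys \<theta>))) eT \<Longrightarrow> z' \<in> S \<Longrightarrow> M \<in> clarke_jac_on S T z' \<Longrightarrow> norm M \<le> BT"
    using usco_on_bounded[OF conservative_jac_on_usco[OF T_cons] graph_S(2)[OF \<theta>]] by metis
  obtain eG BG where G: "eG > 0" "\<And>z' M. z' \<in> ball (jpair \<theta> (ys \<theta>)) eG \<Longrightarrow> z' \<in> S \<Longrightarrow> M \<in> clarke_jac_on S G z' \<Longrightarrow> norm M \<le> BG"
    using usco_on_bounded[OF conservative_jac_on_usco[OF G_cons] graph_S(1)[OF \<theta>]] by metis
  define g where "g \<theta> = jpair \<theta> (ys \<theta>)" for \<theta>
  have cont: "continuous_on \<Theta> g" "continuous_on \<Theta> (R \<circ> g)"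
    using loc_lipschitz_on_continuous_on[OF graph_lip]
      loc_lipschitz_on_continuous_on[OF loc_lipschitz_on_compose[OF graph_lip R_lip]] graph_S
    by (auto simp: g_def[abs_def] o_def image_subset_iff)
  obtain d1 where d1: "d1 > 0" "\<And>\<theta>'. \<theta>' \<in> \<Theta> \<Longrightarrow> dist \<theta>' \<theta> < d1 \<Longrightarrow> dist (g \<theta>') (g \<theta>) < eG"
    using cont(1) \<theta> G(1) unfolding continuous_on_iff by metis
  obtain d2 where d2: "d2 > 0" "\<And>\<theta>'. \<theta>' \<in> \<Theta> \<Longrightarrow> dist \<theta>' \<theta> < d2 \<Longrightarrow> dist ((R \<circ> g) \<theta>') ((R \<circ> g) \<theta>) < eT"
    using cont(2) \<theta> T(1) unfolding continuous_on_iff by metis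
  define B where "B = real CARD('m) * (real CARD('p) * (BT * (1 + \<gamma> * BG) / (1 - q)))"
  have "norm M \<le> B" if \<theta>': "\<theta>' \<in> ball \<theta> (min d1 d2) \<inter> \<Theta>" and M: "M \<in> Jys \<theta>'" for \<theta>' M
  proof -
    obtain MT MG where J: "MT \<in> clarke_jac_on S T (R (jpair \<theta>' (ys \<theta>')))" "MG \<in> clarke_jac_on S G (jpair \<theta>' (ys \<theta>'))"
      and eq: "\<And>x. M *v x = linearized_step \<gamma> MT MG x (M *v x)"
      using M unfolding Jys_def by blast
    have \<theta>'\<Theta>: "\<theta>' \<in> \<Theta>" using \<theta>' by simp
    have "norm MG \<le> BG"
      using d1(2)[of \<theta>'] \<theta>' by (intro G(2)[OF _ graph_S(1)[OF \<theta>'\<Theta>] J(2)]) (simp add: g_def dist_commute)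
    moreover have "norm MT \<le> BT"
      using d2(2)[of \<theta>'] \<theta>' by (intro T(2)[OF _ graph_S(2)[OF \<theta>'\<Theta>] J(1)]) (simp add: g_def dist_commute)
    ultimately have "norm (M *v x) \<le> BT * (1 + \<gamma> * BG) / (1 - q) * norm x" for x
      using \<gamma> by (intro implicit_jacobian_bound[OF clarke_T_bound[OF J(1) graph_S(2)[OF \<theta>'\<Theta>]]
            clarke_G_bound[OF J(2) graph_S(1)[OF \<theta>'\<Theta>]] q eq]) auto
    then show ?thesis unfolding B_def by (rule norm_matrix_le_of_operator_bound)
  qed
  then show "\<exists>e>0. \<exists>B. \<forall>z'\<in>ball \<theta> e \<inter> \<Theta>. \<forall>M\<in>Jys z'. norm M \<le> B"
    using d1(1) d2(1) by (intro exI[of _ "min d1 d2"] conjI exI[of _ B]) auto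
next
  fix \<theta>s Ms \<theta> M
  assume *: "\<forall>n. \<theta>s n \<in> \<Theta> \<and> Ms n \<in> Jys (\<theta>s n)" "\<theta> \<in> \<Theta>" "\<theta>s \<longlonglongrightarrow> \<theta>" "Ms \<longlonglongrightarrow> M"
  have "\<forall>n. \<exists>MT MG. MT \<in> clarke_jac_on S T (R (jpair (\<theta>s n) (ys (\<theta>s n)))) \<and> MG \<in> clarke_jac_on S G (jpair (\<theta>s n) (ys (\<theta>s n))) \<and>
      (\<forall>x. Ms n *v x = linearized_step \<gamma> MT MG x (Ms n *v x))"
    using *(1) unfolding Jys_def by blast
  then obtain MT MG where J: "\<And>n. MT n \<in> clarke_jac_on S T (R (jpair (\<theta>s n) (ys (\<theta>s n))))"
    "\<And>n. MG n \<in> clarke_jac_on S G (jpair (\<theta>s n) (ys (\<theta>s n)))"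
    "\<And>n x. Ms n *v x = linearized_step \<gamma> (MT n) (MG n) x (Ms n *v x)" by metis
  have \<theta>s: "\<theta>s n \<in> \<Theta>" for n using *(1) by blast
  \<comment> \<open>Two successive extractions, first for \<open>MT\<close> and then, along
    \<open>r1\<close>, for \<open>MG\<close>.\<close>
  obtain r1 T0 where r1: "strict_mono r1" "T0 \<in> clarke_jac_on S T (R (jpair \<theta> (ys \<theta>)))" "(MT \<circ> r1) \<longlonglongrightarrow> T0"
    by (rule usco_on_convergent_subseq[OF conservative_jac_on_usco[OF T_cons] graph_S(2)[OF \<theta>s] J(1) graph_S(2)[OF *(2)] graph_tendsto(2)[OF \<theta>s *(2,3)]])
  have "(\<theta>s \<circ> r1) \<longlonglongrightarrow> \<theta>" using *(3) r1(1) by (rule LIMSEQ_subseq_LIMSEQ)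
  then have lim1: "(\<lambda>n. jpair (\<theta>s (r1 n)) (ys (\<theta>s (r1 n)))) \<longlonglongrightarrow> jpair \<theta> (ys \<theta>)"
    using graph_tendsto(1)[of "\<theta>s \<circ> r1"] \<theta>s *(2) by simp
  obtain r2 G0 where r2: "strict_mono r2" "G0 \<in> clarke_jac_on S G (jpair \<theta> (ys \<theta>))" "((\<lambda>n. MG (r1 n)) \<circ> r2) \<longlonglongrightarrow> G0"
    by (rule usco_on_convergent_subseq[OF conservative_jac_on_usco[OF G_cons] graph_S(1)[OF \<theta>s] J(2) graph_S(1)[OF *(2)] lim1])
  have lT: "(\<lambda>n. MT (r1 (r2 n))) \<longlonglongrightarrow> T0" using LIMSEQ_subseq_LIMSEQ[OF r1(3) r2(1)] by (simp add: o_def)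
  have lG: "(\<lambda>n. MG (r1 (r2 n))) \<longlonglongrightarrow> G0" using r2(3) by (simp add: o_def)
  have lM: "(\<lambda>n. Ms (r1 (r2 n))) \<longlonglongrightarrow> M"
    using LIMSEQ_subseq_LIMSEQ[OF LIMSEQ_subseq_LIMSEQ[OF *(4) r1(1)] r2(1)] by (simp add: o_def)
  have "M *v x = linearized_step \<gamma> T0 G0 x (M *v x)" for x
  proof -
    note [tendsto_intros] = bounded_bilinear.tendsto[OF bounded_bilinear_matrix_vector_mult]
    have jp: "(\<lambda>n. jpair x (v n)) \<longlonglongrightarrow> jpair x l" if "v \<longlonglongrightarrow> l" for v and l :: "real^'m"
      using tendsto_add[OF tendsto_const[of "jpair x 0"] bounded_linear.tendsto[OF bounded_linear_jpair2 that]]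
      by (simp add: jpair_arith)
    have "(\<lambda>n. linearized_step \<gamma> (MT (r1 (r2 n))) (MG (r1 (r2 n))) x (Ms (r1 (r2 n)) *v x)) \<longlonglongrightarrow> linearized_step \<gamma> T0 G0 x (M *v x)"
      unfolding linearized_step_def by (intro tendsto_intros jp lT lG lM)
    moreover have "(\<lambda>n. Ms (r1 (r2 n)) *v x) \<longlonglongrightarrow> M *v x" by (intro tendsto_intros lM)
    ultimately show ?thesis by (subst (asm) J(3)[symmetric]) (rule LIMSEQ_unique)
  qed
  then show "M \<in> Jys \<theta>" unfolding Jys_def using r1(2) r2(2) by blast
qed

text \<open>Conservativity of \<open>G\<close> is used on the lifted curve \<open>z\<close> in the
  graph of \<open>ys\<close>, that of \<open>T\<close> on its image under the forward step. Each use
  also supplies the almost everywhere derivative of its own curve.\<close>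

private lemma Jys_curve:
  assumes c: "abs_cont_curve c" "c ` {0..1} \<subseteq> \<Theta>"
  shows "AE t in lebesgue. t \<in> {0..1} \<longrightarrow>
           (\<exists>dc dF. (c has_vector_derivative dc) (at t within {0..1}) \<and>
                    ((ys \<circ> c) has_vector_derivative dF) (at t within {0..1}) \<and>
                    (\<forall>M\<in>Jys (c t). dF = M *v dc))"
proof -
  define z where "z = (\<lambda>\<theta>. jpair \<theta> (ys \<theta>)) \<circ> c"
  have z: "abs_cont_curve z" unfolding z_def by (rule abs_cont_curve_compose[OF c graph_lip])
  have zS: "z ` {0..1} \<subseteq> S" using c(2) graph_S(1) by (auto simp: z_def)
  have Rz: "abs_cont_curve (R \<circ> z)" by (rule abs_cont_curve_compose[OF z zS R_lip])
  have RzS: "(R \<circ> z) ` {0..1} \<subseteq> S" using zS R_S by (auto simp: image_subset_iff)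
  show ?thesis
    using conservative_jac_onD(4)[OF G_cons z zS] conservative_jac_onD(4)[OF T_cons Rz RzS]
  proof (eventually_elim, intro impI)
    fix t :: real
    assume t: "t \<in> {0..1}"
      and "t \<in> {0..1} \<longrightarrow> (\<exists>dc dF. (z has_vector_derivative dc) (at t within {0..1}) \<and>
                    ((G \<circ> z) has_vector_derivative dF) (at t within {0..1}) \<and>
                    (\<forall>M\<in>clarke_jac_on S G (z t). dF = M *v dc))"
      and "t \<in> {0..1} \<longrightarrow> (\<exists>dc dF. ((R \<circ> z) has_vector_derivative dc) (at t within {0..1}) \<and>
                    ((T \<circ> (R \<circ> z)) has_vector_derivative dF) (at t within {0..1}) \<and>
                    (\<forall>M\<in>clarke_jac_on S T ((R \<circ> z) t). dF = M *v dc))"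
    then obtain dz dG dR dT where d: "(z has_vector_derivative dz) (at t within {0..1})"
      "((G \<circ> z) has_vector_derivative dG) (at t within {0..1})"
      "((R \<circ> z) has_vector_derivative dR) (at t within {0..1})"
      "((T \<circ> (R \<circ> z)) has_vector_derivative dT) (at t within {0..1})"
      and dG: "\<And>M. M \<in> clarke_jac_on S G (z t) \<Longrightarrow> dG = M *v dz"
      and dT: "\<And>M. M \<in> clarke_jac_on S T ((R \<circ> z) t) \<Longrightarrow> dT = M *v dR" by blast
    have ct: "c t \<in> \<Theta>" using c(2) t by blast
    \<comment> \<open>Both the given curve and \<open>ys \<circ> c\<close> are linear images of
      \<open>z\<close>.\<close>
    have dc: "(c has_vector_derivative jfst dz) (at t within {0..1})"
      using bounded_linear.has_vector_derivative[OF bounded_linear_jfst d(1)] by (simp add: z_def)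
    have dy: "((ys \<circ> c) has_vector_derivative jsnd dz) (at t within {0..1})"
      using bounded_linear.has_vector_derivative[OF bounded_linear_jsnd d(1)] by (simp add: z_def o_def)
    \<comment> \<open>Conservativity of \<open>T\<close> names \<open>dR\<close> without describing
      it; differentiating the formula for \<open>R\<close> identifies it.\<close>
    have "((\<lambda>s. z s - \<gamma> *\<^sub>R jpair 0 (G (z s))) has_vector_derivative dz - \<gamma> *\<^sub>R jpair 0 dG) (at t within {0..1})"
      using bounded_linear.has_vector_derivative[OF bounded_linear_jpair2 d(2)]
      by (intro derivative_intros d(1) bounded_linear.has_vector_derivative[OF bounded_linear_scaleR_right]) (simp add: o_def)
    then have "((R \<circ> z) has_vector_derivative dz - \<gamma> *\<^sub>R jpair 0 dG) (at t within {0..1})"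
      by (simp add: R_eq o_def)
    then have "dR = dz - \<gamma> *\<^sub>R jpair 0 dG" by (rule vector_derivative_within_01_unique[OF t d(3)])
    also have "\<dots> = jpair (jfst dz) (jsnd dz) - \<gamma> *\<^sub>R jpair 0 dG" by simp
    also have "\<dots> = jpair (jfst dz) (jsnd dz - \<gamma> *\<^sub>R dG)" unfolding jpair_arith by simp
    finally have dR: "dR = jpair (jfst dz) (jsnd dz - \<gamma> *\<^sub>R dG)" .
    \<comment> \<open>By the fixed-point equation \<open>T \<circ> R \<circ> z\<close> and
      \<open>ys \<circ> c\<close> coincide on the interval, so the two derivatives do too.\<close>
    have "((ys \<circ> c) has_vector_derivative dT) (at t within {0..1})"
    proof (rule has_vector_derivative_transform_within[OF d(4) zero_less_one t])
      show "(T \<circ> (R \<circ> z)) s = (ys \<circ> c) s" if "s \<in> {0..1}" for s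
      proof -
        have "c s \<in> \<Theta>" using c(2) that by blast
        then show ?thesis using fixed'[of "c s"] by (simp add: z_def)
      qed
    qed
    then have dT': "jsnd dz = dT" by (rule vector_derivative_within_01_unique[OF t dy])
    have "jsnd dz = M *v jfst dz" if M: "M \<in> Jys (c t)" for M
    proof -
      obtain MT MG where J: "MT \<in> clarke_jac_on S T (R (jpair (c t) (ys (c t))))" "MG \<in> clarke_jac_on S G (jpair (c t) (ys (c t)))"
        and eq: "\<And>x. M *v x = linearized_step \<gamma> MT MG x (M *v x)"
        using M unfolding Jys_def by blast
      \<comment> \<open>The same equation is satisfied by \<open>M *v jfst dz\<close>, and its
        solution is unique.\<close>
      have "jsnd dz = linearized_step \<gamma> MT MG (jfst dz) (jsnd dz)"
        using dT[of MT] dG[of MG] J unfolding linearized_step_def by (simp add: z_def dT'[symmetric] dR)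
      then show ?thesis
        by (rule linearized_step_unique[OF clarke_T_bound[OF J(1) graph_S(2)[OF ct]]
              clarke_G_bound[OF J(2) graph_S(1)[OF ct]] q _ eq])
    qed
    then show "\<exists>dc dF. (c has_vector_derivative dc) (at t within {0..1}) \<and>
                    ((ys \<circ> c) has_vector_derivative dF) (at t within {0..1}) \<and>
                    (\<forall>M\<in>Jys (c t). dF = M *v dc)" using dc dy by blast
  qed
qed

private lemma Jys_nonempty:
  assumes "\<theta> \<in> \<Theta>"
  shows "Jys \<theta> \<noteq> {}"
proof -
  have "clarke_jac_on S T (R (jpair \<theta> (ys \<theta>))) \<noteq> {}" "clarke_jac_on S G (jpair \<theta> (ys \<theta>)) \<noteq> {}"
    using conservative_jac_onD(1)[OF T_cons] conservative_jac_onD(1)[OF G_cons] graph_S[OF assms] by auto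
  then show ?thesis unfolding Jys_eq[OF assms, symmetric] by blast
qed

theorem fixed_point_conservative_jac:
  "conservative_jac_on \<Theta> ys
     (\<lambda>\<theta>. {matrix_inv (mat 1 - blk2 MT ** (mat 1 - \<gamma> *\<^sub>R blk2 MG))
                ** (blk1 MT - \<gamma> *\<^sub>R (blk2 MT ** blk1 MG)) | MT MG.
              MT \<in> clarke_jac_on {z. jfst z \<in> \<Theta>} T (jpair \<theta> (ys \<theta> - \<gamma> *\<^sub>R G (jpair \<theta> (ys \<theta>)))) \<and>
              MG \<in> clarke_jac_on {z. jfst z \<in> \<Theta>} G (jpair \<theta> (ys \<theta>))})"
proof -
  have "conservative_jac_on \<Theta> ys Jys"
    unfolding conservative_jac_on_iff_usco
  proof (intro conjI ballI allI impI)
    fix c :: "real \<Rightarrow> real^'p" assume "abs_cont_curve c \<and> c ` {0..1} \<subseteq> \<Theta>"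
    then show "AE t in lebesgue. t \<in> {0..1} \<longrightarrow>
           (\<exists>dc dF. (c has_vector_derivative dc) (at t within {0..1}) \<and>
                    ((ys \<circ> c) has_vector_derivative dF) (at t within {0..1}) \<and>
                    (\<forall>M\<in>Jys (c t). dF = M *v dc))"
      using Jys_curve by simp
  qed (simp_all add: Jys_nonempty usco_Jys)
  then show ?thesis
    by (rule conservative_jac_on_cong[THEN iffD1, rotated]) (simp add: Jys_eq[symmetric] S_def R_def)
qed

end

section \<open>Convex conjugates and proximal maps\<close>

lemma gderiv_unique:
  assumes "GDERIV f x :> D" "GDERIV f x :> D'"
  shows "D = D'"
proof -
  have "(\<lambda>h. inner h D) = (\<lambda>h. inner h D')"
    using assms unfolding gderiv_def by (rule has_derivative_unique)
  then have "inner (D - D') D = inner (D - D') D'" by metis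
  then have "inner (D - D') (D - D') = 0" by (simp add: inner_diff_right)
  then show ?thesis by simp
qed

lemma gradient_eqI: "GDERIV f x :> D \<Longrightarrow> gradient f x = D"
  unfolding gradient_def using gderiv_unique by blast

lemma differentiable_imp_gderiv_gradient:
  fixes f :: "'a::euclidean_space \<Rightarrow> real"
  assumes "f differentiable (at x)"
  shows "GDERIV f x :> gradient f x"
proof -
  obtain f' where f': "(f has_derivative f') (at x)" using assms unfolding differentiable_def by blast
  then have lin: "linear f'" by (rule has_derivative_linear)
  have "f' h = inner h (adjoint f' 1)" for h
    using adjoint_works[OF lin, of h 1] by simp
  then have "f' = (\<lambda>h. inner h (adjoint f' 1))" by (rule ext)
  with f' have "GDERIV f x :> adjoint f' 1" unfolding gderiv_def by metis
  then show ?thesis using gradient_eqI by metis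
qed

lemma gderiv_along_line:
  assumes "GDERIV f (u + s *\<^sub>R w) :> d"
  shows "((\<lambda>s. f (u + s *\<^sub>R w)) has_field_derivative inner d w) (at s)"
proof -
  have "((\<lambda>s. u + s *\<^sub>R w) has_derivative (\<lambda>h. h *\<^sub>R w)) (at s)"
    by (auto intro!: derivative_eq_intros)
  from has_derivative_compose[OF this, of f "\<lambda>h. inner h d"]
  have "((\<lambda>s. f (u + s *\<^sub>R w)) has_derivative (\<lambda>h. inner (h *\<^sub>R w) d)) (at s)"
    using assms unfolding gderiv_def by simp
  then show ?thesis unfolding has_field_derivative_def
    by (rule has_derivative_eq_rhs) (auto simp: inner_commute mult.commute)
qed

lemma gderiv_directional_limit:
  assumes "GDERIV f u :> d"
  shows "((\<lambda>s. (f (u + s *\<^sub>R w) - f u) / s) \<longlongrightarrow> inner d w) (at_right 0)"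
proof -
  have "((\<lambda>s. f (u + s *\<^sub>R w)) has_field_derivative inner d w) (at 0)"
    using assms by (intro gderiv_along_line) simp
  then have "((\<lambda>s. (f (u + s *\<^sub>R w) - f u) / s) \<longlongrightarrow> inner d w) (at 0)"
    by (simp add: DERIV_def)
  then show ?thesis by (rule tendsto_within_subset) auto
qed

lemma gderiv_if_quadratic_remainder:
  fixes F :: "'a::real_inner \<Rightarrow> real"
  assumes "\<And>x'. \<bar>F x' - F x - inner d (x' - x)\<bar> \<le> C * (norm (x' - x))\<^sup>2"
  shows "GDERIV F x :> d"
  unfolding gderiv_def has_derivative_at_alt
proof (intro conjI allI impI)
  show "bounded_linear (\<lambda>h. inner h d)" by (rule bounded_linear_inner_left)
  fix e :: real assume e: "e > 0"
  have "norm (F y - F x - inner (y - x) d) \<le> e * norm (y - x)" if "norm (y - x) < e / (\<bar>C\<bar> + 1)" for y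
  proof -
    have "\<bar>F y - F x - inner d (y - x)\<bar> \<le> (\<bar>C\<bar> + 1) * (norm (y - x))\<^sup>2"
      by (rule order_trans[OF assms mult_right_mono]) auto
    also have "\<dots> = ((\<bar>C\<bar> + 1) * norm (y - x)) * norm (y - x)" by (simp add: power2_eq_square)
    also have "\<dots> \<le> e * norm (y - x)"
      using that by (intro mult_right_mono) (auto simp: pos_less_divide_eq mult.commute less_imp_le)
    finally show ?thesis by (simp add: inner_commute)
  qed
  then show "\<exists>\<delta>>0. \<forall>y. norm (y - x) < \<delta> \<longrightarrow> norm (F y - F x - inner (y - x) d) \<le> e * norm (y - x)"
    using e by (intro exI[of _ "e / (\<bar>C\<bar> + 1)"]) (auto simp: add_nonneg_pos)
qed

text \<open>Convexity of \<open>f\<close> minus the quadratic on the segment bounds the difference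
  quotient, with gain \<open>\<mu> / 2 * (1 - s) * (norm w)\<^sup>2\<close>; then \<open>s\<close>
  tends to 0 from the right.\<close>

lemma strongly_convex_first_order:
  assumes sc: "strongly_convex_on \<mu> UNIV f" and d: "GDERIV f u :> d"
  shows "f u + inner d (v - u) + \<mu> / 2 * (norm (v - u))\<^sup>2 \<le> f v"
proof -
  define w where "w = v - u"
  have "(f (u + s *\<^sub>R w) - f u) / s \<le> f v - f u - \<mu> / 2 * (1 - s) * (norm w)\<^sup>2"
    if s: "0 < s" "s < 1" for s
  proof -
    define z where "z = u + s *\<^sub>R w"
    have z: "z = (1 - s) *\<^sub>R u + s *\<^sub>R v" by (simp add: z_def w_def algebra_simps)
    have 1: "f z - \<mu> / 2 * (norm z)\<^sup>2 \<le>
        (1 - s) * (f u - \<mu> / 2 * (norm u)\<^sup>2) + s * (f v - \<mu> / 2 * (norm v)\<^sup>2)"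
      using sc s unfolding strongly_convex_on_def convex_on_def z by simp
    have 2: "(norm z)\<^sup>2 = (1 - s) * (norm u)\<^sup>2 + s * (norm v)\<^sup>2 - s * (1 - s) * (norm w)\<^sup>2"
      unfolding w_def z power2_norm_eq_inner
      by (simp add: inner_add inner_diff inner_commute algebra_simps)
    have "f z - f u \<le> s * (f v - f u - \<mu> / 2 * (1 - s) * (norm w)\<^sup>2)"
      using 1 unfolding 2 by (simp add: field_simps)
    then have "f (u + s *\<^sub>R w) - f u \<le> s * (f v - f u - \<mu> / 2 * (1 - s) * (norm w)\<^sup>2)"
      by (simp add: z_def)
    then show ?thesis using s by (simp add: pos_divide_le_eq mult.commute)
  qed
  then have "\<forall>\<^sub>F s in at_right 0. (f (u + s *\<^sub>R w) - f u) / s \<le> f v - f u - \<mu> / 2 * (1 - s) * (norm w)\<^sup>2"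
    unfolding eventually_at_right_field by (intro exI[of _ 1]) auto
  moreover have "((\<lambda>s. f v - f u - \<mu> / 2 * (1 - s) * (norm w)\<^sup>2) \<longlongrightarrow> f v - f u - \<mu> / 2 * (1 - 0) * (norm w)\<^sup>2) (at_right 0)"
    by (intro tendsto_intros)
  ultimately have "inner d w \<le> f v - f u - \<mu> / 2 * (1 - 0) * (norm w)\<^sup>2"
    by (intro tendsto_le[OF _ _ gderiv_directional_limit[OF d]]) auto
  then show ?thesis by (simp add: w_def)
qed

lemma strongly_convex_if_first_order:
  assumes "\<And>u v. f u + inner (D u) (v - u) + \<mu> / 2 * (norm (v - u))\<^sup>2 \<le> f v"
  shows "strongly_convex_on \<mu> UNIV f"
  unfolding strongly_convex_on_def convex_on_def
proof (intro conjI ballI allI impI)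
  fix x y :: 'a and s t :: real assume st: "0 \<le> s" "0 \<le> t" "s + t = 1"
  define k where "k x = f x - \<mu> / 2 * (norm x)\<^sup>2" for x
  define z where "z = s *\<^sub>R x + t *\<^sub>R y"
  \<comment> \<open>The slope of \<open>k\<close> at \<open>z\<close>: the hypothesis says exactly
    that \<open>k\<close> lies above its affine support there, and averaging the supports at
    \<open>x\<close> and \<open>y\<close> cancels the slope.\<close>
  define p where "p = D z - \<mu> *\<^sub>R z"
  have k: "k z + inner p (v - z) \<le> k v" for v
    using assms[of z v] unfolding k_def p_def power2_norm_eq_inner
    by (simp add: inner_diff inner_commute algebra_simps)
  have "s * (k z + inner p (x - z)) + t * (k z + inner p (y - z)) \<le> s * k x + t * k y"
    using st by (intro add_mono mult_left_mono k)
  moreover have "s * (k z + inner p (x - z)) + t * (k z + inner p (y - z)) =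
      (s + t) * k z + inner p ((s *\<^sub>R x + t *\<^sub>R y) - (s + t) *\<^sub>R z)"
    by (simp add: algebra_simps inner_diff_right inner_add_right)
  ultimately show "f (s *\<^sub>R x + t *\<^sub>R y) - \<mu> / 2 * (norm (s *\<^sub>R x + t *\<^sub>R y))\<^sup>2
      \<le> s * (f x - \<mu> / 2 * (norm x)\<^sup>2) + t * (f y - \<mu> / 2 * (norm y)\<^sup>2)"
    using st by (simp add: z_def k_def)
qed simp

text \<open>The gap between \<open>f\<close> and the quadratic model along the segment has
  nonpositive derivative in \<open>t\<close>, by Cauchy-Schwarz and the Lipschitz bound.\<close>

lemma descent_lemma:
  assumes D: "\<And>x. GDERIV f x :> D x" and lip: "\<beta>-lipschitz_on UNIV D"
  shows "f v \<le> f u + inner (D u) (v - u) + \<beta> / 2 * (norm (v - u))\<^sup>2"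
proof -
  define w where "w = v - u"
  define k where "k t = f (u + t *\<^sub>R w) - t * inner (D u) w - \<beta> / 2 * t\<^sup>2 * (norm w)\<^sup>2" for t
  have "k 1 \<le> k 0"
  proof (rule DERIV_nonpos_imp_nonincreasing[of 0 1 k])
    fix t :: real assume t: "0 \<le> t" "t \<le> 1"
    have "(k has_field_derivative (inner (D (u + t *\<^sub>R w)) w - inner (D u) w - \<beta> * t * (norm w)\<^sup>2)) (at t)"
      unfolding k_def by (auto intro!: derivative_eq_intros gderiv_along_line D)
    moreover have "inner (D (u + t *\<^sub>R w)) w - inner (D u) w - \<beta> * t * (norm w)\<^sup>2 \<le> 0"
    proof -
      have "inner (D (u + t *\<^sub>R w) - D u) w \<le> norm (D (u + t *\<^sub>R w) - D u) * norm w" by (rule norm_cauchy_schwarz)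
      also have "\<dots> \<le> (\<beta> * (t * norm w)) * norm w"
        using lipschitz_onD[OF lip, of "u + t *\<^sub>R w" u] t by (intro mult_right_mono) (auto simp: dist_norm)
      finally show ?thesis by (simp add: inner_diff_left power2_eq_square algebra_simps)
    qed
    ultimately show "\<exists>y. (k has_real_derivative y) (at t) \<and> y \<le> 0" by blast
  qed simp
  then show ?thesis by (simp add: k_def w_def)
qed

section \<open>Closed convex proper functions\<close>

lemma closed_convex_proper_finite_point:
  assumes "closed_convex_proper h"
  obtains x r where "h x = ereal r"
  using assms unfolding closed_convex_proper_def by (metis ereal_cases)

lemma closed_convex_proper_cases:
  assumes "closed_convex_proper h"
  obtains "h x = \<infinity>" | r where "h x = ereal r"
  using assms unfolding closed_convex_proper_def by (metis ereal_cases)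

text \<open>A hyperplane separates the epigraph from a point one unit below its graph. It cannot be
  vertical, because a point of the epigraph lies straight above, so it is the graph of an affine
  function.\<close>

lemma closed_convex_proper_affine_minorant:
  fixes h :: "'a::euclidean_space \<Rightarrow> ereal"
  assumes h: "closed_convex_proper h"
  shows "\<exists>v c. \<forall>u. ereal (inner v u + c) \<le> h u"
proof -
  obtain x0 r0 where x0: "h x0 = ereal r0" by (rule closed_convex_proper_finite_point[OF h])
  have "(x0, r0 - 1) \<notin> epi h" by (simp add: epi_def x0)
  then obtain p b where "inner p (x0, r0 - 1) < b" "\<And>z. z \<in> epi h \<Longrightarrow> inner p z > b"
    using separating_hyperplane_closed_point[of "epi h" "(x0, r0 - 1)"] h
    unfolding closed_convex_proper_def by blast
  then obtain n s where ns: "inner n x0 + s * (r0 - 1) < b" "\<And>x t. (x, t) \<in> epi h \<Longrightarrow> inner n x + s * t > b"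
    by (cases p) fastforce
  have "inner n x0 + s * r0 > b" using ns(2)[of x0 r0] by (simp add: epi_def x0)
  then have s: "s > 0" using ns(1) by (simp add: algebra_simps)
  have "ereal (inner (- (1/s) *\<^sub>R n) u + b / s) \<le> h u" for u
  proof (rule closed_convex_proper_cases[OF h, of u])
    fix r assume r: "h u = ereal r"
    then have "inner n u + s * r > b" using ns(2)[of u r] by (simp add: epi_def)
    then show ?thesis using s r by (simp add: field_simps)
  qed simp
  then show ?thesis by blast
qed

lemma closed_convex_proper_scale:
  fixes h :: "'a::euclidean_space \<Rightarrow> ereal"
  assumes h: "closed_convex_proper h" and \<gamma>: "0 < \<gamma>"
  shows "closed_convex_proper (\<lambda>u. ereal \<gamma> * h u)"
proof -
  let ?A = "\<lambda>z :: 'a \<times> real. (fst z, snd z / \<gamma>)"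
  have fin: "ereal \<gamma> * h u \<le> ereal t \<longleftrightarrow> h u \<le> ereal (t / \<gamma>)" for u t
    by (rule closed_convex_proper_cases[OF h, of u]) (use \<gamma> in \<open>auto simp: field_simps\<close>)
  have epi: "epi (\<lambda>u. ereal \<gamma> * h u) = ?A -` epi h"
    by (auto simp: epi_def fin)
  have lin: "linear ?A" by (rule linearI) (auto simp: add_divide_distrib)
  have "closed (?A -` epi h)"
    using h linear_continuous_on[OF linear_conv_bounded_linear[THEN iffD1, OF lin], of UNIV]
    unfolding closed_convex_proper_def by (auto intro: continuous_closed_vimage simp: linear_continuous_at linear_conv_bounded_linear[THEN iffD1, OF lin])
  moreover have "convex (?A -` epi h)"
    using h lin unfolding closed_convex_proper_def by (auto intro: convex_linear_vimage)
  moreover have "ereal \<gamma> * h u \<noteq> - \<infinity>" for u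
    by (rule closed_convex_proper_cases[OF h, of u]) (use \<gamma> in auto)
  moreover have "\<exists>u. ereal \<gamma> * h u \<noteq> \<infinity>"
    using closed_convex_proper_finite_point[OF h] by (metis PInfty_neq_ereal(1) times_ereal.simps(1))
  ultimately show ?thesis unfolding closed_convex_proper_def epi by blast
qed

text \<open>The epigraph of the conjugate is an intersection of half-spaces indexed by
  \<open>epi g\<close>. The slope of an affine minorant of \<open>g\<close> is a point where the
  conjugate is finite.\<close>

lemma closed_convex_proper_conjugate:
  fixes g :: "'a::euclidean_space \<Rightarrow> ereal"
  assumes g: "closed_convex_proper g"
  shows "closed_convex_proper (conjugate g)"
proof -
  obtain x0 r0 where x0: "g x0 = ereal r0" by (rule closed_convex_proper_finite_point[OF g])
  obtain v c where vc: "\<And>u. ereal (inner v u + c) \<le> g u" using closed_convex_proper_affine_minorant[OF g] by blast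
  have le: "conjugate g y \<le> ereal t \<longleftrightarrow> (\<forall>z\<in>epi g. inner y (fst z) - snd z \<le> t)" for y t
  proof
    assume L: "conjugate g y \<le> ereal t"
    show "\<forall>z\<in>epi g. inner y (fst z) - snd z \<le> t"
    proof
      fix z assume z: "z \<in> epi g"
      have "ereal (inner y (fst z)) - g (fst z) \<le> ereal t" using L unfolding conjugate_def SUP_le_iff by blast
      then show "inner y (fst z) - snd z \<le> t"
        using z by (cases rule: closed_convex_proper_cases[OF g, of "fst z"]) (auto simp: epi_def)
    qed
  next
    assume R: "\<forall>z\<in>epi g. inner y (fst z) - snd z \<le> t"
    show "conjugate g y \<le> ereal t" unfolding conjugate_def
    proof (rule SUP_least)
      fix u show "ereal (inner y u) - g u \<le> ereal t"
      proof (rule closed_convex_proper_cases[OF g, of u])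
        fix r assume "g u = ereal r"
        then show ?thesis using R[rule_format, of "(u, r)"] by (simp add: epi_def)
      qed simp
    qed
  qed
  have epi: "epi (conjugate g) = (\<Inter>z\<in>epi g. {w. inner (fst z, - 1) w \<le> snd z})"
  proof (rule set_eqI)
    fix w show "w \<in> epi (conjugate g) \<longleftrightarrow> w \<in> (\<Inter>z\<in>epi g. {w. inner (fst z, - 1) w \<le> snd z})"
      by (cases w) (simp add: epi_def[of "conjugate g"] le inner_commute algebra_simps)
  qed
  have "closed (epi (conjugate g))" "convex (epi (conjugate g))" unfolding epi
    by (auto intro!: closed_halfspace_le convex_halfspace_le convex_INT)
  moreover have "conjugate g y \<noteq> - \<infinity>" for y
  proof -
    have "ereal (inner y x0) - g x0 \<le> conjugate g y" unfolding conjugate_def by (rule SUP_upper) simp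
    then show ?thesis by (auto simp: x0)
  qed
  moreover have "conjugate g v \<le> ereal (- c)" unfolding le
  proof
    fix z assume "z \<in> epi g"
    then have "g (fst z) \<le> ereal (snd z)" by (auto simp: epi_def)
    with vc[of "fst z"] have "ereal (inner v (fst z) + c) \<le> ereal (snd z)" by (rule order_trans)
    then show "inner v (fst z) - snd z \<le> - c" by simp
  qed
  then have "conjugate g v \<noteq> \<infinity>" by auto
  ultimately show ?thesis unfolding closed_convex_proper_def by blast
qed

lemma closed_convex_proper_zero: "closed_convex_proper (\<lambda>_::'a::euclidean_space. 0)"
proof -
  have "epi (\<lambda>_::'a. 0) = {w. 0 \<le> inner (0, 1) w}" by (auto simp: epi_def)
  then show ?thesis unfolding closed_convex_proper_def
    using closed_halfspace_ge[where a = "(0::'a, 1::real)" and b = 0]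
      convex_halfspace_ge[where a = "(0::'a, 1::real)" and b = 0] by auto
qed

text \<open>Minimising over the epigraph replaces the extended-valued \<open>h\<close> by the
  continuous coordinate \<open>snd\<close>. A sublevel set is compact since the quadratic growth of
  \<psi> dominates the affine minorant of \<open>h\<close>.\<close>

lemma exists_minimizer_closed_convex_plus_strongly_convex:
  fixes h :: "'a::euclidean_space \<Rightarrow> ereal"
  assumes h: "closed_convex_proper h" and \<mu>: "\<mu> > 0" and cont: "continuous_on UNIV \<psi>"
    and lower: "\<And>v. \<psi> u0 + inner d (v - u0) + \<mu> / 2 * (norm (v - u0))\<^sup>2 \<le> \<psi> v"
  obtains y where "\<And>y'. h y + ereal (\<psi> y) \<le> h y' + ereal (\<psi> y')"
proof -
  obtain x1 r1 where x1: "h x1 = ereal r1" by (rule closed_convex_proper_finite_point[OF h])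
  obtain p c where pc: "\<And>u. ereal (inner p u + c) \<le> h u" using closed_convex_proper_affine_minorant[OF h] by blast
  define \<rho> where "\<rho> = r1 + \<psi> x1"
  define C where "C = {z \<in> epi h. snd z + \<psi> (fst z) \<le> \<rho>}"
  have ne: "(x1, r1) \<in> C" by (simp add: C_def epi_def x1 \<rho>_def)
  have cont2: "continuous_on A (\<lambda>z :: 'a \<times> real. snd z + \<psi> (fst z))" for A
    by (intro continuous_intros continuous_on_compose2[OF cont]) auto
  have "closed {z :: 'a \<times> real. snd z + \<psi> (fst z) \<le> \<rho>}"
    by (intro closed_Collect_le continuous_on_const cont2)
  then have closedC: "closed C" using h unfolding C_def closed_convex_proper_def Collect_conj_eq
    by (auto simp: Collect_mem_eq)
  define A where "A = \<bar>\<rho> - c - \<psi> u0 - inner p u0\<bar>"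
  define B where "B = norm p + norm d"
  \<comment> \<open>On \<open>C\<close> the distance \<open>r\<close> from \<open>u0\<close>
    satisfies \<open>\<mu> / 2 * r\<^sup>2 \<le> A + B * r\<close>, hence \<open>r \<le> 1\<close>
    or \<open>r \<le> 2 * (A + B) / \<mu>\<close>.\<close>
  define R where "R = 1 + 2 * (A + B) / \<mu>"
  have AB: "0 \<le> A" "0 \<le> B" by (auto simp: A_def B_def)
  have R: "R \<ge> 1" using AB \<mu> by (simp add: R_def)
  have bounds: "u \<in> cball u0 R \<and> t \<in> {c - norm p * (norm u0 + R)..\<rho> - \<psi> u0 + norm d * R}"
    if "(u, t) \<in> C" for u t
  proof -
    have t: "h u \<le> ereal t" "t + \<psi> u \<le> \<rho>" using that by (auto simp: C_def epi_def)
    have "ereal (inner p u + c) \<le> ereal t" using pc[of u] t(1) by (rule order_trans)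
    then have pt: "inner p u + c \<le> t" by simp
    define w where "w = u - u0"
    have "inner p u = inner p u0 + inner p w" by (simp add: w_def inner_diff_right)
    then have "\<mu> / 2 * (norm w)\<^sup>2 \<le> (\<rho> - c - \<psi> u0 - inner p u0) - inner p w - inner d w"
      using lower[of u] t(2) pt by (simp add: w_def)
    also have "\<dots> \<le> A + B * norm w"
      using norm_cauchy_schwarz[of p "- w"] norm_cauchy_schwarz[of d "- w"]
      by (simp add: A_def B_def algebra_simps)
    finally have q: "\<mu> / 2 * (norm w)\<^sup>2 \<le> A + B * norm w" .
    have "norm w \<le> R"
    proof (cases "norm w \<le> 1")
      case False
      then have "A + B * norm w \<le> (A + B) * norm w" using AB mult_left_mono[of 1 "norm w" A] by (simp add: algebra_simps)
      with q have "(\<mu> / 2 * norm w) * norm w \<le> (A + B) * norm w" by (simp add: power2_eq_square)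
      then have "\<mu> / 2 * norm w \<le> A + B" by (rule mult_right_le_imp_le) (use False in linarith)
      then have "norm w \<le> 2 * (A + B) / \<mu>" using \<mu> by (simp add: field_simps)
      then show ?thesis by (simp add: R_def)
    qed (use R in linarith)
    then have wR: "norm (u - u0) \<le> R" by (simp add: w_def)
    have "norm u \<le> norm u0 + R" using wR norm_triangle_sub[of u u0] by linarith
    then have "norm p * norm u \<le> norm p * (norm u0 + R)" by (intro mult_left_mono) auto
    moreover have "- inner p u \<le> norm p * norm u" using norm_cauchy_schwarz[of p "- u"] by simp
    ultimately have 1: "c - norm p * (norm u0 + R) \<le> t" using pt by linarith
    have "- inner d (u - u0) \<le> norm d * norm (u - u0)" using norm_cauchy_schwarz[of d "- (u - u0)"]
      by (simp only: inner_minus_right norm_minus_cancel)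
    also have "\<dots> \<le> norm d * R" using wR by (intro mult_left_mono) auto
    moreover have "0 \<le> \<mu> / 2 * (norm (u - u0))\<^sup>2" using \<mu> by simp
    ultimately have "t \<le> \<rho> - \<psi> u0 + norm d * R" using lower[of u] t(2) by linarith
    with 1 wR show ?thesis by (simp add: dist_norm norm_minus_commute)
  qed
  have "C \<subseteq> cball u0 R \<times> {c - norm p * (norm u0 + R)..\<rho> - \<psi> u0 + norm d * R}"
    using bounds by auto
  then have "bounded C" by (rule bounded_subset[rotated]) (intro bounded_Times bounded_cball bounded_closed_interval)
  then have "compact C" using closedC by (simp add: compact_eq_bounded_closed)
  then obtain z where z: "z \<in> C" "\<And>z'. z' \<in> C \<Longrightarrow> snd z + \<psi> (fst z) \<le> snd z' + \<psi> (fst z')"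
    using continuous_attains_inf[of C "\<lambda>z. snd z + \<psi> (fst z)"] ne cont2 by blast
  have "h (fst z) + ereal (\<psi> (fst z)) \<le> h y' + ereal (\<psi> y')" for y'
  proof (rule closed_convex_proper_cases[OF h, of y'])
    fix r assume r: "h y' = ereal r"
    have "snd z + \<psi> (fst z) \<le> r + \<psi> y'"
    proof (cases "(y', r) \<in> C")
      case True then show ?thesis using z(2)[OF True] by simp
    next
      case False then show ?thesis using z(1) r by (auto simp: C_def epi_def)
    qed
    moreover have "h (fst z) + ereal (\<psi> (fst z)) \<le> ereal (snd z) + ereal (\<psi> (fst z))"
      using z(1) by (intro add_right_mono) (auto simp: C_def epi_def)
    ultimately show ?thesis using r by (simp add: order_trans)
  qed simp
  then show ?thesis using that by blast
qed

section \<open>Subgradients and proximal maps\<close>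

definition is_subgradient :: "('a::real_inner \<Rightarrow> ereal) \<Rightarrow> 'a \<Rightarrow> 'a \<Rightarrow> bool" where
  "is_subgradient h y p \<longleftrightarrow> h y \<noteq> \<infinity> \<and> (\<forall>u. h y + ereal (inner p (u - y)) \<le> h u)"

lemma is_subgradient_monotone:
  assumes "closed_convex_proper h" "is_subgradient h y p" "is_subgradient h y' p'"
  shows "0 \<le> inner (p - p') (y - y')"
proof -
  obtain r r' where r: "h y = ereal r" "h y' = ereal r'"
    using assms closed_convex_proper_cases[OF assms(1)] unfolding is_subgradient_def by metis
  have "h y + ereal (inner p (y' - y)) \<le> h y'" "h y' + ereal (inner p' (y - y')) \<le> h y"
    using assms unfolding is_subgradient_def by blast+
  then have "r + inner p (y' - y) \<le> r'" "r' + inner p' (y - y') \<le> r" using r by simp_all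
  then show ?thesis by (simp add: inner_diff algebra_simps)
qed

lemma is_subgradient_scale:
  assumes "closed_convex_proper h" "0 < \<gamma>"
  shows "is_subgradient (\<lambda>u. ereal \<gamma> * h u) y (\<gamma> *\<^sub>R p) \<longleftrightarrow> is_subgradient h y p"
proof -
  have "ereal \<gamma> * h y + ereal (inner (\<gamma> *\<^sub>R p) (u - y)) \<le> ereal \<gamma> * h u \<longleftrightarrow> h y + ereal (inner p (u - y)) \<le> h u" for u
  proof -
    have "ereal \<gamma> * h y + ereal (inner (\<gamma> *\<^sub>R p) (u - y)) = ereal \<gamma> * (h y + ereal (inner p (u - y)))"
      by (rule closed_convex_proper_cases[OF assms(1), of y]) (use assms(2) in \<open>auto simp: algebra_simps\<close>)
    then show ?thesis using assms(2) by (simp add: ereal_mult_le_mult_iff)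
  qed
  then show ?thesis unfolding is_subgradient_def using assms(2) by auto
qed

text \<open>Fermat's rule for a sum with one smooth term. A minimiser is compared with points of the
  segment towards \<open>u\<close>, where convexity bounds \<open>h\<close> linearly, and the
  one-sided derivative of \<psi> remains; conversely the two support inequalities add up.\<close>

lemma minimizer_iff_is_subgradient:
  assumes h: "closed_convex_proper h" and d: "GDERIV \<psi> y :> d"
    and lower: "\<And>v. \<psi> y + inner d (v - y) \<le> \<psi> v"
  shows "(\<forall>y'. h y + ereal (\<psi> y) \<le> h y' + ereal (\<psi> y')) \<longleftrightarrow> is_subgradient h y (- d)"
proof
  assume min: "\<forall>y'. h y + ereal (\<psi> y) \<le> h y' + ereal (\<psi> y')"
  obtain x1 r1 where x1: "h x1 = ereal r1" by (rule closed_convex_proper_finite_point[OF h])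
  have fin: "h y \<noteq> \<infinity>" using min[rule_format, of x1] by (auto simp: x1)
  then obtain r where r: "h y = ereal r" using closed_convex_proper_cases[OF h] by metis
  have "h y + ereal (inner (- d) (u - y)) \<le> h u" for u
  proof (rule closed_convex_proper_cases[OF h, of u])
    fix r' assume r': "h u = ereal r'"
    have "r - r' \<le> (\<psi> (y + s *\<^sub>R (u - y)) - \<psi> y) / s" if s: "0 < s" "s < 1" for s
    proof -
      have "(1 - s) *\<^sub>R (y, r) + s *\<^sub>R (u, r') \<in> epi h"
        using h s r r' unfolding closed_convex_proper_def
        by (intro convexD) (auto simp: epi_def)
      moreover have "(1 - s) *\<^sub>R (y, r) + s *\<^sub>R (u, r') = (y + s *\<^sub>R (u - y), r + s * (r' - r))"
        by (simp add: algebra_simps)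
      ultimately have 1: "h (y + s *\<^sub>R (u - y)) \<le> ereal (r + s * (r' - r))" by (simp add: epi_def)
      have "ereal (r + \<psi> y) \<le> h (y + s *\<^sub>R (u - y)) + ereal (\<psi> (y + s *\<^sub>R (u - y)))"
        using min r by simp
      also have "\<dots> \<le> ereal (r + s * (r' - r)) + ereal (\<psi> (y + s *\<^sub>R (u - y)))"
        using 1 by (rule add_right_mono)
      finally have "s * (r - r') \<le> \<psi> (y + s *\<^sub>R (u - y)) - \<psi> y" by (simp add: algebra_simps)
      then show ?thesis using s by (simp add: field_simps)
    qed
    then have "\<forall>\<^sub>F s in at_right 0. r - r' \<le> (\<psi> (y + s *\<^sub>R (u - y)) - \<psi> y) / s"
      unfolding eventually_at_right_field by (intro exI[of _ 1]) auto
    then have "r - r' \<le> inner d (u - y)"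
      by (intro tendsto_lowerbound[OF gderiv_directional_limit[OF d]]) auto
    then show ?thesis using r r' by simp
  qed simp
  then show "is_subgradient h y (- d)" using fin unfolding is_subgradient_def by blast
next
  assume sub: "is_subgradient h y (- d)"
  then obtain r where r: "h y = ereal r" using closed_convex_proper_cases[OF h] unfolding is_subgradient_def by metis
  show "\<forall>y'. h y + ereal (\<psi> y) \<le> h y' + ereal (\<psi> y')"
  proof
    fix y'
    show "h y + ereal (\<psi> y) \<le> h y' + ereal (\<psi> y')"
    proof (rule closed_convex_proper_cases[OF h, of y'])
      fix r' assume r': "h y' = ereal r'"
      have "h y + ereal (inner (- d) (y' - y)) \<le> h y'" using sub unfolding is_subgradient_def by blast
      then show ?thesis using lower[of y'] r r' by simp
    qed simp
  qed
qed

lemma gderiv_half_sqnorm: "GDERIV (\<lambda>u. 1/2 * (norm (x - u))\<^sup>2) u :> (u - x)"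
proof (rule gderiv_if_quadratic_remainder[where C = "1/2"])
  fix x'
  have eq: "1/2 * (norm (x - x'))\<^sup>2 - 1/2 * (norm (x - u))\<^sup>2 - inner (u - x) (x' - u) = 1/2 * (norm (x' - u))\<^sup>2"
    unfolding power2_norm_eq_inner by (simp add: inner_diff inner_commute algebra_simps)
  show "\<bar>1/2 * (norm (x - x'))\<^sup>2 - 1/2 * (norm (x - u))\<^sup>2 - inner (u - x) (x' - u)\<bar> \<le> 1/2 * (norm (x' - u))\<^sup>2"
    unfolding eq by simp
qed

lemma prox_minimizer_iff:
  fixes h :: "'a::euclidean_space \<Rightarrow> ereal"
  assumes h: "closed_convex_proper h"
  shows "(\<forall>y'. h y + ereal (1/2 * (norm (x - y))\<^sup>2) \<le> h y' + ereal (1/2 * (norm (x - y'))\<^sup>2))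
    \<longleftrightarrow> is_subgradient h y (x - y)"
proof -
  have "1/2 * (norm (x - y))\<^sup>2 + inner (y - x) (v - y) \<le> 1/2 * (norm (x - v))\<^sup>2" for v
    using inner_ge_zero[of "v - y"] unfolding power2_norm_eq_inner
    by (simp add: inner_diff inner_commute algebra_simps)
  then show ?thesis using minimizer_iff_is_subgradient[OF h gderiv_half_sqnorm, of x y] by simp
qed

lemma is_subgradient_prox:
  fixes h :: "'a::euclidean_space \<Rightarrow> ereal"
  assumes h: "closed_convex_proper h"
  shows "is_subgradient h (prox h x) (x - prox h x)"
proof -
  let ?\<psi> = "\<lambda>u. 1/2 * (norm (x - u))\<^sup>2"
  have "continuous_on UNIV ?\<psi>" by (intro continuous_intros)
  moreover have "?\<psi> x + inner 0 (v - x) + 1 / 2 * (norm (v - x))\<^sup>2 \<le> ?\<psi> v" for v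
    by (simp add: norm_minus_commute)
  ultimately obtain y where y: "\<And>y'. h y + ereal (?\<psi> y) \<le> h y' + ereal (?\<psi> y')"
    using exists_minimizer_closed_convex_plus_strongly_convex[OF h, of 1 ?\<psi> x 0] by auto
  \<comment> \<open>\<open>arg_min\<close> is a choice, so it is a minimiser as soon as one
    exists.\<close>
  have "is_arg_min (\<lambda>u. h u + ereal (?\<psi> u)) (\<lambda>_. True) (prox h x)"
    unfolding prox_def arg_min_def
    by (rule someI[of _ y]) (use y in \<open>auto simp: is_arg_min_def not_less\<close>)
  then have "\<forall>y'. h (prox h x) + ereal (?\<psi> (prox h x)) \<le> h y' + ereal (?\<psi> y')"
    by (auto simp: is_arg_min_def not_less)
  then show ?thesis unfolding prox_minimizer_iff[OF h] .
qed

lemma prox_eqI: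
  fixes h :: "'a::euclidean_space \<Rightarrow> ereal"
  assumes h: "closed_convex_proper h" and y: "is_subgradient h y (x - y)"
  shows "prox h x = y"
proof -
  have "0 \<le> inner ((x - prox h x) - (x - y)) (prox h x - y)"
    by (rule is_subgradient_monotone[OF h is_subgradient_prox[OF h] y])
  also have "(x - prox h x) - (x - y) = - (prox h x - y)" by simp
  finally have "inner (prox h x - y) (prox h x - y) \<le> 0" by (simp only: inner_minus_left neg_0_le_iff_le)
  then show ?thesis by (metis inner_gt_zero_iff linorder_not_less right_minus_eq)
qed

text \<open>Monotonicity of subgradients gives firm nonexpansiveness,
  \<open>(norm p)\<^sup>2 \<le> inner (x - x') p\<close>; Cauchy-Schwarz finishes.\<close>

lemma prox_nonexpansive:
  fixes h :: "'a::euclidean_space \<Rightarrow> ereal"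
  assumes h: "closed_convex_proper h"
  shows "norm (prox h x - prox h x') \<le> norm (x - x')"
proof -
  define p where "p = prox h x - prox h x'"
  have "0 \<le> inner ((x - prox h x) - (x' - prox h x')) p"
    unfolding p_def by (rule is_subgradient_monotone[OF h is_subgradient_prox[OF h] is_subgradient_prox[OF h]])
  also have "(x - prox h x) - (x' - prox h x') = (x - x') - p" by (simp add: p_def)
  finally have "(norm p)\<^sup>2 \<le> inner (x - x') p" by (simp add: inner_diff_left power2_norm_eq_inner)
  also have "\<dots> \<le> norm (x - x') * norm p" by (rule norm_cauchy_schwarz)
  finally have "norm p * norm p \<le> norm (x - x') * norm p" by (simp add: power2_eq_square)
  then have "norm p \<le> norm (x - x')" by (cases "p = 0") auto
  then show ?thesis by (simp add: p_def)
qed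

section \<open>Conjugates of smooth strongly convex functions\<close>

lemma conjugate_at_subgradient:
  assumes "\<And>v. f u + inner x (v - u) \<le> f v"
  shows "conjugate (\<lambda>u. ereal (f u)) x = ereal (inner x u - f u)"
  unfolding conjugate_def
proof (rule antisym)
  show "(SUP v. ereal (inner x v) - ereal (f v)) \<le> ereal (inner x u - f u)"
  proof (rule SUP_least)
    fix v show "ereal (inner x v) - ereal (f v) \<le> ereal (inner x u - f u)"
      using assms[of v] by (simp add: inner_diff_right)
  qed
  have "ereal (inner x u) - ereal (f u) \<le> (SUP v. ereal (inner x v) - ereal (f v))"
    by (rule SUP_upper) simp
  then show "ereal (inner x u - f u) \<le> (SUP v. ereal (inner x v) - ereal (f v))" by simp
qed

text \<open>The map \<open>U\<close> is a right inverse of the gradient \<open>D\<close>. The upper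
  quadratic model of \<open>f\<close> yields the lower model of the conjugate, strong monotonicity
  of \<open>D\<close> yields the Lipschitz bound on \<open>U\<close>, and together they squeeze the
  remainder that identifies \<open>U\<close> as the gradient.\<close>

lemma conjugate_strongly_convex_smooth:
  fixes f :: "'a::euclidean_space \<Rightarrow> real"
  assumes \<alpha>: "0 < \<alpha>" and \<beta>: "0 < \<beta>" and D: "\<And>x. GDERIV f x :> D x"
    and lower: "\<And>u v. f u + inner (D u) (v - u) + \<alpha> / 2 * (norm (v - u))\<^sup>2 \<le> f v"
    and upper: "\<And>u v. f v \<le> f u + inner (D u) (v - u) + \<beta> / 2 * (norm (v - u))\<^sup>2"
  obtains fs U where "\<And>x. conjugate (\<lambda>u. ereal (f u)) x = ereal (fs x)" "\<And>x. GDERIV fs x :> U x"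
    "\<And>x x'. fs x + inner (U x) (x' - x) + 1 / (2 * \<beta>) * (norm (x' - x))\<^sup>2 \<le> fs x'"
    "\<And>x x'. norm (U x - U x') \<le> norm (x - x') / \<alpha>"
proof -
  have cont: "continuous_on UNIV f"
    using D unfolding gderiv_def by (meson continuous_at_imp_continuous_on has_derivative_continuous)
  \<comment> \<open>Minimise \<open>f u - inner x u\<close>; the zero function plays the nonsmooth
    part in the existence and optimality lemmas.\<close>
  have "\<exists>u. D u = x" for x
  proof -
    define \<psi> where "\<psi> u = f u - inner x u" for u
    have d: "GDERIV \<psi> u :> (D u - x)" for u
      unfolding \<psi>_def gderiv_def
      using D[of u, unfolded gderiv_def] by (auto intro!: derivative_eq_intros simp: inner_diff inner_commute)
    have lw: "\<psi> u + inner (D u - x) (v - u) + \<alpha> / 2 * (norm (v - u))\<^sup>2 \<le> \<psi> v" for u v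
      using lower[of u v] by (simp add: \<psi>_def inner_diff algebra_simps)
    have "continuous_on UNIV \<psi>" unfolding \<psi>_def by (intro continuous_intros cont)
    then obtain y where y: "\<And>y'. 0 + ereal (\<psi> y) \<le> 0 + ereal (\<psi> y')"
      using exists_minimizer_closed_convex_plus_strongly_convex[OF closed_convex_proper_zero \<alpha> _ lw[of 0]] by blast
    have "\<psi> y + inner (D y - x) (v - y) \<le> \<psi> v" for v
    proof -
      have "0 \<le> \<alpha> / 2 * (norm (v - y))\<^sup>2" using \<alpha> by simp
      then show ?thesis using lw[of y v] by linarith
    qed
    then have "is_subgradient (\<lambda>_. 0) y (- (D y - x))"
      using minimizer_iff_is_subgradient[OF closed_convex_proper_zero d] y by blast
    \<comment> \<open>A subgradient of the zero function vanishes, as testing it in its own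
      direction shows.\<close>
    then have "0 + ereal (inner (- (D y - x)) ((y - (D y - x)) - y)) \<le> 0" unfolding is_subgradient_def by blast
    then have "inner (x - D y) (x - D y) \<le> 0" by simp
    then have "D y = x" by (metis inner_gt_zero_iff linorder_not_less right_minus_eq)
    then show ?thesis by blast
  qed
  then obtain U where U: "\<And>x. D (U x) = x" by metis
  define fs where "fs x = inner x (U x) - f (U x)" for x
  have convex: "f (U x) + inner x (v - U x) \<le> f v" for x v
  proof -
    have "0 \<le> \<alpha> / 2 * (norm (v - U x))\<^sup>2" using \<alpha> by simp
    then show ?thesis using lower[of "U x" v] unfolding U by linarith
  qed
  have fs: "conjugate (\<lambda>u. ereal (f u)) x = ereal (fs x)" for x
    unfolding fs_def by (rule conjugate_at_subgradient[OF convex])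
  have young: "inner x v - f v \<le> fs x" for x v using convex[of x v] by (simp add: fs_def inner_diff_right)
  have fs_lower: "fs x + inner (U x) (x' - x) + 1 / (2 * \<beta>) * (norm (x' - x))\<^sup>2 \<le> fs x'" for x x'
  proof -
    define w where "w = x' - x"
    \<comment> \<open>This \<open>v\<close> maximises the lower estimate of
      \<open>inner x' v - f v\<close> obtained from the upper quadratic model of \<open>f\<close> at
      \<open>U x\<close>.\<close>
    define v where "v = U x + (1 / \<beta>) *\<^sub>R w"
    have "f v \<le> f (U x) + inner x ((1 / \<beta>) *\<^sub>R w) + \<beta> / 2 * (norm ((1 / \<beta>) *\<^sub>R w))\<^sup>2"
      using upper[of v "U x"] U by (simp add: v_def)
    also have "\<beta> / 2 * (norm ((1 / \<beta>) *\<^sub>R w))\<^sup>2 = 1 / (2 * \<beta>) * (norm w)\<^sup>2"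
      using \<beta> by (simp add: power_divide power2_eq_square)
    finally have 1: "f v \<le> f (U x) + inner x w / \<beta> + 1 / (2 * \<beta>) * (norm w)\<^sup>2" by simp
    have x': "x' = x + w" by (simp add: w_def)
    have "inner x' v = inner x (U x) + inner w (U x) + inner x w / \<beta> + inner w w / \<beta>"
      by (simp add: v_def x' inner_add add_divide_distrib)
    moreover have "inner w w / \<beta> = 2 * (1 / (2 * \<beta>) * (norm w)\<^sup>2)"
      by (simp add: power2_norm_eq_inner)
    ultimately have "fs x + inner (U x) w + 1 / (2 * \<beta>) * (norm w)\<^sup>2 \<le> inner x' v - f v"
      using 1 by (simp add: fs_def inner_commute)
    also have "\<dots> \<le> fs x'" by (rule young)
    finally show ?thesis by (simp add: w_def)
  qed
  have U_lip: "norm (U x - U x') \<le> norm (x - x') / \<alpha>" for x x'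
  proof -
    define w where "w = U x - U x'"
    have "\<alpha> * (norm w)\<^sup>2 \<le> inner (x - x') w"
      using lower[of "U x" "U x'"] lower[of "U x'" "U x"]
      by (simp add: U w_def inner_diff norm_minus_commute algebra_simps)
    also have "\<dots> \<le> norm (x - x') * norm w" by (rule norm_cauchy_schwarz)
    finally have "(\<alpha> * norm w) * norm w \<le> norm (x - x') * norm w" by (simp add: power2_eq_square)
    then have "\<alpha> * norm w \<le> norm (x - x')" by (cases "w = 0") auto
    then show ?thesis using \<alpha> by (simp add: w_def field_simps)
  qed
  have "GDERIV fs x :> U x" for x
  proof (rule gderiv_if_quadratic_remainder[where C = "1 / \<alpha>"])
    fix x'
    have pos: "0 \<le> 1 / (2 * \<beta>) * (norm (x' - x))\<^sup>2" "0 \<le> 1 / (2 * \<beta>) * (norm (x - x'))\<^sup>2" using \<beta> by simp_all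
    \<comment> \<open>The upper half of the squeeze is the lower model based at \<open>x'\<close>
      instead of \<open>x\<close>.\<close>
    have "fs x' - fs x - inner (U x) (x' - x) \<le> inner (U x' - U x) (x' - x)"
      using fs_lower[of x' x] pos(2) by (simp add: inner_diff)
    also have "\<dots> \<le> norm (U x' - U x) * norm (x' - x)" by (rule norm_cauchy_schwarz)
    also have "\<dots> \<le> norm (x' - x) / \<alpha> * norm (x' - x)" using U_lip by (rule mult_right_mono) simp
    finally have "fs x' - fs x - inner (U x) (x' - x) \<le> 1 / \<alpha> * (norm (x' - x))\<^sup>2" by (simp add: power2_eq_square)
    moreover have "0 \<le> fs x' - fs x - inner (U x) (x' - x)" using fs_lower[of x x'] pos(1) by simp
    ultimately show "\<bar>fs x' - fs x - inner (U x) (x' - x)\<bar> \<le> 1 / \<alpha> * (norm (x' - x))\<^sup>2" by simp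
  qed
  then show ?thesis using that fs fs_lower U_lip by blast
qed

section \<open>Singular value bounds\<close>

lemma inner_transpose_matrix_vector:
  fixes K :: "real^'n^'m"
  shows "inner (transpose K *v y) x = inner y (K *v x)"
  by (simp add: dot_lmul_matrix)

text \<open>If \<open>w = B v\<close> were nonzero, moving from \<open>v\<close> slightly against
  \<open>w\<close> would make the form negative, the first-order term being
  \<open>2 * t * inner w w\<close>.\<close>

lemma psd_quadratic_form_zero_imp_kernel:
  assumes lin: "linear B" and sym: "\<And>x y. inner (B x) y = inner x (B y)"
    and psd: "\<And>x. 0 \<le> inner (B x) x" and v: "inner (B v) v = 0"
  shows "B v = 0"
proof -
  define w where "w = B v"
  have q: "0 \<le> 2 * t * inner w w + t\<^sup>2 * inner (B w) w" for t
    using psd[of "v + t *\<^sub>R w"] v sym[of w v]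
    by (simp add: linear_add[OF lin] linear_scale[OF lin] inner_add w_def[symmetric] inner_commute power2_eq_square algebra_simps)
  define c where "c = inner (B w) w"
  define N where "N = inner w w"
  \<comment> \<open>Small enough that \<open>s * c \<le> N\<close>, while nonnegativity at
    \<open>- s\<close> would force \<open>2 * N \<le> s * c\<close>.\<close>
  define s where "s = N / (c + 1)"
  have c: "0 \<le> c" "0 \<le> N" using psd by (simp_all add: c_def N_def)
  have "0 \<le> 2 * (- s) * N + (- s)\<^sup>2 * c" unfolding c_def N_def by (rule q)
  then have "s * (2 * N) \<le> s * (s * c)" by (simp add: power2_eq_square algebra_simps)
  have "N \<le> 0"
  proof (rule ccontr)
    assume "\<not> N \<le> 0"
    then have N: "N > 0" by simp
    then have "s > 0" using c by (simp add: s_def)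
    with \<open>s * (2 * N) \<le> s * (s * c)\<close> have "2 * N \<le> s * c" by simp
    also have "\<dots> \<le> N" using c N by (simp add: s_def divide_le_eq)
    finally show False using N by simp
  qed
  then show ?thesis unfolding N_def w_def by (metis inner_gt_zero_iff linorder_not_less)
qed

text \<open>The maximum \<mu> of the form on the unit sphere is an eigenvalue: the form of
  \<open>\<mu> I - A\<close> is nonnegative and vanishes at the maximiser, which therefore lies in
  its kernel.\<close>

lemma quadratic_form_le_max_eigenvalue:
  fixes A :: "real^'m^'m" and c :: real
  assumes sym: "\<And>x y. inner (A *v x) y = inner x (A *v y)"
    and eig: "\<And>\<mu> v. v \<noteq> 0 \<Longrightarrow> A *v v = \<mu> *\<^sub>R v \<Longrightarrow> \<mu> \<le> c"
  shows "inner (A *v x) x \<le> c * (norm x)\<^sup>2"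
proof -
  let ?q = "\<lambda>x. inner (A *v x) x"
  have "continuous_on (sphere 0 1) ?q"
    by (intro continuous_intros matrix_vector_mult_linear_continuous_on)
  \<comment> \<open>Any unit vector shows that the sphere is nonempty.\<close>
  moreover have "axis undefined 1 \<in> sphere (0::real^'m) 1" by simp
  ultimately obtain v where v: "norm v = 1" "\<And>y. norm y = 1 \<Longrightarrow> ?q y \<le> ?q v"
    using continuous_attains_sup[of "sphere (0::real^'m) 1" ?q] by (auto simp: compact_sphere)
  define \<mu> where "\<mu> = ?q v"
  have q: "?q y \<le> \<mu> * (norm y)\<^sup>2" for y
  proof (cases "y = 0")
    case False
    then have "?q ((1 / norm y) *\<^sub>R y) \<le> \<mu>" unfolding \<mu>_def by (intro v(2)) simp
    then show ?thesis using False
      by (simp add: matrix_vector_mult_scaleR power2_eq_square field_simps)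
  qed simp
  define B where "B y = \<mu> *\<^sub>R y - A *v y" for y
  have "B v = 0"
  proof (rule psd_quadratic_form_zero_imp_kernel[of B v])
    show "linear B" unfolding B_def
      by (rule linearI) (simp_all add: matrix_vector_right_distrib matrix_vector_mult_scaleR algebra_simps)
    show "inner (B x) y = inner x (B y)" for x y by (simp add: B_def inner_diff sym)
    show "0 \<le> inner (B x) x" for x using q[of x] by (simp add: B_def inner_diff_left power2_norm_eq_inner)
    show "inner (B v) v = 0" using v(1) by (simp add: B_def inner_diff_left \<mu>_def norm_eq_1)
  qed
  then have "A *v v = \<mu> *\<^sub>R v" by (simp add: B_def)
  moreover have "v \<noteq> 0" using v(1) by auto
  ultimately have "\<mu> \<le> c" by (rule eig[rotated])
  then have "\<mu> * (norm x)\<^sup>2 \<le> c * (norm x)\<^sup>2" by (rule mult_right_mono) simp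
  then show ?thesis using q[of x] by linarith
qed

text \<open>The form of \<open>K ** transpose K\<close> is the squared norm of the transpose, and
  its eigenvalues are squares of singular values.\<close>

lemma singular_values_bound_transpose:
  fixes K :: "real^'n^'m"
  assumes sv: "\<And>\<sigma>. singular_value K \<sigma> \<Longrightarrow> lo \<le> \<sigma> \<and> \<sigma> \<le> hi" and lo: "0 \<le> lo" "lo \<le> hi"
  shows "lo * norm y \<le> norm (transpose K *v y)" "norm (transpose K *v y) \<le> hi * norm y"
    "norm (K *v x) \<le> hi * norm x"
proof -
  define A where "A = K ** transpose K"
  have form: "inner (A *v x) y = inner (transpose K *v x) (transpose K *v y)" for x y
    by (metis A_def inner_commute inner_transpose_matrix_vector matrix_vector_mul_assoc)
  have sq: "inner (A *v x) x = (norm (transpose K *v x))\<^sup>2" for x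
    by (simp add: form power2_norm_eq_inner)
  have symA: "inner (A *v x) y = inner x (A *v y)" for x y
    by (metis form inner_commute)
  have eig: "lo\<^sup>2 \<le> \<mu> \<and> \<mu> \<le> hi\<^sup>2" if v: "v \<noteq> 0" "A *v v = \<mu> *\<^sub>R v" for \<mu> v
  proof -
    have "\<mu> * inner v v = (norm (transpose K *v v))\<^sup>2" using sq[of v] v(2) by simp
    then have "0 \<le> \<mu> * inner v v" by simp
    moreover have "0 < inner v v" using v(1) by simp
    ultimately have "0 \<le> \<mu>" by (simp add: zero_le_mult_iff)
    then have "singular_value K (sqrt \<mu>)" using v unfolding singular_value_def A_def by auto
    then have "lo \<le> sqrt \<mu>" "sqrt \<mu> \<le> hi" using sv by auto
    then show ?thesis
      using power_mono[of lo "sqrt \<mu>" 2] power_mono[of "sqrt \<mu>" hi 2] lo \<open>0 \<le> \<mu>\<close> by simp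
  qed
  have up: "norm (transpose K *v y) \<le> hi * norm y" for y
  proof (rule power2_le_imp_le)
    have "inner (A *v y) y \<le> hi\<^sup>2 * (norm y)\<^sup>2"
      using eig by (intro quadratic_form_le_max_eigenvalue symA) blast
    then show "(norm (transpose K *v y))\<^sup>2 \<le> (hi * norm y)\<^sup>2" by (simp add: sq power_mult_distrib)
  qed (use lo in auto)
  then show "norm (transpose K *v y) \<le> hi * norm y" .
  show "lo * norm y \<le> norm (transpose K *v y)"
  proof (rule power2_le_imp_le)
    \<comment> \<open>The lower bound for \<open>A\<close> is the upper bound for
      \<open>- A\<close>.\<close>
    have "inner ((- A) *v y) y \<le> (- lo\<^sup>2) * (norm y)\<^sup>2"
    proof (rule quadratic_form_le_max_eigenvalue)
      have neg: "(- A) *v x = - (A *v x)" for x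
        by (simp add: vec_eq_iff matrix_vector_mult_def sum_negf)
      show "inner ((- A) *v x) y = inner x ((- A) *v y)" for x y 
        unfolding neg inner_minus_left inner_minus_right symA ..
      fix \<mu> v assume v: "v \<noteq> 0" "(- A) *v v = \<mu> *\<^sub>R v"
      then have "- (A *v v) = \<mu> *\<^sub>R v" unfolding neg by simp
      then have "A *v v = (- \<mu>) *\<^sub>R v" using minus_equation_iff[of "A *v v"] by simp
      then have "lo\<^sup>2 \<le> - \<mu>" using eig[OF v(1)] by blast
      then show "\<mu> \<le> - lo\<^sup>2" by simp
    qed
    moreover have "(- A) *v y = - (A *v y)" by (simp add: vec_eq_iff matrix_vector_mult_def sum_negf)
    ultimately show "(lo * norm y)\<^sup>2 \<le> (norm (transpose K *v y))\<^sup>2" by (simp add: sq power_mult_distrib)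
  qed simp
  \<comment> \<open>By duality the bound on the transpose bounds \<open>K\<close>.\<close>
  have "(norm (K *v x))\<^sup>2 = inner (transpose K *v (K *v x)) x"
    by (simp only: inner_transpose_matrix_vector power2_norm_eq_inner)
  also have "\<dots> \<le> norm (transpose K *v (K *v x)) * norm x" by (rule norm_cauchy_schwarz)
  also have "\<dots> \<le> (hi * norm (K *v x)) * norm x" using up by (rule mult_right_mono) simp
  finally have "norm (K *v x) * norm (K *v x) \<le> (hi * norm x) * norm (K *v x)" by (simp add: power2_eq_square mult_ac)
  then show "norm (K *v x) \<le> hi * norm x"
    using lo by (cases "K *v x = 0") auto
qed

section \<open>The dual problem\<close>

text \<open>The chain rule through the linear map. The modulus \<open>1 / \<beta>\<close> of the
  conjugate gains \<open>lo\<^sup>2\<close> because the transpose stretches by at least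
  \<open>lo\<close>; the Lipschitz constant \<open>1 / \<alpha>\<close> of its gradient gains one
  \<open>hi\<close> from the transpose and one from \<open>K\<close>.\<close>

lemma dual_term_properties:
  fixes f :: "real^'n \<Rightarrow> real" and K :: "real^'n^'m"
  defines "fs \<equiv> \<lambda>x. real_of_ereal (conjugate (\<lambda>u. ereal (f u)) x)"
    and "\<phi> \<equiv> \<lambda>y. real_of_ereal (conjugate (\<lambda>u. ereal (f u)) (- (transpose K *v y)))"
  assumes params: "0 < \<alpha>" "\<alpha> \<le> \<beta>" "0 < lo" "lo \<le> hi"
    and diff: "\<And>x. f differentiable (at x)" and sc: "strongly_convex_on \<alpha> UNIV f"
    and lip: "\<beta>-lipschitz_on UNIV (gradient f)"
    and sv: "\<And>\<sigma>. singular_value K \<sigma> \<Longrightarrow> lo \<le> \<sigma> \<and> \<sigma> \<le> hi"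
  shows "conjugate (\<lambda>u. ereal (f u)) x = ereal (fs x)"
    and "fs differentiable (at x)"
    and "GDERIV \<phi> y :> - (K *v gradient fs (- (transpose K *v y)))"
    and "\<phi> y + inner (gradient \<phi> y) (y' - y) + (lo\<^sup>2 / \<beta>) / 2 * (norm (y' - y))\<^sup>2 \<le> \<phi> y'"
    and "(hi\<^sup>2 / \<alpha>)-lipschitz_on UNIV (gradient \<phi>)"
proof -
  note [simp del] = transpose_matrix_vector
  have \<beta>: "0 < \<beta>" using params by simp
  have D: "GDERIV f x :> gradient f x" for x using diff by (rule differentiable_imp_gderiv_gradient)
  obtain F U where F: "\<And>x. conjugate (\<lambda>u. ereal (f u)) x = ereal (F x)" "\<And>x. GDERIV F x :> U x"
    "\<And>x x'. F x + inner (U x) (x' - x) + 1 / (2 * \<beta>) * (norm (x' - x))\<^sup>2 \<le> F x'"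
    "\<And>x x'. norm (U x - U x') \<le> norm (x - x') / \<alpha>"
    using conjugate_strongly_convex_smooth[OF params(1) \<beta> D strongly_convex_first_order[OF sc D] descent_lemma[OF D lip]]
    by blast
  have fs: "fs = F" by (simp add: fs_def F(1))
  have \<phi>: "\<phi> = (\<lambda>y. F (- (transpose K *v y)))" by (simp add: \<phi>_def F(1))
  have grad: "gradient F = U" using F(2) gradient_eqI by blast
  note K = singular_values_bound_transpose[where K = K, OF sv less_imp_le[OF params(3)] params(4)]
  show "conjugate (\<lambda>u. ereal (f u)) x = ereal (fs x)" by (simp add: fs F(1))
  show "fs differentiable (at x)" using F(2)[of x] unfolding fs gderiv_def differentiable_def by blast
  have G: "GDERIV \<phi> y :> - (K *v U (- (transpose K *v y)))" for y
  proof -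
    have "((\<lambda>y. - (transpose K *v y)) has_derivative (\<lambda>h. - (transpose K *v h))) (at y)"
      by (intro has_derivative_minus bounded_linear_imp_has_derivative) simp
    from has_derivative_compose[OF this F(2)[unfolded gderiv_def]]
    have "(\<phi> has_derivative (\<lambda>h. inner (- (transpose K *v h)) (U (- (transpose K *v y))))) (at y)"
      by (simp add: \<phi>)
    then show ?thesis unfolding gderiv_def
      by (rule has_derivative_eq_rhs) (simp only: inner_minus_left inner_minus_right inner_transpose_matrix_vector)
  qed
  then show "GDERIV \<phi> y :> - (K *v gradient fs (- (transpose K *v y)))" by (simp add: fs grad)
  have grad\<phi>: "gradient \<phi> y = - (K *v U (- (transpose K *v y)))" for y using G by (rule gradient_eqI)
  show "\<phi> y + inner (gradient \<phi> y) (y' - y) + (lo\<^sup>2 / \<beta>) / 2 * (norm (y' - y))\<^sup>2 \<le> \<phi> y'"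
  proof -
    define w where "w = y' - y"
    define x where "x = - (transpose K *v y)"
    have w: "- (transpose K *v y') - x = - (transpose K *v w)"
      by (simp add: x_def w_def matrix_vector_mult_diff_distrib)
    have "(lo * norm w)\<^sup>2 \<le> (norm (transpose K *v w))\<^sup>2" using params by (intro power_mono K(1)) auto
    then have "(lo\<^sup>2 / \<beta>) / 2 * (norm w)\<^sup>2 \<le> 1 / (2 * \<beta>) * (norm (transpose K *v w))\<^sup>2"
      using \<beta> by (simp add: power_mult_distrib field_simps)
    moreover have "inner (gradient \<phi> y) w = inner (U x) (- (transpose K *v w))"
      unfolding grad\<phi> x_def[symmetric] inner_minus_left inner_minus_right
      by (simp only: inner_commute[of "U x"] inner_transpose_matrix_vector) (simp only: inner_commute)
    moreover have "\<phi> y = F x" "\<phi> y' = F (- (transpose K *v y'))" by (simp_all add: \<phi> x_def)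
    ultimately show ?thesis using F(3)[of x "- (transpose K *v y')"] unfolding w w_def[symmetric] norm_minus_cancel by linarith
  qed
  show "(hi\<^sup>2 / \<alpha>)-lipschitz_on UNIV (gradient \<phi>)"
  proof (rule lipschitz_onI)
    fix y y'
    let ?x = "\<lambda>y. - (transpose K *v y)"
    have "dist (gradient \<phi> y) (gradient \<phi> y') = norm (K *v (U (?x y) - U (?x y')))"
      by (simp add: grad\<phi> dist_norm matrix_vector_mult_diff_distrib norm_minus_commute)
    also have "\<dots> \<le> hi * norm (U (?x y) - U (?x y'))" by (rule K(3))
    also have "\<dots> \<le> hi * (norm (?x y - ?x y') / \<alpha>)" using params by (intro mult_left_mono F(4)) auto
    also have "norm (?x y - ?x y') = norm (transpose K *v (y - y'))"
      by (simp add: matrix_vector_mult_diff_distrib norm_minus_commute)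
    also have "hi * (norm (transpose K *v (y - y')) / \<alpha>) \<le> hi * (hi * norm (y - y') / \<alpha>)"
      using params by (intro mult_left_mono divide_right_mono K(2)) auto
    finally show "dist (gradient \<phi> y) (gradient \<phi> y') \<le> hi\<^sup>2 / \<alpha> * dist y y'"
      by (simp add: dist_norm power2_eq_square)
  qed (use params in simp)
qed

lemma gradient_strongly_monotone:
  assumes "\<And>y y'. \<phi> y + inner (D y) (y' - y) + a / 2 * (norm (y' - y))\<^sup>2 \<le> \<phi> y'"
  shows "a * (norm (y - y'))\<^sup>2 \<le> inner (D y - D y') (y - y')"
  using assms[of y y'] assms[of y' y] by (simp add: inner_diff norm_minus_commute algebra_simps)

text \<open>Expand the square: strong monotonicity bounds the cross term, the Lipschitz constant the
  last one.\<close>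

lemma gradient_step_contraction:
  assumes lower: "\<And>y y'. \<phi> y + inner (D y) (y' - y) + a / 2 * (norm (y' - y))\<^sup>2 \<le> \<phi> y'"
    and lip: "b-lipschitz_on UNIV D" and \<gamma>: "0 \<le> \<gamma>"
  shows "norm ((y - \<gamma> *\<^sub>R D y) - (y' - \<gamma> *\<^sub>R D y')) \<le> sqrt (1 - 2 * \<gamma> * a + \<gamma>\<^sup>2 * b\<^sup>2) * norm (y - y')"
proof -
  define d where "d = y - y'"
  define e where "e = D y - D y'"
  have mono: "a * (norm d)\<^sup>2 \<le> inner e d" unfolding d_def e_def by (rule gradient_strongly_monotone[OF lower])
  have "norm e \<le> b * norm d" using lipschitz_onD[OF lip, of y y'] by (simp add: dist_norm d_def e_def)
  then have le: "(norm e)\<^sup>2 \<le> (b * norm d)\<^sup>2" by (rule power_mono) simp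
  have "(norm (d - \<gamma> *\<^sub>R e))\<^sup>2 = (norm d)\<^sup>2 - 2 * \<gamma> * inner e d + \<gamma>\<^sup>2 * (norm e)\<^sup>2"
    unfolding power2_norm_eq_inner by (simp add: inner_diff inner_commute power2_eq_square algebra_simps)
  also have "\<dots> \<le> (norm d)\<^sup>2 - 2 * \<gamma> * (a * (norm d)\<^sup>2) + \<gamma>\<^sup>2 * (b * norm d)\<^sup>2"
    using mult_left_mono[OF mono, of "2 * \<gamma>"] mult_left_mono[OF le, of "\<gamma>\<^sup>2"] \<gamma> by simp
  also have "\<dots> = (1 - 2 * \<gamma> * a + \<gamma>\<^sup>2 * b\<^sup>2) * (norm d)\<^sup>2" by (simp add: power_mult_distrib algebra_simps)
  finally have "norm (d - \<gamma> *\<^sub>R e) \<le> sqrt ((1 - 2 * \<gamma> * a + \<gamma>\<^sup>2 * b\<^sup>2) * (norm d)\<^sup>2)" by (rule real_le_rsqrt)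
  also have "\<dots> = sqrt (1 - 2 * \<gamma> * a + \<gamma>\<^sup>2 * b\<^sup>2) * norm d" by (simp add: real_sqrt_mult)
  finally show ?thesis by (simp add: d_def e_def algebra_simps)
qed

text \<open>Optimality means that \<open>- D y\<close> is a subgradient of \<open>g\<close>. Two
  such points coincide because \<open>D\<close> is strongly monotone and subgradients are
  monotone.\<close>

lemma dual_minimizer_unique_fixed_point:
  fixes g :: "real^'m \<Rightarrow> ereal"
  assumes g: "closed_convex_proper g" and a: "0 < a" and \<gamma>: "0 < \<gamma>"
    and D: "\<And>y. GDERIV \<phi> y :> D y"
    and lower: "\<And>y y'. \<phi> y + inner (D y) (y' - y) + a / 2 * (norm (y' - y))\<^sup>2 \<le> \<phi> y'"
  shows "\<exists>!y. \<forall>y'. ereal (\<phi> y) + g y \<le> ereal (\<phi> y') + g y'"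
    and "(\<forall>y'. ereal (\<phi> y) + g y \<le> ereal (\<phi> y') + g y') \<Longrightarrow> prox (\<lambda>u. ereal \<gamma> * g u) (y - \<gamma> *\<^sub>R D y) = y"
proof -
  have conv: "\<phi> y + inner (D y) (v - y) \<le> \<phi> v" for y v
  proof -
    have "0 \<le> a / 2 * (norm (v - y))\<^sup>2" using a by simp
    then show ?thesis using lower[of y v] by linarith
  qed
  have iff: "(\<forall>y'. ereal (\<phi> y) + g y \<le> ereal (\<phi> y') + g y') \<longleftrightarrow> is_subgradient g y (- D y)" for y
    using minimizer_iff_is_subgradient[OF g D conv] by (simp add: add.commute)
  have cont: "continuous_on UNIV \<phi>"
    using D unfolding gderiv_def by (meson continuous_at_imp_continuous_on has_derivative_continuous)
  obtain y0 where "\<And>y'. g y0 + ereal (\<phi> y0) \<le> g y' + ereal (\<phi> y')"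
    using exists_minimizer_closed_convex_plus_strongly_convex[OF g a cont lower[of 0]] by blast
  then have y0: "is_subgradient g y0 (- D y0)" unfolding iff[symmetric] by (simp add: add.commute)
  have uniq: "y = y'" if "is_subgradient g y (- D y)" "is_subgradient g y' (- D y')" for y y'
  proof -
    have "0 \<le> inner (- D y - - D y') (y - y')" by (rule is_subgradient_monotone[OF g that])
    then have "inner (D y - D y') (y - y') \<le> 0" by (simp add: inner_diff)
    with gradient_strongly_monotone[of \<phi> D a y y', OF lower] have "a * (norm (y - y'))\<^sup>2 \<le> 0" by linarith
    then show ?thesis using a by (simp add: mult_le_0_iff)
  qed
  show "\<exists>!y. \<forall>y'. ereal (\<phi> y) + g y \<le> ereal (\<phi> y') + g y'" unfolding iff using y0 uniq by blast
  assume "\<forall>y'. ereal (\<phi> y) + g y \<le> ereal (\<phi> y') + g y'"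
  \<comment> \<open>This vector is the difference between \<open>y - \<gamma> *\<^sub>R D y\<close>
    and \<open>y\<close>, as the prox characterisation requires.\<close>
  then have "is_subgradient (\<lambda>u. ereal \<gamma> * g u) y (\<gamma> *\<^sub>R (- D y))"
    unfolding iff by (simp only: is_subgradient_scale[OF g \<gamma>])
  then show "prox (\<lambda>u. ereal \<gamma> * g u) (y - \<gamma> *\<^sub>R D y) = y"
    by (intro prox_eqI closed_convex_proper_scale[OF g \<gamma>]) simp
qed

theorem theorem6:
  fixes \<Theta> :: "(real^'p) set"
    and f :: "real^'p \<Rightarrow> real^'n \<Rightarrow> real"
    and g :: "real^'p \<Rightarrow> real^'m \<Rightarrow> ereal"
    and K :: "real^'p \<Rightarrow> real^'n^'m"
    and \<alpha> \<beta> lam_lo lam_hi :: real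
  assumes \<Theta>: "\<Theta> \<noteq> {}" "connected \<Theta>" "open \<Theta>"
    and params: "0 < \<alpha>" "\<alpha> \<le> \<beta>" "0 < lam_lo" "lam_lo \<le> lam_hi"
    and f_C1: "\<And>\<theta>. \<theta> \<in> \<Theta> \<Longrightarrow> (\<forall>x. f \<theta> differentiable (at x)) \<and>
                 continuous_on UNIV (gradient (f \<theta>))"
    and f_sc: "\<And>\<theta>. \<theta> \<in> \<Theta> \<Longrightarrow> strongly_convex_on \<alpha> UNIV (f \<theta>)"
    and f_lip: "\<And>\<theta>. \<theta> \<in> \<Theta> \<Longrightarrow> \<beta>-lipschitz_on UNIV (gradient (f \<theta>))"
    and g_ccp: "\<And>\<theta>. \<theta> \<in> \<Theta> \<Longrightarrow> closed_convex_proper (g \<theta>)"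
    and K_surj: "\<And>\<theta>. \<theta> \<in> \<Theta> \<Longrightarrow> surj ((*v) (K \<theta>))"
    and K_sv: "\<And>\<theta> \<sigma>. \<theta> \<in> \<Theta> \<Longrightarrow> singular_value (K \<theta>) \<sigma> \<Longrightarrow> lam_lo \<le> \<sigma> \<and> \<sigma> \<le> lam_hi"
  shows
    \<comment> \<open>(i)\<close>
    "(\<forall>\<theta>\<in>\<Theta>.
       let fs = (\<lambda>x. real_of_ereal (conjugate (\<lambda>u. ereal (f \<theta> u)) x));
           \<phi> = (\<lambda>y. real_of_ereal (conjugate (\<lambda>u. ereal (f \<theta> u)) (- (transpose (K \<theta>) *v y))))
       in (\<forall>y. \<bar>conjugate (\<lambda>u. ereal (f \<theta> u)) (- (transpose (K \<theta>) *v y))\<bar> \<noteq> \<infinity>) \<and>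
          (\<forall>x. fs differentiable (at x)) \<and>
          strongly_convex_on (lam_lo\<^sup>2 / \<beta>) UNIV \<phi> \<and>
          (\<forall>y. GDERIV \<phi> y :> - (K \<theta> *v gradient fs (- (transpose (K \<theta>) *v y)))) \<and>
          (lam_hi\<^sup>2 / \<alpha>)-lipschitz_on UNIV (gradient \<phi>))
     \<and>
     \<comment> \<open>(ii)\<close>
     (\<forall>\<gamma>. let a = lam_lo\<^sup>2 / \<beta>; b = lam_hi\<^sup>2 / \<alpha>;
              fs = (\<lambda>\<theta> x. real_of_ereal (conjugate (\<lambda>u. ereal (f \<theta> u)) x));
              \<phi> = (\<lambda>\<theta> y. real_of_ereal (conjugate (\<lambda>u. ereal (f \<theta> u)) (- (transpose (K \<theta>) *v y))));
              T = (\<lambda>\<theta> y. prox (\<lambda>u. ereal \<gamma> * conjugate (g \<theta>) u) y);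
              Tj = (\<lambda>z. T (jfst z) (jsnd z));
              G = (\<lambda>z. gradient (\<phi> (jfst z)) (jsnd z));
              S = {z. jfst z \<in> \<Theta>};
              D = (\<lambda>\<theta> y. conjugate (\<lambda>u. ereal (f \<theta> u)) (- (transpose (K \<theta>) *v y))
                         + conjugate (g \<theta>) y);
              ys = (\<lambda>\<theta>. THE y. \<forall>y'. D \<theta> y \<le> D \<theta> y')
          in 0 < \<gamma> \<longrightarrow> \<gamma> < 2 * a / (a + b)\<^sup>2 \<longrightarrow>
             path_differentiable_on S Tj \<longrightarrow> path_differentiable_on S G \<longrightarrow>
             (\<forall>\<theta>\<in>\<Theta>. \<exists>!y. \<forall>y'. D \<theta> y \<le> D \<theta> y') \<and>
             path_differentiable_on \<Theta> ys \<and>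
             conservative_jac_on \<Theta> ys
               (\<lambda>\<theta>. {matrix_inv (mat 1 - blk2 MT ** (mat 1 - \<gamma> *\<^sub>R blk2 MG))
                        ** (blk1 MT - \<gamma> *\<^sub>R (blk2 MT ** blk1 MG)) | MT MG.
                      MT \<in> clarke_jac_on S Tj
                              (jpair \<theta> (ys \<theta> + \<gamma> *\<^sub>R (K \<theta> *v gradient (fs \<theta>)
                                                    (- (transpose (K \<theta>) *v ys \<theta>))))) \<and>
                      MG \<in> clarke_jac_on S G (jpair \<theta> (ys \<theta>))}))"
proof (intro conjI)
  define fs where "fs = (\<lambda>\<theta> x. real_of_ereal (conjugate (\<lambda>u. ereal (f \<theta> u)) x))"
  define \<phi> where "\<phi> = (\<lambda>\<theta> y. real_of_ereal (conjugate (\<lambda>u. ereal (f \<theta> u)) (- (transpose (K \<theta>) *v y))))"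
  define a where "a = lam_lo\<^sup>2 / \<beta>"
  define b where "b = lam_hi\<^sup>2 / \<alpha>"
  have ab: "0 < a" "0 < b" using params by (simp_all add: a_def b_def)
  note dual = dual_term_properties[OF params _ f_sc f_lip K_sv]
  have f_diff: "f \<theta> differentiable (at x)" if "\<theta> \<in> \<Theta>" for \<theta> x using f_C1[OF that] by blast
  have conj: "conjugate (\<lambda>u. ereal (f \<theta> u)) x = ereal (fs \<theta> x)" if "\<theta> \<in> \<Theta>" for \<theta> x
    unfolding fs_def using that by (intro dual(1) f_diff)
  have fs_diff: "fs \<theta> differentiable (at x)" if "\<theta> \<in> \<Theta>" for \<theta> x
    unfolding fs_def using that by (intro dual(2) f_diff)
  have D\<phi>: "GDERIV (\<phi> \<theta>) y :> - (K \<theta> *v gradient (fs \<theta>) (- (transpose (K \<theta>) *v y)))" if "\<theta> \<in> \<Theta>" for \<theta> y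
    unfolding fs_def \<phi>_def using that by (intro dual(3) f_diff)
  have lower: "\<phi> \<theta> y + inner (gradient (\<phi> \<theta>) y) (y' - y) + a / 2 * (norm (y' - y))\<^sup>2 \<le> \<phi> \<theta> y'"
    if "\<theta> \<in> \<Theta>" for \<theta> y y'
    unfolding \<phi>_def a_def using that by (intro dual(4) f_diff)
  have G_lip: "b-lipschitz_on UNIV (gradient (\<phi> \<theta>))" if "\<theta> \<in> \<Theta>" for \<theta>
    unfolding \<phi>_def b_def using that by (intro dual(5) f_diff)
  have grad\<phi>: "gradient (\<phi> \<theta>) y = - (K \<theta> *v gradient (fs \<theta>) (- (transpose (K \<theta>) *v y)))" if "\<theta> \<in> \<Theta>" for \<theta> y
    using D\<phi>[OF that] by (rule gradient_eqI)
  have D\<phi>': "GDERIV (\<phi> \<theta>) y :> gradient (\<phi> \<theta>) y" if "\<theta> \<in> \<Theta>" for \<theta> y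
    using D\<phi>[OF that] grad\<phi>[OF that] by simp
  show "\<forall>\<theta>\<in>\<Theta>.
       let fs = (\<lambda>x. real_of_ereal (conjugate (\<lambda>u. ereal (f \<theta> u)) x));
           \<phi> = (\<lambda>y. real_of_ereal (conjugate (\<lambda>u. ereal (f \<theta> u)) (- (transpose (K \<theta>) *v y))))
       in (\<forall>y. \<bar>conjugate (\<lambda>u. ereal (f \<theta> u)) (- (transpose (K \<theta>) *v y))\<bar> \<noteq> \<infinity>) \<and>
          (\<forall>x. fs differentiable (at x)) \<and>
          strongly_convex_on (lam_lo\<^sup>2 / \<beta>) UNIV \<phi> \<and>
          (\<forall>y. GDERIV \<phi> y :> - (K \<theta> *v gradient fs (- (transpose (K \<theta>) *v y)))) \<and>
          (lam_hi\<^sup>2 / \<alpha>)-lipschitz_on UNIV (gradient \<phi>)"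
    unfolding Let_def
  proof (intro ballI, goal_cases)
    case (1 \<theta>)
    have "strongly_convex_on a UNIV (\<phi> \<theta>)" by (rule strongly_convex_if_first_order[OF lower[OF 1]])
    moreover have "\<bar>conjugate (\<lambda>u. ereal (f \<theta> u)) x\<bar> \<noteq> \<infinity>" for x by (simp add: conj[OF 1])
    ultimately show ?case
      using fs_diff[OF 1] D\<phi>[OF 1] G_lip[OF 1] unfolding fs_def \<phi>_def a_def b_def
      by (intro conjI allI)
  qed
  show "\<forall>\<gamma>. let a = lam_lo\<^sup>2 / \<beta>; b = lam_hi\<^sup>2 / \<alpha>;
              fs = (\<lambda>\<theta> x. real_of_ereal (conjugate (\<lambda>u. ereal (f \<theta> u)) x));
              \<phi> = (\<lambda>\<theta> y. real_of_ereal (conjugate (\<lambda>u. ereal (f \<theta> u)) (- (transpose (K \<theta>) *v y))));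
              T = (\<lambda>\<theta> y. prox (\<lambda>u. ereal \<gamma> * conjugate (g \<theta>) u) y);
              Tj = (\<lambda>z. T (jfst z) (jsnd z));
              G = (\<lambda>z. gradient (\<phi> (jfst z)) (jsnd z));
              S = {z. jfst z \<in> \<Theta>};
              D = (\<lambda>\<theta> y. conjugate (\<lambda>u. ereal (f \<theta> u)) (- (transpose (K \<theta>) *v y))
                         + conjugate (g \<theta>) y);
              ys = (\<lambda>\<theta>. THE y. \<forall>y'. D \<theta> y \<le> D \<theta> y')
          in 0 < \<gamma> \<longrightarrow> \<gamma> < 2 * a / (a + b)\<^sup>2 \<longrightarrow>
             path_differentiable_on S Tj \<longrightarrow> path_differentiable_on S G \<longrightarrow>
             (\<forall>\<theta>\<in>\<Theta>. \<exists>!y. \<forall>y'. D \<theta> y \<le> D \<theta> y') \<and>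
             path_differentiable_on \<Theta> ys \<and>
             conservative_jac_on \<Theta> ys
               (\<lambda>\<theta>. {matrix_inv (mat 1 - blk2 MT ** (mat 1 - \<gamma> *\<^sub>R blk2 MG))
                        ** (blk1 MT - \<gamma> *\<^sub>R (blk2 MT ** blk1 MG)) | MT MG.
                      MT \<in> clarke_jac_on S Tj
                              (jpair \<theta> (ys \<theta> + \<gamma> *\<^sub>R (K \<theta> *v gradient (fs \<theta>)
                                                    (- (transpose (K \<theta>) *v ys \<theta>))))) \<and>
                      MG \<in> clarke_jac_on S G (jpair \<theta> (ys \<theta>))})"
    unfolding Let_def
  proof (intro allI impI, goal_cases)
    case (1 \<gamma>)
    define Tj where "Tj = (\<lambda>z :: real^('p + 'm). prox (\<lambda>u. ereal \<gamma> * conjugate (g (jfst z)) u) (jsnd z))"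
    define G where "G = (\<lambda>z :: real^('p + 'm). gradient (\<phi> (jfst z)) (jsnd z))"
    define D where "D = (\<lambda>\<theta> y. conjugate (\<lambda>u. ereal (f \<theta> u)) (- (transpose (K \<theta>) *v y)) + conjugate (g \<theta>) y)"
    define ys where "ys = (\<lambda>\<theta>. THE y. \<forall>y'. D \<theta> y \<le> D \<theta> y')"
    have \<gamma>: "0 < \<gamma>" "\<gamma> < 2 * a / (a + b)\<^sup>2" using 1(1,2) by (simp_all only: a_def b_def)
    have pd: "path_differentiable_on {z. jfst z \<in> \<Theta>} Tj" "path_differentiable_on {z. jfst z \<in> \<Theta>} G"
      using 1(3,4) by (simp_all only: Tj_def G_def \<phi>_def)
    define q where "q = sqrt (1 - 2 * \<gamma> * a + \<gamma>\<^sup>2 * b\<^sup>2)"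
    \<comment> \<open>\<open>q < 1\<close> amounts to \<open>\<gamma> * b\<^sup>2 < 2 * a\<close>,
      which the step-size condition implies since \<open>b \<le> a + b\<close>.\<close>
    have q: "q < 1"
    proof -
      have "\<gamma> * (a + b)\<^sup>2 < 2 * a" using \<gamma>(2) ab by (simp add: pos_less_divide_eq)
      moreover have "\<gamma> * b\<^sup>2 \<le> \<gamma> * (a + b)\<^sup>2" using \<gamma>(1) ab by (intro mult_left_mono power_mono) auto
      ultimately have "\<gamma> * b\<^sup>2 < 2 * a" by linarith
      then have "\<gamma> * (\<gamma> * b\<^sup>2) < \<gamma> * (2 * a)" using \<gamma>(1) by (rule mult_strict_left_mono)
      then have "1 - 2 * \<gamma> * a + \<gamma>\<^sup>2 * b\<^sup>2 < 1" by (simp add: power2_eq_square mult_ac)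
      then show ?thesis by (simp add: q_def)
    qed
    have gs: "closed_convex_proper (conjugate (g \<theta>))" if "\<theta> \<in> \<Theta>" for \<theta>
      by (rule closed_convex_proper_conjugate[OF g_ccp[OF that]])
    have D_eq: "D \<theta> y = ereal (\<phi> \<theta> y) + conjugate (g \<theta>) y" if "\<theta> \<in> \<Theta>" for \<theta> y
      using conj[OF that] by (simp add: D_def \<phi>_def)
    have ex1: "\<exists>!y. \<forall>y'. D \<theta> y \<le> D \<theta> y'" if "\<theta> \<in> \<Theta>" for \<theta>
      unfolding D_eq[OF that]
      by (rule dual_minimizer_unique_fixed_point(1)[OF gs[OF that] ab(1) \<gamma>(1) D\<phi>'[OF that] lower[OF that]])
    have fixed: "Tj (jpair \<theta> (ys \<theta> - \<gamma> *\<^sub>R G (jpair \<theta> (ys \<theta>)))) = ys \<theta>" if "\<theta> \<in> \<Theta>" for \<theta>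
    proof -
      have "\<forall>y'. D \<theta> (ys \<theta>) \<le> D \<theta> y'" unfolding ys_def by (rule theI'[OF ex1[OF that]])
      then show ?thesis unfolding D_eq[OF that] Tj_def G_def jpair_simps
        by (rule dual_minimizer_unique_fixed_point(2)[OF gs[OF that] ab(1) \<gamma>(1) D\<phi>'[OF that] lower[OF that]])
    qed
    have nonexp: "norm (Tj (jpair \<theta> y) - Tj (jpair \<theta> y')) \<le> norm (y - y')" if "\<theta> \<in> \<Theta>" for \<theta> y y'
      unfolding Tj_def jpair_simps by (rule prox_nonexpansive[OF closed_convex_proper_scale[OF gs[OF that] \<gamma>(1)]])
    have contr: "norm ((y - \<gamma> *\<^sub>R G (jpair \<theta> y)) - (y' - \<gamma> *\<^sub>R G (jpair \<theta> y'))) \<le> q * norm (y - y')"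
      if "\<theta> \<in> \<Theta>" for \<theta> y y'
      unfolding G_def jpair_simps q_def
      by (rule gradient_step_contraction[OF lower[OF that] G_lip[OF that] less_imp_le[OF \<gamma>(1)]])
    note B = \<Theta>(3) pd \<gamma>(1) q nonexp contr fixed
    have lip: "loc_lipschitz_on \<Theta> ys" by (rule fixed_point_loc_lipschitz[OF B])
    \<comment> \<open>The sign changes because the gradient of the dual term is minus
      \<open>K \<theta>\<close> applied to the gradient of the conjugate.\<close>
    have pt: "ys \<theta> - \<gamma> *\<^sub>R G (jpair \<theta> (ys \<theta>)) =
        ys \<theta> + \<gamma> *\<^sub>R (K \<theta> *v gradient (fs \<theta>) (- (transpose (K \<theta>) *v ys \<theta>)))" if "\<theta> \<in> \<Theta>" for \<theta>
      by (simp add: G_def grad\<phi>[OF that])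
    have cons: "conservative_jac_on \<Theta> ys
               (\<lambda>\<theta>. {matrix_inv (mat 1 - blk2 MT ** (mat 1 - \<gamma> *\<^sub>R blk2 MG))
                        ** (blk1 MT - \<gamma> *\<^sub>R (blk2 MT ** blk1 MG)) | MT MG.
                      MT \<in> clarke_jac_on {z. jfst z \<in> \<Theta>} Tj
                              (jpair \<theta> (ys \<theta> + \<gamma> *\<^sub>R (K \<theta> *v gradient (fs \<theta>)
                                                    (- (transpose (K \<theta>) *v ys \<theta>))))) \<and>
                      MG \<in> clarke_jac_on {z. jfst z \<in> \<Theta>} G (jpair \<theta> (ys \<theta>))})"
      \<comment> \<open>The identity \<open>pt\<close> is available only over \<Theta>, hence the
        congruence rule rather than a rewrite under the binder.\<close>
      by (rule conservative_jac_on_cong[THEN iffD1, OF _ fixed_point_conservative_jac[OF B]]) (simp only: pt)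
    have "path_differentiable_on \<Theta> ys" using lip cons unfolding path_differentiable_on_def by blast
    then have "(\<forall>\<theta>\<in>\<Theta>. \<exists>!y. \<forall>y'. D \<theta> y \<le> D \<theta> y') \<and> path_differentiable_on \<Theta> ys \<and>
        conservative_jac_on \<Theta> ys
               (\<lambda>\<theta>. {matrix_inv (mat 1 - blk2 MT ** (mat 1 - \<gamma> *\<^sub>R blk2 MG))
                        ** (blk1 MT - \<gamma> *\<^sub>R (blk2 MT ** blk1 MG)) | MT MG.
                      MT \<in> clarke_jac_on {z. jfst z \<in> \<Theta>} Tj
                              (jpair \<theta> (ys \<theta> + \<gamma> *\<^sub>R (K \<theta> *v gradient (fs \<theta>)
                                                    (- (transpose (K \<theta>) *v ys \<theta>))))) \<and>
                      MG \<in> clarke_jac_on {z. jfst z \<in> \<Theta>} G (jpair \<theta> (ys \<theta>))})"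
      using ex1 cons by simp
    then show ?case unfolding ys_def D_def Tj_def G_def fs_def \<phi>_def .
  qed
qed

end
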